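(* There is a multithreaded algorithm that, given a batch $T$ of $n$ items and a condition $C$ on items, returns a batch containing exactly the items of $T$ satisfying $C$, in the same order as in $T$, stored as a complete binary tree, and that takes $O(n\cdot w)$ work and $O(\log n+s)$ span whenever every evaluation of $C$ takes $O(w)$ work and $O(s)$ span.
   Context: Computation model: asynchronous dynamic multithreading on a parallel pointer machine with queued read-modify-write (QRMW) contention. Memory consists of nodes each with a fixed number of cells holding an integer or a pointer; pointers can only be stored, followed and tested for equality (no pointer arithmetic). Threads can fork threads, join (wait for termination of) a thread, suspend themselves, resume a suspended thread, terminate, create memory nodes, perform integer arithmetic, and perform read-modify-write operations (read, write, test-and-set, fetch-and-add, compare-and-swap) on memory cells, each in $O(1)$ time, except that RMW operations on the same memory cell are FIFO-queued and serviced one per time step, the issuing thread being blocked until its request is serviced. An execution is described by its execution DAG whose nodes are the executed primitive instructions, weighted by the time taken to execute them, and whose edges are the dependencies (program order within a thread, fork, join, resume). Work is the total weight of the DAG and span is the maximum total weight of a directed path. The bounds are required to hold for every execution schedule, asymptotically as the parameters grow. A batch of items is stored as a BBT: a full binary tree with items only at its leaves (the batch order is the left-to-right leaf order) in which at every internal node the heights of the two subtrees differ by at most $1$; each node stores its children, its subtree height and number of leaves, and the first and last item in its subtree. A complete binary tree is one in which every level is full except possibly the last. *)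

theory Defs
  imports Complex_Main
begin

section \<open>Machine language\<close>

text \<open>
  Code is a finite list of procedures over thread-local registers; every jump stays inside its
  procedure.  A program consists of the procedures of the algorithm and those of the condition,
  which the algorithm can only run by forking \<open>Cond 0\<close>.  Cell indices are constants of the code,
  so there is no pointer arithmetic.
\<close>

type_synonym reg = nat
type_synonym label = nat

datatype val = Null | IntV int | NodeP nat | ThreadP nat

datatype pname = Alg nat | Cond nat

datatype 'a rmw = Read | Write 'a | TestAndSet | FetchAdd 'a | CompareSwap 'a 'a

datatype arith = Plus | Minus | Times | Div | Mod

datatype instr =
    Const reg int
  | SetNull reg
  | Move reg reg
  | Arith arith reg reg reg
  | Jump label
  | BranchLess reg reg label
  | BranchEq reg reg label
  | New reg
  | RMW reg reg nat "reg rmw"           \<comment> \<open>destination, pointer, cell, operation\<close>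
  | Fork reg pname "reg list"           \<comment> \<open>destination of the thread handle, code, arguments\<close>
  | Join reg reg                        \<comment> \<open>destination of the returned value, thread handle\<close>
  | Self reg
  | Suspend
  | Resume reg
  | Return reg                          \<comment> \<open>terminate; the value is handed to joining threads\<close>

type_synonym program = "pname \<Rightarrow> instr list"

definition link :: "instr list list \<Rightarrow> instr list list \<Rightarrow> program" where
  "link A C = (\<lambda>q. case q of
       Alg j \<Rightarrow> if j < length A then A ! j else []
     | Cond j \<Rightarrow> if j < length C then C ! j else [])"

definition cond_code :: "instr list list \<Rightarrow> bool" where
  "cond_code C \<longleftrightarrow>
     (\<forall>is \<in> set C. \<forall>r q args. Fork r q args \<in> set is \<longrightarrow> (\<exists>j. q = Cond j))"

fun arith_op :: "arith \<Rightarrow> int \<Rightarrow> int \<Rightarrow> int" where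
  "arith_op Plus x y = x + y"
| "arith_op Minus x y = x - y"
| "arith_op Times x y = x * y"
| "arith_op Div x y = x div y"
| "arith_op Mod x y = x mod y"

text \<open>The new contents of the cell and the value received by the thread.  A write carries no
  information back, and a fetch-and-add involving a pointer leaves the cell unchanged.\<close>

fun rmw_op :: "val rmw \<Rightarrow> val \<Rightarrow> val \<times> val" where
  "rmw_op Read old = (old, old)"
| "rmw_op (Write v) old = (v, v)"
| "rmw_op TestAndSet old = (IntV 1, old)"
| "rmw_op (FetchAdd v) old =
     (case (old, v) of (IntV x, IntV y) \<Rightarrow> (IntV (x + y), old) | _ \<Rightarrow> (old, old))"
| "rmw_op (CompareSwap u v) old = (if old = u then (v, IntV 1) else (old, IntV 0))"


section \<open>Configurations\<close>

datatype status = Ready | Waiting nat nat "val rmw" reg | Suspended | Done val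

text \<open>
  The fields \<open>deps\<close>, \<open>args\<close> and \<open>eval_of\<close> do not influence the execution.  \<open>deps\<close> holds the DAG
  nodes on which the next instruction of the thread depends (for a waiting or terminated thread:
  its last instruction), \<open>args\<close> the arguments passed when it was forked, and \<open>eval_of\<close> is \<open>Some e\<close>
  iff the thread belongs to the evaluation of the condition whose initial thread is \<open>e\<close>.
\<close>

record thread =
  proc :: pname
  pc :: nat
  regs :: "reg \<Rightarrow> val"
  status :: status
  deps :: "nat set"
  args :: "val list"
  eval_of :: "nat option"

text \<open>
  Nodes, threads and executed instructions are numbered consecutively.  The instructions
  \<open>{..<ninstr}\<close> with \<open>edges\<close> and \<open>weight\<close> form the execution DAG; every edge leads to a later
  instruction.
\<close>

record config =
  mem :: "nat \<Rightarrow> nat \<Rightarrow> val"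
  nnodes :: nat
  queue :: "nat \<Rightarrow> nat \<Rightarrow> nat list"     \<comment> \<open>waiting threads of a cell, first served first\<close>
  thr :: "nat \<Rightarrow> thread"
  nthr :: nat
  ninstr :: nat
  thread_of :: "nat \<Rightarrow> nat"
  edges :: "(nat \<times> nat) set"
  weight :: "nat \<Rightarrow> nat"

definition new_thread ::
  "pname \<Rightarrow> val list \<Rightarrow> nat set \<Rightarrow> nat option \<Rightarrow> thread" where
  "new_thread q vs D e =
     \<lparr> proc = q, pc = 0, regs = (\<lambda>r. if r < length vs then vs ! r else Null),
       status = Ready, deps = D, args = vs, eval_of = e \<rparr>"

definition set_reg :: "reg \<Rightarrow> val \<Rightarrow> thread \<Rightarrow> thread" where
  "set_reg r v th = th\<lparr>regs := (regs th)(r := v)\<rparr>"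

definition set_thr :: "nat \<Rightarrow> thread \<Rightarrow> config \<Rightarrow> config" where
  "set_thr t th \<sigma> = \<sigma>\<lparr>thr := (thr \<sigma>)(t := th)\<rparr>"

definition add_instr :: "nat \<Rightarrow> nat set \<Rightarrow> nat \<Rightarrow> config \<Rightarrow> config" where
  "add_instr t D k \<sigma> = \<sigma>\<lparr>
     ninstr := Suc (ninstr \<sigma>),
     thread_of := (thread_of \<sigma>)(ninstr \<sigma> := t),
     edges := edges \<sigma> \<union> D \<times> {ninstr \<sigma>},
     weight := (weight \<sigma>)(ninstr \<sigma> := k)\<rparr>"

definition init_config :: "(nat \<Rightarrow> nat \<Rightarrow> val) \<Rightarrow> nat \<Rightarrow> val \<Rightarrow> config" where
  "init_config m N v =
     \<lparr> mem = m, nnodes = N, queue = (\<lambda>_ _. []),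
       thr = (\<lambda>_. new_thread (Alg 0) [v] {} None), nthr = 1,
       ninstr = 0, thread_of = (\<lambda>_. 0), edges = {}, weight = (\<lambda>_. 0) \<rparr>"


section \<open>Execution\<close>

text \<open>
  \<open>exec K P t \<sigma>\<close> executes the next instruction of thread \<open>t\<close> on a machine whose nodes have \<open>K\<close>
  cells.  It is \<open>None\<close> if \<open>t\<close> is blocked: terminated, suspended, queued at a cell, joining an
  unfinished thread, or stuck at an ill-typed instruction.  An RMW instruction only enters the
  queue of its cell here; its weight is counted by \<open>service\<close>.  Resuming a thread that is not
  suspended has no effect.
\<close>

definition exec :: "nat \<Rightarrow> program \<Rightarrow> nat \<Rightarrow> config \<Rightarrow> config option" where
  "exec K P t \<sigma> =
    (let th = thr \<sigma> t; R = regs th; i = ninstr \<sigma>;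
         \<sigma>1 = add_instr t (deps th) 1 \<sigma>;
         th1 = th\<lparr>pc := Suc (pc th), deps := {i}\<rparr>
     in
     if \<not> (t < nthr \<sigma> \<and> status th = Ready \<and> pc th < length (P (proc th))) then None
     else case P (proc th) ! pc th of
       Const r k \<Rightarrow> Some (set_thr t (set_reg r (IntV k) th1) \<sigma>1)
     | SetNull r \<Rightarrow> Some (set_thr t (set_reg r Null th1) \<sigma>1)
     | Move r r' \<Rightarrow> Some (set_thr t (set_reg r (R r') th1) \<sigma>1)
     | Arith f r r1 r2 \<Rightarrow>
         (case (R r1, R r2) of
            (IntV x, IntV y) \<Rightarrow> Some (set_thr t (set_reg r (IntV (arith_op f x y)) th1) \<sigma>1)
          | _ \<Rightarrow> None)
     | Jump l \<Rightarrow> Some (set_thr t (th1\<lparr>pc := l\<rparr>) \<sigma>1)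
     | BranchLess r1 r2 l \<Rightarrow>
         (case (R r1, R r2) of
            (IntV x, IntV y) \<Rightarrow> Some (set_thr t (if x < y then th1\<lparr>pc := l\<rparr> else th1) \<sigma>1)
          | _ \<Rightarrow> None)
     | BranchEq r1 r2 l \<Rightarrow>
         Some (set_thr t (if R r1 = R r2 then th1\<lparr>pc := l\<rparr> else th1) \<sigma>1)
     | New r \<Rightarrow>
         Some (set_thr t (set_reg r (NodeP (nnodes \<sigma>)) th1)
           (\<sigma>1\<lparr>nnodes := Suc (nnodes \<sigma>), mem := (mem \<sigma>)(nnodes \<sigma> := (\<lambda>_. Null))\<rparr>))
     | RMW r p c f \<Rightarrow>
         (case R p of
            NodeP a \<Rightarrow>
              if a < nnodes \<sigma> \<and> c < K
              then Some (set_thr t (th1\<lparr>status := Waiting a c (map_rmw R f) r\<rparr>)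
                     ((add_instr t (deps th) 0 \<sigma>)
                        \<lparr>queue := (queue \<sigma>)(a := (queue \<sigma> a)(c := queue \<sigma> a c @ [t]))\<rparr>))
              else None
          | _ \<Rightarrow> None)
     | Fork r q rs \<Rightarrow>
         (let u = nthr \<sigma>;
              e = (case eval_of th of
                     Some e \<Rightarrow> Some e
                   | None \<Rightarrow> (case q of Alg _ \<Rightarrow> None | Cond _ \<Rightarrow> Some u))
          in Some (set_thr u (new_thread q (map R rs) {i} e)
               (set_thr t (set_reg r (ThreadP u) th1) (\<sigma>1\<lparr>nthr := Suc u\<rparr>))))
     | Join r x \<Rightarrow>
         (case R x of
            ThreadP u \<Rightarrow>
              (case status (thr \<sigma> u) of
                 Done v \<Rightarrow>
                   if u < nthr \<sigma>
                   then Some (set_thr t (set_reg r v th1)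
                          (add_instr t (deps th \<union> deps (thr \<sigma> u)) 1 \<sigma>))
                   else None
               | _ \<Rightarrow> None)
          | _ \<Rightarrow> None)
     | Self r \<Rightarrow> Some (set_thr t (set_reg r (ThreadP t) th1) \<sigma>1)
     | Suspend \<Rightarrow> Some (set_thr t (th1\<lparr>status := Suspended\<rparr>) \<sigma>1)
     | Resume x \<Rightarrow>
         (case R x of
            ThreadP u \<Rightarrow>
              if u < nthr \<sigma> then
                (let \<sigma>2 = set_thr t th1 \<sigma>1; tu = thr \<sigma> u
                 in Some (if status tu = Suspended
                          then set_thr u (tu\<lparr>status := Ready, deps := insert i (deps tu)\<rparr>) \<sigma>2
                          else \<sigma>2))
              else None
          | _ \<Rightarrow> None)
     | Return r \<Rightarrow> Some (set_thr t (th1\<lparr>status := Done (R r)\<rparr>) \<sigma>1))"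

fun exec_all :: "nat \<Rightarrow> program \<Rightarrow> nat list \<Rightarrow> config \<Rightarrow> config option" where
  "exec_all K P [] \<sigma> = Some \<sigma>"
| "exec_all K P (t # ts) \<sigma> =
     (case exec K P t \<sigma> of None \<Rightarrow> None | Some \<sigma>' \<Rightarrow> exec_all K P ts \<sigma>')"

text \<open>Every cell serves the first request of its queue.  A request gains one unit of weight in
  every time step it spends in the queue, including the one in which it is served.\<close>

definition service :: "config \<Rightarrow> config" where
  "service \<sigma> = \<sigma>\<lparr>
     mem := (\<lambda>a c. case queue \<sigma> a c of
         [] \<Rightarrow> mem \<sigma> a c
       | t # _ \<Rightarrow> (case status (thr \<sigma> t) of
             Waiting _ _ f _ \<Rightarrow> fst (rmw_op f (mem \<sigma> a c))
           | _ \<Rightarrow> mem \<sigma> a c)),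
     queue := (\<lambda>a c. tl (queue \<sigma> a c)),
     thr := (\<lambda>t. case status (thr \<sigma> t) of
         Waiting a c f r \<Rightarrow>
           if queue \<sigma> a c \<noteq> [] \<and> hd (queue \<sigma> a c) = t
           then set_reg r (snd (rmw_op f (mem \<sigma> a c))) ((thr \<sigma> t)\<lparr>status := Ready\<rparr>)
           else thr \<sigma> t
       | _ \<Rightarrow> thr \<sigma> t),
     weight := (\<lambda>i. weight \<sigma> i +
       (if \<exists>t < nthr \<sigma>. (\<exists>a c f r. status (thr \<sigma> t) = Waiting a c f r) \<and> i \<in> deps (thr \<sigma> t)
        then 1 else 0))\<rparr>"

text \<open>
  One time step: the scheduler picks any threads that are not blocked, in any order (which decides
  the order of requests arriving at a cell in the same step); each executes one instruction, and
  then the queues are served.  Steps in which nothing at all happens are left out.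
\<close>

inductive time_step :: "nat \<Rightarrow> program \<Rightarrow> config \<Rightarrow> config \<Rightarrow> bool" for K P where
  "\<lbrakk> distinct ts; \<forall>t \<in> set ts. exec K P t \<sigma> \<noteq> None;
     ts \<noteq> [] \<or> (\<exists>a c. queue \<sigma> a c \<noteq> []);
     exec_all K P ts \<sigma> = Some \<sigma>' \<rbrakk>
   \<Longrightarrow> time_step K P \<sigma> (service \<sigma>')"

definition finished :: "nat \<Rightarrow> program \<Rightarrow> config \<Rightarrow> bool" where
  "finished K P \<sigma> \<longleftrightarrow>
     (\<forall>t. exec K P t \<sigma> = None) \<and> (\<forall>a c. queue \<sigma> a c = [])"


section \<open>Work and span\<close>

definition work_on :: "config \<Rightarrow> nat set \<Rightarrow> nat" where
  "work_on \<sigma> V = (\<Sum>i\<in>V. weight \<sigma> i)"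

definition path_in :: "config \<Rightarrow> nat set \<Rightarrow> nat list \<Rightarrow> bool" where
  "path_in \<sigma> V p \<longleftrightarrow> p \<noteq> [] \<and> set p \<subseteq> V \<and> successively (\<lambda>i j. (i, j) \<in> edges \<sigma>) p"

definition span_on :: "config \<Rightarrow> nat set \<Rightarrow> nat" where
  "span_on \<sigma> V = Max (insert 0 {sum_list (map (weight \<sigma>) p) | p. path_in \<sigma> V p})"

definition dag_work :: "config \<Rightarrow> nat" where
  "dag_work \<sigma> = work_on \<sigma> {..<ninstr \<sigma>}"

definition dag_span :: "config \<Rightarrow> nat" where
  "dag_span \<sigma> = span_on \<sigma> {..<ninstr \<sigma>}"


section \<open>Batches\<close>

datatype 'a batch_tree = Leaf 'a | Branch "'a batch_tree" "'a batch_tree"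

fun leaves :: "'a batch_tree \<Rightarrow> 'a list" where
  "leaves (Leaf x) = [x]"
| "leaves (Branch l r) = leaves l @ leaves r"

fun height :: "'a batch_tree \<Rightarrow> nat" where
  "height (Leaf x) = 0"
| "height (Branch l r) = Suc (max (height l) (height r))"

fun balanced :: "'a batch_tree \<Rightarrow> bool" where
  "balanced (Leaf x) \<longleftrightarrow> True"
| "balanced (Branch l r) \<longleftrightarrow>
     balanced l \<and> balanced r \<and> height l \<le> height r + 1 \<and> height r \<le> height l + 1"

fun level_size :: "'a batch_tree \<Rightarrow> nat \<Rightarrow> nat" where
  "level_size t 0 = 1"
| "level_size (Leaf x) (Suc d) = 0"
| "level_size (Branch l r) (Suc d) = level_size l d + level_size r d"

definition complete_tree :: "'a batch_tree \<Rightarrow> bool" where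
  "complete_tree t \<longleftrightarrow> (\<forall>d < height t. level_size t d = 2 ^ d)"

text \<open>Cells 0 to 5 of a node hold the left and right child, the height, the number of leaves, and
  the first and last item.  \<open>S\<close> is the set of nodes used; they are not shared between subtrees.\<close>

fun tree_at :: "(nat \<Rightarrow> nat \<Rightarrow> val) \<Rightarrow> nat \<Rightarrow> val batch_tree \<Rightarrow> nat set \<Rightarrow> bool" where
  "tree_at m a (Leaf x) S \<longleftrightarrow>
     S = {a} \<and> m a 0 = Null \<and> m a 1 = Null \<and> m a 2 = IntV 0 \<and> m a 3 = IntV 1 \<and>
     m a 4 = x \<and> m a 5 = x"
| "tree_at m a (Branch l r) S \<longleftrightarrow>
     (\<exists>b c S1 S2. tree_at m b l S1 \<and> tree_at m c r S2 \<and>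
        S = insert a (S1 \<union> S2) \<and> a \<notin> S1 \<union> S2 \<and> S1 \<inter> S2 = {} \<and>
        m a 0 = NodeP b \<and> m a 1 = NodeP c \<and>
        m a 2 = IntV (int (height (Branch l r))) \<and>
        m a 3 = IntV (int (length (leaves (Branch l r)))) \<and>
        m a 4 = hd (leaves (Branch l r)) \<and> m a 5 = last (leaves (Branch l r)))"

text \<open>A batch is \<open>None\<close> when it has no items; it is then represented by the null pointer.\<close>

type_synonym batch = "val batch_tree option"

definition items :: "batch \<Rightarrow> val list" where
  "items T = (case T of None \<Rightarrow> [] | Some t \<Rightarrow> leaves t)"

definition batch_at :: "(nat \<Rightarrow> nat \<Rightarrow> val) \<Rightarrow> nat \<Rightarrow> val \<Rightarrow> batch \<Rightarrow> bool" where
  "batch_at m N v T \<longleftrightarrow> (case T of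
       None \<Rightarrow> v = Null
     | Some t \<Rightarrow> balanced t \<and> (\<exists>a S. v = NodeP a \<and> tree_at m a t S \<and> S \<subseteq> {..<N}))"

definition complete_batch :: "batch \<Rightarrow> bool" where
  "complete_batch T \<longleftrightarrow> (case T of None \<Rightarrow> True | Some t \<Rightarrow> complete_tree t)"

text \<open>Before the execution starts there are no other threads to point to.\<close>

definition wf_memory :: "nat \<Rightarrow> (nat \<Rightarrow> nat \<Rightarrow> val) \<Rightarrow> nat \<Rightarrow> bool" where
  "wf_memory K m N \<longleftrightarrow>
     (\<forall>a < N. \<forall>c < K. case m a c of NodeP b \<Rightarrow> b < N | ThreadP u \<Rightarrow> False | _ \<Rightarrow> True)"


section \<open>Evaluations of the condition\<close>

text \<open>An evaluation is a run of \<open>Cond 0\<close> on the item as sole argument, together with all threads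
  forked, directly or indirectly, in the course of it.\<close>

definition evaluation :: "config \<Rightarrow> nat \<Rightarrow> val \<Rightarrow> bool" where
  "evaluation \<sigma> e x \<longleftrightarrow> e < nthr \<sigma> \<and> eval_of (thr \<sigma> e) = Some e \<and>
     proc (thr \<sigma> e) = Cond 0 \<and> args (thr \<sigma> e) = [x]"

definition eval_nodes :: "config \<Rightarrow> nat \<Rightarrow> nat set" where
  "eval_nodes \<sigma> e = {i. i < ninstr \<sigma> \<and> eval_of (thr \<sigma> (thread_of \<sigma> i)) = Some e}"

text \<open>
  \<open>evaluates K P xs \<phi> \<sigma>\<close>: in the execution leading to \<open>\<sigma>\<close>, the code of the condition computes the
  predicate \<open>\<phi>\<close> on each item of \<open>xs\<close> it is run on, and different evaluations do not synchronise
  with each other: otherwise a path could run through many evaluations, and their individual spans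
  would be meaningless.  They may share memory; the resulting contention enters their weights.
\<close>

definition evaluates ::
  "nat \<Rightarrow> program \<Rightarrow> val list \<Rightarrow> (val \<Rightarrow> bool) \<Rightarrow> config \<Rightarrow> bool" where
  "evaluates K P xs \<phi> \<sigma> \<longleftrightarrow>
     (\<forall>e x. evaluation \<sigma> e x \<and> x \<in> set xs \<longrightarrow>
        (\<forall>v. status (thr \<sigma> e) = Done v \<longrightarrow> v = IntV (if \<phi> x then 1 else 0)) \<and>
        (finished K P \<sigma> \<longrightarrow> (\<exists>v. status (thr \<sigma> e) = Done v))) \<and>
     (\<forall>(i, j) \<in> edges \<sigma>. \<forall>e e'. i \<in> eval_nodes \<sigma> e \<and> j \<in> eval_nodes \<sigma> e' \<longrightarrow> e = e')"

definition evaluation_cost :: "val list \<Rightarrow> real \<Rightarrow> real \<Rightarrow> config \<Rightarrow> bool" where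
  "evaluation_cost xs w s \<sigma> \<longleftrightarrow>
     (\<forall>e x. evaluation \<sigma> e x \<and> x \<in> set xs \<longrightarrow>
        real (work_on \<sigma> (eval_nodes \<sigma> e)) \<le> w \<and> real (span_on \<sigma> (eval_nodes \<sigma> e)) \<le> s)"

end

theory Submission
  imports Defs
begin

text \<open>A condition may overwrite the input tree. Hence the input is read completely, by one thread per node,
  before any evaluation starts: the threads forked by the scan first join a common gate, which ends with
  the scan, and only then evaluate the condition and count the accepted items bottom-up. The ranks of
  the accepted items are passed top-down. With \<open>k = 2 ^ d + r\<close> accepted items, \<open>r < 2 ^ d\<close>, the first
  \<open>2 * r\<close> of them are joined in pairs, which leaves exactly \<open>2 ^ d\<close> subtrees; joining neighbours \<open>d\<close> more
  times gives a complete tree. Every layer is a linked list of threads: an element joins its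
  left child, learns from it the thread of the right child, and never waits for a whole layer, so that
  the span stays logarithmic.

  Every thread and every node of the algorithm has a static name, and the code of every named thread is
  executed symbolically with these names as values. Each cell has one writer and one reader, who knows
  that the writer has ended; thus no request queues behind another. Symbolic execution also
  assigns time stamps that increase along the edges of the execution DAG and are logarithmic in the
  number of items. They bound the span, and they exclude deadlock, since a thread joins
  only threads with smaller final stamps.\<close>

section \<open>Execution steps\<close>

text \<open>The condition is arbitrary code that runs concurrently with the algorithm: it may loop,
  suspend, resume and fork, and only the cost hypothesis limits it. It is contained by what it can
  name: an item and everything derived from it reach neither a node created by the algorithm nor one
  of its threads. The algorithm in turn is checked role by role, once and without a scheduler. This
  is sound because the facts a role relies on (a thread has ended, a cell holds its designated
  value) never become false again. Jumps go forward only, so a role passes each position at most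
  once; this makes static names unambiguous, bounds the work of a role by its code length, and
  forces loops to be chains of forked threads. Allowing one reader per cell explains why the same
  number or pointer is sometimes stored twice. The hypotheses on the condition concern the
  configuration under consideration, whereas the invariant needs the results of evaluations at all
  earlier times; finished evaluations keep their result, so that part carries over to the
  past.\<close>

definition same_frame :: "thread \<Rightarrow> thread \<Rightarrow> bool" where
  "same_frame th th' \<longleftrightarrow> proc th' = proc th \<and> args th' = args th \<and> eval_of th' = eval_of th"

definition waiting :: "thread \<Rightarrow> bool" where
  "waiting th \<longleftrightarrow> (\<exists>a c f r. status th = Waiting a c f r)"

lemma set_reg_simps [simp]:
  "proc (set_reg r v th) = proc th" "pc (set_reg r v th) = pc th"
  "status (set_reg r v th) = status th" "deps (set_reg r v th) = deps th"
  "args (set_reg r v th) = args th" "eval_of (set_reg r v th) = eval_of th"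
  "regs (set_reg r v th) = (regs th)(r := v)"
  by (simp_all add: set_reg_def)

lemma set_thr_simps [simp]:
  "mem (set_thr t th \<sigma>) = mem \<sigma>" "nnodes (set_thr t th \<sigma>) = nnodes \<sigma>"
  "queue (set_thr t th \<sigma>) = queue \<sigma>" "thr (set_thr t th \<sigma>) = (thr \<sigma>)(t := th)"
  "nthr (set_thr t th \<sigma>) = nthr \<sigma>" "ninstr (set_thr t th \<sigma>) = ninstr \<sigma>"
  "thread_of (set_thr t th \<sigma>) = thread_of \<sigma>" "edges (set_thr t th \<sigma>) = edges \<sigma>"
  "weight (set_thr t th \<sigma>) = weight \<sigma>"
  by (simp_all add: set_thr_def)

lemma add_instr_simps [simp]:
  "mem (add_instr t D k \<sigma>) = mem \<sigma>" "nnodes (add_instr t D k \<sigma>) = nnodes \<sigma>"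
  "queue (add_instr t D k \<sigma>) = queue \<sigma>" "thr (add_instr t D k \<sigma>) = thr \<sigma>"
  "nthr (add_instr t D k \<sigma>) = nthr \<sigma>" "ninstr (add_instr t D k \<sigma>) = Suc (ninstr \<sigma>)"
  "thread_of (add_instr t D k \<sigma>) = (thread_of \<sigma>)(ninstr \<sigma> := t)"
  "edges (add_instr t D k \<sigma>) = edges \<sigma> \<union> D \<times> {ninstr \<sigma>}"
  "weight (add_instr t D k \<sigma>) = (weight \<sigma>)(ninstr \<sigma> := k)"
  by (simp_all add: add_instr_def)

lemma new_thread_simps [simp]:
  "proc (new_thread q vs D e) = q" "pc (new_thread q vs D e) = 0"
  "status (new_thread q vs D e) = Ready" "deps (new_thread q vs D e) = D"
  "args (new_thread q vs D e) = vs" "eval_of (new_thread q vs D e) = e"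
  "regs (new_thread q vs D e) r = (if r < length vs then vs ! r else Null)"
  by (simp_all add: new_thread_def)

definition enabled :: "program \<Rightarrow> nat \<Rightarrow> config \<Rightarrow> bool" where
  "enabled P t \<sigma> \<longleftrightarrow> t < nthr \<sigma> \<and> status (thr \<sigma> t) = Ready \<and> pc (thr \<sigma> t) < length (P (proc (thr \<sigma> t)))"

lemma exec_enabled: "exec K P t \<sigma> = Some \<sigma>' \<Longrightarrow> enabled P t \<sigma>"
  by (auto simp: exec_def enabled_def Let_def split: if_splits)

text \<open>Forgets registers, program counters and the program: the fifteen instructions leave only
  five kinds of change to threads, memory and DAG, and well-formedness, persistence and growth of
  the work depend on nothing else. A \<open>Join\<close>, and a \<open>Resume\<close> without
  effect, fall under \<open>local\<close>, whose \<open>D\<close> is the set of incoming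
  dependencies.\<close>

inductive effect :: "nat \<Rightarrow> config \<Rightarrow> config \<Rightarrow> bool" for t \<sigma> where
  local: "\<lbrakk> same_frame (thr \<sigma> t) th'; deps th' = {ninstr \<sigma>}; \<not> waiting th';
      D = deps (thr \<sigma> t) \<or>
        (\<exists>u v. u < nthr \<sigma> \<and> status (thr \<sigma> u) = Done v \<and> D = deps (thr \<sigma> t) \<union> deps (thr \<sigma> u)) \<rbrakk>
    \<Longrightarrow> effect t \<sigma> (set_thr t th' (add_instr t D (Suc 0) \<sigma>))"
| new: "\<lbrakk> same_frame (thr \<sigma> t) th'; deps th' = {ninstr \<sigma>}; \<not> waiting th' \<rbrakk>
    \<Longrightarrow> effect t \<sigma> (set_thr t th' ((add_instr t (deps (thr \<sigma> t)) (Suc 0) \<sigma>)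
          \<lparr>nnodes := Suc (nnodes \<sigma>), mem := (mem \<sigma>)(nnodes \<sigma> := (\<lambda>_. Null))\<rparr>))"
| rmw: "\<lbrakk> same_frame (thr \<sigma> t) th'; deps th' = {ninstr \<sigma>}; status th' = Waiting a c f r \<rbrakk>
    \<Longrightarrow> effect t \<sigma> (set_thr t th' ((add_instr t (deps (thr \<sigma> t)) 0 \<sigma>)
          \<lparr>queue := (queue \<sigma>)(a := (queue \<sigma> a)(c := queue \<sigma> a c @ [t]))\<rparr>))"
| fork: "\<lbrakk> same_frame (thr \<sigma> t) th'; deps th' = {ninstr \<sigma>}; \<not> waiting th';
      e = (case eval_of (thr \<sigma> t) of Some e \<Rightarrow> Some e
             | None \<Rightarrow> (case q of Alg _ \<Rightarrow> None | Cond _ \<Rightarrow> Some (nthr \<sigma>))) \<rbrakk>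
    \<Longrightarrow> effect t \<sigma> (set_thr (nthr \<sigma>) (new_thread q vs {ninstr \<sigma>} e)
          (set_thr t th' ((add_instr t (deps (thr \<sigma> t)) (Suc 0) \<sigma>)\<lparr>nthr := Suc (nthr \<sigma>)\<rparr>)))"
| resume: "\<lbrakk> same_frame (thr \<sigma> t) th'; deps th' = {ninstr \<sigma>}; \<not> waiting th';
      u < nthr \<sigma>; status (thr \<sigma> u) = Suspended \<rbrakk>
    \<Longrightarrow> effect t \<sigma> (set_thr u ((thr \<sigma> u)\<lparr>status := Ready, deps := insert (ninstr \<sigma>) (deps (thr \<sigma> u))\<rparr>)
          (set_thr t th' (add_instr t (deps (thr \<sigma> t)) (Suc 0) \<sigma>)))"

lemma exec_effect:
  assumes "exec K P t \<sigma> = Some \<sigma>'"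
  shows "effect t \<sigma> \<sigma>'"
proof -
  have en: "enabled P t \<sigma>"
    using assms by (rule exec_enabled)
  define I where "I = P (proc (thr \<sigma> t)) ! pc (thr \<sigma> t)"
  note ex = assms [unfolded exec_def Let_def, folded I_def]
  note fr = same_frame_def waiting_def
  show ?thesis
  proof (cases I)
    case (Fork r q rs)
    show ?thesis
      using ex en unfolding Fork
      by (auto simp: enabled_def fr intro!: effect.fork)
  next
    case (Resume x)
    show ?thesis
      using ex en unfolding Resume
      by (auto simp: enabled_def fr split: val.splits if_splits
          intro!: effect.resume effect.local)
  qed (use ex en in \<open>auto simp: enabled_def fr split: val.splits if_splits status.splits
          intro!: effect.local effect.new effect.rmw\<close>)
qed

text \<open>Two clauses matter most later. A waiting thread depends on exactly its own pending
  request, so the weight that \<open>service\<close> adds can be attributed to one thread; and an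
  evaluation identifier always names a thread of that same evaluation, so every evaluation thread
  leads back to an initial one.\<close>

definition wf_config :: "config \<Rightarrow> bool" where
  "wf_config \<sigma> \<longleftrightarrow>
    (\<forall>t < nthr \<sigma>. deps (thr \<sigma> t) \<subseteq> {..<ninstr \<sigma>}) \<and>
    (\<forall>i < ninstr \<sigma>. thread_of \<sigma> i < nthr \<sigma>) \<and>
    (\<forall>i j. (i, j) \<in> edges \<sigma> \<longrightarrow> i < j \<and> j < ninstr \<sigma>) \<and>
    (\<forall>a c. distinct (queue \<sigma> a c)) \<and>
    (\<forall>a c t. t \<in> set (queue \<sigma> a c) \<longleftrightarrow> t < nthr \<sigma> \<and> (\<exists>f r. status (thr \<sigma> t) = Waiting a c f r)) \<and>
    (\<forall>t < nthr \<sigma>. waiting (thr \<sigma> t) \<longrightarrow> (\<exists>i < ninstr \<sigma>. deps (thr \<sigma> t) = {i} \<and> thread_of \<sigma> i = t)) \<and>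
    (\<forall>t < nthr \<sigma>. \<forall>e. eval_of (thr \<sigma> t) = Some e \<longrightarrow> e < nthr \<sigma> \<and> eval_of (thr \<sigma> e) = Some e)"

lemma wf_configD:
  assumes "wf_config \<sigma>"
  shows "t < nthr \<sigma> \<Longrightarrow> deps (thr \<sigma> t) \<subseteq> {..<ninstr \<sigma>}"
    and "i < ninstr \<sigma> \<Longrightarrow> thread_of \<sigma> i < nthr \<sigma>"
    and "(i, j) \<in> edges \<sigma> \<Longrightarrow> i < j \<and> j < ninstr \<sigma>"
    and "distinct (queue \<sigma> a c)"
    and "t \<in> set (queue \<sigma> a c) \<longleftrightarrow> t < nthr \<sigma> \<and> (\<exists>f r. status (thr \<sigma> t) = Waiting a c f r)"
    and "t < nthr \<sigma> \<Longrightarrow> waiting (thr \<sigma> t) \<Longrightarrow> \<exists>i < ninstr \<sigma>. deps (thr \<sigma> t) = {i} \<and> thread_of \<sigma> i = t"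
    and "t < nthr \<sigma> \<Longrightarrow> eval_of (thr \<sigma> t) = Some e \<Longrightarrow> e < nthr \<sigma> \<and> eval_of (thr \<sigma> e) = Some e"
  using assms unfolding wf_config_def by blast+

lemma wf_config_init: "wf_config (init_config m N v)"
  by (auto simp: wf_config_def init_config_def waiting_def)

lemma effect_wf:
  assumes wf: "wf_config \<sigma>" and t: "t < nthr \<sigma>" and st: "status (thr \<sigma> t) = Ready"
    and eff: "effect t \<sigma> \<sigma>'"
  shows "wf_config \<sigma>'"
proof -
  note w = wf_configD [OF wf]
  have dt: "deps (thr \<sigma> t) \<subseteq> {..<ninstr \<sigma>}"
    using w(1) t by blast
  have less: "\<And>u i. u < nthr \<sigma> \<Longrightarrow> i \<in> deps (thr \<sigma> u) \<Longrightarrow> i < ninstr \<sigma>"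
    using w(1) by blast
  have ed: "\<And>i j. (i, j) \<in> edges \<sigma> \<Longrightarrow> i < j" "\<And>i j. (i, j) \<in> edges \<sigma> \<Longrightarrow> j < ninstr \<sigma>"
      "\<And>i j. (i, j) \<in> edges \<sigma> \<Longrightarrow> j < Suc (ninstr \<sigma>)"
    using w(3) by (auto intro: less_SucI)
  have qt: "t \<notin> set (queue \<sigma> a c)" for a c
    using w(5) st by simp
  have e1: "\<And>u e. u < nthr \<sigma> \<Longrightarrow> eval_of (thr \<sigma> u) = Some e \<Longrightarrow> e < nthr \<sigma>"
    and e2: "\<And>u e. u < nthr \<sigma> \<Longrightarrow> eval_of (thr \<sigma> u) = Some e \<Longrightarrow> eval_of (thr \<sigma> e) = Some e"
    using w(7) by blast+
  have wt: "\<exists>i. i \<noteq> ninstr \<sigma> \<and> i < Suc (ninstr \<sigma>) \<and> deps (thr \<sigma> u) = {i} \<and> thread_of \<sigma> i = u"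
    if "u < nthr \<sigma>" "waiting (thr \<sigma> u)" for u
    using w(6) [OF that] by (metis less_SucI nat_neq_iff)
  have tmem: "\<And>i. i < ninstr \<sigma> \<Longrightarrow> thread_of \<sigma> i < nthr \<sigma>"
    using w(2) .
  show ?thesis
    using eff
  proof cases
    case (local th' D)
    have D: "\<And>i. i \<in> D \<Longrightarrow> i < ninstr \<sigma>"
      using local less t by auto
    show ?thesis
      unfolding wf_config_def local(1)
      apply (intro conjI allI impI)
      subgoal using local less by (auto intro: less_SucI)
      subgoal using tmem t by (auto simp: less_Suc_eq)
      subgoal using ed D by auto
      subgoal using ed D by auto
      subgoal using w(4) by simp
      subgoal using w(5) local t st by (auto simp: waiting_def)
      subgoal for u using wt [of u] local by (auto simp: waiting_def less_Suc_eq split: if_splits)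
      subgoal for u e' using e1 [of u e'] local by (auto simp: same_frame_def split: if_splits)
      subgoal for u e' using e2 [of u e'] local by (auto simp: same_frame_def split: if_splits)
      done
  next
    case (new th')
    show ?thesis
      unfolding wf_config_def new(1)
      apply (intro conjI allI impI)
      subgoal using new less by (auto intro: less_SucI)
      subgoal using tmem t by (auto simp: less_Suc_eq)
      subgoal using ed dt by auto
      subgoal using ed dt by auto
      subgoal using w(4) by simp
      subgoal using w(5) new t st by (auto simp: waiting_def)
      subgoal for u using wt [of u] new by (auto simp: waiting_def less_Suc_eq split: if_splits)
      subgoal for u e' using e1 [of u e'] new by (auto simp: same_frame_def split: if_splits)
      subgoal for u e' using e2 [of u e'] new by (auto simp: same_frame_def split: if_splits)
      done
  next
    case (rmw th' a c f r)
    show ?thesis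
      unfolding wf_config_def rmw(1)
      apply (intro conjI allI impI)
      subgoal using rmw less by (auto intro: less_SucI)
      subgoal using tmem t by (auto simp: less_Suc_eq)
      subgoal using ed dt by auto
      subgoal using ed dt by auto
      subgoal using w(4) qt by simp
      subgoal using w(5) rmw t st by auto
      subgoal for u using wt [of u] rmw by (auto simp: waiting_def less_Suc_eq split: if_splits)
      subgoal for u e' using e1 [of u e'] rmw by (auto simp: same_frame_def split: if_splits)
      subgoal for u e' using e2 [of u e'] rmw by (auto simp: same_frame_def split: if_splits)
      done
  next
    case (fork th' e q vs)
    show ?thesis
      unfolding wf_config_def fork(1)
      apply (intro conjI allI impI)
      subgoal using fork less by (auto intro: less_SucI simp: less_Suc_eq)
      subgoal using tmem t by (auto simp: less_Suc_eq)
      subgoal using ed dt by auto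
      subgoal using ed dt by auto
      subgoal using w(4) by simp
      subgoal using w(5) fork t st by (auto simp: less_Suc_eq waiting_def)
      subgoal for u using wt [of u] fork by (auto simp: waiting_def less_Suc_eq split: if_splits)
      subgoal for u e' using e1 [of u e'] e1 [OF t, of e'] fork by (auto simp: same_frame_def less_Suc_eq split: if_splits option.splits pname.splits)
      subgoal for u e' using e1 e1 [of u e'] e2 [of u e'] e1 [of t e'] e2 [of t e'] t fork
        by (auto simp: same_frame_def less_Suc_eq split: if_splits option.splits pname.splits)
      done
  next
    case (resume th' u)
    show ?thesis
      unfolding wf_config_def resume(1)
      apply (intro conjI allI impI)
      subgoal using resume less by (auto intro: less_SucI split: if_splits)
      subgoal using tmem t by (auto simp: less_Suc_eq)
      subgoal using ed dt by auto
      subgoal using ed dt by auto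
      subgoal using w(4) by simp
      subgoal using w(5) resume t st by (auto simp: waiting_def)
      subgoal for u using wt [of u] resume by (auto simp: waiting_def less_Suc_eq split: if_splits)
      subgoal for u e' using e1 [of u e'] resume by (auto simp: same_frame_def split: if_splits)
      subgoal for u e' using e2 [of u e'] resume by (auto simp: same_frame_def split: if_splits)
      done
  qed
qed

lemma service_simps [simp]:
  "nnodes (service \<sigma>) = nnodes \<sigma>" "nthr (service \<sigma>) = nthr \<sigma>" "ninstr (service \<sigma>) = ninstr \<sigma>"
  "thread_of (service \<sigma>) = thread_of \<sigma>" "edges (service \<sigma>) = edges \<sigma>"
  "queue (service \<sigma>) a c = tl (queue \<sigma> a c)"
  "weight (service \<sigma>) i = weight \<sigma> i + (if \<exists>t < nthr \<sigma>. waiting (thr \<sigma> t) \<and> i \<in> deps (thr \<sigma> t) then 1 else 0)"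
  by (auto simp: service_def waiting_def)

lemma service_thr:
  "thr (service \<sigma>) t = (case status (thr \<sigma> t) of
     Waiting a c f r \<Rightarrow>
       if queue \<sigma> a c \<noteq> [] \<and> hd (queue \<sigma> a c) = t
       then set_reg r (snd (rmw_op f (mem \<sigma> a c))) ((thr \<sigma> t)\<lparr>status := Ready\<rparr>) else thr \<sigma> t
   | _ \<Rightarrow> thr \<sigma> t)"
  by (simp add: service_def)

lemma service_mem:
  "mem (service \<sigma>) a c = (case queue \<sigma> a c of [] \<Rightarrow> mem \<sigma> a c
    | t # _ \<Rightarrow> (case status (thr \<sigma> t) of
         Waiting _ _ f _ \<Rightarrow> fst (rmw_op f (mem \<sigma> a c)) | _ \<Rightarrow> mem \<sigma> a c))"
  by (simp add: service_def)

lemma service_thr_frame: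
  "same_frame (thr \<sigma> t) (thr (service \<sigma>) t)" "deps (thr (service \<sigma>) t) = deps (thr \<sigma> t)"
  "pc (thr (service \<sigma>) t) = pc (thr \<sigma> t)"
  by (simp_all add: service_thr same_frame_def split: status.splits)

lemma service_thr_idle: "\<not> waiting (thr \<sigma> t) \<Longrightarrow> thr (service \<sigma>) t = thr \<sigma> t"
  by (auto simp: service_thr waiting_def split: status.splits)

lemma service_status:
  "status (thr (service \<sigma>) t) = status (thr \<sigma> t) \<or>
    status (thr (service \<sigma>) t) = Ready \<and> waiting (thr \<sigma> t)"
  by (auto simp: service_thr waiting_def split: status.splits)

lemma service_wf:
  assumes wf: "wf_config \<sigma>"
  shows "wf_config (service \<sigma>)"
proof -
  note w = wf_configD [OF wf]
  \<comment> \<open>Queues hold no duplicates, so dropping the head removes exactly the served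
    thread.\<close>
  have q: "t \<in> set (tl (queue \<sigma> a c)) \<longleftrightarrow> t \<in> set (queue \<sigma> a c) \<and> t \<noteq> hd (queue \<sigma> a c)" for a c t
    using w(4) [of a c] by (cases "queue \<sigma> a c") auto
  have wa: "waiting (thr (service \<sigma>) t) \<Longrightarrow> waiting (thr \<sigma> t)" for t
    using service_status [of \<sigma> t] by (auto simp: waiting_def)
  have 1: "t \<in> set (queue (service \<sigma>) a c) \<longleftrightarrow>
      t < nthr \<sigma> \<and> (\<exists>f r. status (thr (service \<sigma>) t) = Waiting a c f r)" for a c t
  proof (cases "status (thr \<sigma> t)")
    case (Waiting a' c' f r)
    then show ?thesis
      using w(5) [of t a c] q [of t a c] by (cases "queue \<sigma> a c") (auto simp: service_thr)
  qed (use w(5) [of t] q [of t a c] in \<open>auto simp: service_thr\<close>)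
  have 2: "distinct (queue (service \<sigma>) a c)" for a c
    using w(4) by (simp add: distinct_tl)
  have 3: "eval_of (thr (service \<sigma>) t) = eval_of (thr \<sigma> t)" for t
    using service_thr_frame(1) [of \<sigma> t] by (simp add: same_frame_def)
  show ?thesis
    unfolding wf_config_def service_simps(1-5) service_thr_frame(2)
    apply (intro conjI allI impI)
    subgoal using w(1) by simp
    subgoal using w(2) by simp
    subgoal using w(3) by blast
    subgoal using w(3) by blast
    subgoal by (rule 2)
    subgoal by (rule 1)
    subgoal using w(6) wa by simp
    subgoal for t e using w(7) [of t e] unfolding 3 by simp
    subgoal for t e using w(7) [of t e] unfolding 3 by simp
    done
qed

text \<open>Nothing recorded here is ever taken back: threads keep code, arguments and evaluation,
  and results stay. For this reason knowledge about ended threads survives arbitrary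
  interleavings.\<close>

definition persists :: "config \<Rightarrow> config \<Rightarrow> bool" where
  "persists \<sigma> \<sigma>' \<longleftrightarrow> nthr \<sigma> \<le> nthr \<sigma>' \<and>
    (\<forall>t < nthr \<sigma>. same_frame (thr \<sigma> t) (thr \<sigma>' t) \<and>
      (\<forall>v. status (thr \<sigma> t) = Done v \<longrightarrow> status (thr \<sigma>' t) = Done v))"

lemma effect_persists:
  assumes "t < nthr \<sigma>" "status (thr \<sigma> t) = Ready" "effect t \<sigma> \<sigma>'"
  shows "persists \<sigma> \<sigma>'"
  using assms(3)
  by cases (use assms(1,2) in \<open>auto simp: persists_def same_frame_def\<close>)

lemma service_persists: "persists \<sigma> (service \<sigma>)"
  using service_thr_frame(1) by (auto simp: persists_def service_thr)

text \<open>The choice of the scheduler disappears here: \<open>exec_all\<close> runs the chosen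
  threads one after the other, so preservation by a single instruction and by \<open>service\<close>
  covers every time step.\<close>

lemma run_invariant:
  assumes init: "I \<sigma>0"
    and exec: "\<And>t \<sigma> \<sigma>'. I \<sigma> \<Longrightarrow> exec K P t \<sigma> = Some \<sigma>' \<Longrightarrow> I \<sigma>'"
    and serv: "\<And>\<sigma>. I \<sigma> \<Longrightarrow> I (service \<sigma>)"
    and run: "(time_step K P)\<^sup>*\<^sup>* \<sigma>0 \<sigma>"
  shows "I \<sigma>"
proof -
  have all: "exec_all K P ts \<tau> = Some \<tau>' \<Longrightarrow> I \<tau> \<Longrightarrow> I \<tau>'" for ts \<tau> \<tau>'
    by (induction ts arbitrary: \<tau>) (auto split: option.splits intro: exec)
  show ?thesis
    using run
  proof induction
    case (step y z)
    from step(2) show ?case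
      by cases (use step(3) all serv in blast)
  qed (rule init)
qed

lemma exec_wf:
  assumes "wf_config \<sigma>" "exec K P t \<sigma> = Some \<sigma>'"
  shows "wf_config \<sigma>'"
  using assms exec_enabled [OF assms(2)] exec_effect [OF assms(2)] effect_wf
  by (auto simp: enabled_def)

lemma run_wf:
  assumes "(time_step K P)\<^sup>*\<^sup>* (init_config m N v) \<sigma>"
  shows "wf_config \<sigma>"
proof (rule run_invariant [OF _ _ _ assms])
  show "wf_config (init_config m N v)"
    by (rule wf_config_init)
  show "wf_config \<tau>'" if "wf_config \<tau>" "exec K P t \<tau> = Some \<tau>'" for t \<tau> \<tau>'
    using that by (rule exec_wf)
  show "wf_config (service \<tau>)" if "wf_config \<tau>" for \<tau>
    using that by (rule service_wf)
qed

section \<open>Growth of the work\<close>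

lemma dag_work_effect:
  assumes "t < nthr \<sigma>" "status (thr \<sigma> t) = Ready" "effect t \<sigma> \<sigma>'"
  shows "dag_work \<sigma> \<le> dag_work \<sigma>'" "dag_work \<sigma> < dag_work \<sigma>' \<or> waiting (thr \<sigma>' t)"
    "\<And>u. u < nthr \<sigma> \<Longrightarrow> waiting (thr \<sigma> u) \<Longrightarrow> waiting (thr \<sigma>' u)"
proof -
  have *: "(\<Sum>i<ninstr \<sigma>. if i = ninstr \<sigma> then k else weight \<sigma> i) = (\<Sum>i<ninstr \<sigma>. weight \<sigma> i)" for k
    by (intro sum.cong) auto
  show "dag_work \<sigma> \<le> dag_work \<sigma>'" "dag_work \<sigma> < dag_work \<sigma>' \<or> waiting (thr \<sigma>' t)"
    using assms(3)
    by (cases; use assms(1,2) in \<open>auto simp: dag_work_def work_on_def * lessThan_Suc waiting_def\<close>)+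
  show "waiting (thr \<sigma>' u)" if "u < nthr \<sigma>" "waiting (thr \<sigma> u)" for u
    using assms(3) by cases (use assms(1,2) that in \<open>auto simp: waiting_def\<close>)
qed

lemma dag_work_service:
  assumes "wf_config \<sigma>"
  shows "dag_work \<sigma> \<le> dag_work (service \<sigma>)"
    "t < nthr \<sigma> \<Longrightarrow> waiting (thr \<sigma> t) \<Longrightarrow> dag_work \<sigma> < dag_work (service \<sigma>)"
proof -
  show "dag_work \<sigma> \<le> dag_work (service \<sigma>)"
    by (auto simp: dag_work_def work_on_def intro!: sum_mono)
  assume t: "t < nthr \<sigma>" "waiting (thr \<sigma> t)"
  then obtain i where i: "i < ninstr \<sigma>" "i \<in> deps (thr \<sigma> t)"
    using wf_configD(6) [OF assms t] by auto
  show "dag_work \<sigma> < dag_work (service \<sigma>)"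
    unfolding dag_work_def work_on_def service_simps
    by (rule sum_strict_mono_ex1) (use i t in auto)
qed

text \<open>An instruction other than an RMW adds weight one at once; an RMW adds none but leaves a
  waiting thread, which the closing \<open>service\<close> charges. A bound on the work therefore
  bounds the number of time steps.\<close>

lemma dag_work_time_step:
  assumes wf: "wf_config \<sigma>" and step: "time_step K P \<sigma> \<sigma>'"
  shows "dag_work \<sigma> < dag_work \<sigma>'"
proof -
  have all: "exec_all K P ts \<tau> = Some \<tau>' \<Longrightarrow> wf_config \<tau> \<Longrightarrow>
      wf_config \<tau>' \<and> dag_work \<tau> \<le> dag_work \<tau>' \<and> nthr \<tau> \<le> nthr \<tau>' \<and>
      (\<forall>u < nthr \<tau>. waiting (thr \<tau> u) \<longrightarrow> waiting (thr \<tau>' u)) \<and>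
      (ts \<noteq> [] \<longrightarrow> dag_work \<tau> < dag_work \<tau>' \<or> (\<exists>u < nthr \<tau>'. waiting (thr \<tau>' u)))" for ts \<tau> \<tau>'
  proof (induction ts arbitrary: \<tau>)
    case (Cons t ts)
    then obtain \<tau>1 where \<tau>1: "exec K P t \<tau> = Some \<tau>1" "exec_all K P ts \<tau>1 = Some \<tau>'"
      by (auto split: option.splits)
    have t: "t < nthr \<tau>" "status (thr \<tau> t) = Ready" and eff: "effect t \<tau> \<tau>1"
      using exec_enabled [OF \<tau>1(1)] exec_effect [OF \<tau>1(1)] by (auto simp: enabled_def)
    note d = dag_work_effect [OF t eff]
    have n: "nthr \<tau> \<le> nthr \<tau>1"
      using effect_persists [OF t eff] by (simp add: persists_def)
    note IH = Cons.IH [OF \<tau>1(2) exec_wf [OF Cons.prems(2) \<tau>1(1)]]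
    have w: "u < nthr \<tau>' \<and> waiting (thr \<tau>' u)" if "u < nthr \<tau>" "waiting (thr \<tau>1 u)" for u
      using IH n that by (meson less_le_trans)
    have "dag_work \<tau> < dag_work \<tau>' \<or> (\<exists>u < nthr \<tau>'. waiting (thr \<tau>' u))"
      using d(2)
    proof
      assume "dag_work \<tau> < dag_work \<tau>1"
      with IH show ?thesis by linarith
    next
      assume "waiting (thr \<tau>1 t)"
      with w t(1) show ?thesis by blast
    qed
    moreover have "dag_work \<tau> \<le> dag_work \<tau>'" "nthr \<tau> \<le> nthr \<tau>'" "wf_config \<tau>'"
      using IH d(1) n by linarith+
    moreover have "\<forall>u < nthr \<tau>. waiting (thr \<tau> u) \<longrightarrow> waiting (thr \<tau>' u)"
      using d(3) w by blast
    ultimately show ?case by blast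
  qed simp
  from step show ?thesis
  proof cases
    case (1 ts \<sigma>1)
    note a = all [OF 1(5) wf]
    show ?thesis
    proof (cases "\<exists>u < nthr \<sigma>1. waiting (thr \<sigma>1 u)")
      case True
      then show ?thesis
        using conjunct1 [OF a] conjunct1 [OF conjunct2 [OF a]] dag_work_service(2) 1(1) le_less_trans
        by blast
    next
      case False
      \<comment> \<open>A step that schedules nobody needs a nonempty queue, whose members are
        waiting threads.\<close>
      have "ts \<noteq> []"
      proof
        assume "ts = []"
        then obtain a' c u where "u \<in> set (queue \<sigma> a' c)"
          using 1(4) by (metis last_in_set)
        then have "u < nthr \<sigma>" "waiting (thr \<sigma> u)"
          using wf_configD(5) [OF wf] by (auto simp: waiting_def)
        then show False
          using False a less_le_trans by blast
      qed
      then show ?thesis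
        using conjunct1 [OF a] a False dag_work_service(1) [of \<sigma>1] less_le_trans
        unfolding 1(1) by blast
    qed
  qed
qed

text \<open>Edges lead to later instructions, so a path is strictly increasing and visits each
  instruction at most once. Without finiteness the \<open>Max\<close> in \<open>span_on\<close>
  would carry no information.\<close>

lemma finite_paths:
  assumes "wf_config \<sigma>" "V \<subseteq> {..<ninstr \<sigma>}"
  shows "finite {p. path_in \<sigma> V p}"
proof (rule finite_subset)
  show "finite {p. set p \<subseteq> {..<ninstr \<sigma>} \<and> length p \<le> ninstr \<sigma>}"
    by (rule finite_lists_length_le) simp
  show "{p. path_in \<sigma> V p} \<subseteq> {p. set p \<subseteq> {..<ninstr \<sigma>} \<and> length p \<le> ninstr \<sigma>}"
  proof safe
    fix p
    assume p: "path_in \<sigma> V p"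
    show "length p \<le> ninstr \<sigma>"
    proof -
      have "successively (<) p"
        using p wf_configD(3) [OF assms(1)] by (auto simp: path_in_def intro: successively_mono)
      then have "distinct p"
        by (simp add: successively_conv_sorted_wrt strict_sorted_iff)
      then have "length p = card (set p)"
        by (simp add: distinct_card)
      also have "\<dots> \<le> card {..<ninstr \<sigma>}"
        using p assms(2) by (intro card_mono) (auto simp: path_in_def)
      finally show ?thesis by simp
    qed
    show "x < ninstr \<sigma>" if "x \<in> set p" for x
      using p assms(2) that by (auto simp: path_in_def)
  qed
qed

lemma path_le_span:
  assumes "wf_config \<sigma>" "V \<subseteq> {..<ninstr \<sigma>}" "path_in \<sigma> V p"
  shows "sum_list (map (weight \<sigma>) p) \<le> span_on \<sigma> V"
proof -
  have "finite {sum_list (map (weight \<sigma>) p) | p. path_in \<sigma> V p}"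
    using finite_paths [OF assms(1,2)] by simp
  then show ?thesis
    unfolding span_on_def using assms(3) by (intro Max_ge) auto
qed

lemma span_le:
  assumes "wf_config \<sigma>" "V \<subseteq> {..<ninstr \<sigma>}"
    and "\<And>p. path_in \<sigma> V p \<Longrightarrow> real (sum_list (map (weight \<sigma>) p)) \<le> B" "0 \<le> B"
  shows "real (span_on \<sigma> V) \<le> B"
proof -
  have fin: "finite (insert 0 {sum_list (map (weight \<sigma>) p) | p. path_in \<sigma> V p})"
    using finite_paths [OF assms(1,2)] by simp
  have "span_on \<sigma> V \<in> insert 0 {sum_list (map (weight \<sigma>) p) | p. path_in \<sigma> V p}"
    unfolding span_on_def by (rule Max_in [OF fin]) simp
  then show ?thesis
    using assms(3,4) by auto
qed

section \<open>Paths\<close>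

text \<open>Instructions outside \<open>U\<close> carry increasing time stamps; those inside fall into classes
  without edges between them, entered before time \<open>X\<close> and left after it, so that a path visits
  at most one class.\<close>

lemma path_weight_bound:
  fixes tau :: "nat \<Rightarrow> nat" and S :: real
  assumes W: "\<And>i. i < ninstr \<sigma> \<Longrightarrow> i \<notin> U \<Longrightarrow> weight \<sigma> i \<le> 1"
    and TM: "\<And>i. i < ninstr \<sigma> \<Longrightarrow> i \<notin> U \<Longrightarrow> tau i \<le> TM" "X \<le> TM"
    and E: "\<And>i j. (i, j) \<in> edges \<sigma> \<Longrightarrow> i < ninstr \<sigma> \<Longrightarrow> j < ninstr \<sigma> \<Longrightarrow>
       (i \<notin> U \<and> j \<notin> U \<longrightarrow> tau i < tau j) \<and> (i \<notin> U \<and> j \<in> U \<longrightarrow> tau i \<le> X) \<and>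
       (i \<in> U \<and> j \<notin> U \<longrightarrow> X < tau j) \<and> (i \<in> U \<and> j \<in> U \<longrightarrow> ev i = ev j)"
    and S: "\<And>p e. path_in \<sigma> {i \<in> U. i < ninstr \<sigma> \<and> ev i = e} p \<Longrightarrow>
       real (sum_list (map (weight \<sigma>) p)) \<le> S" "0 \<le> S"
    and p: "path_in \<sigma> {..<ninstr \<sigma>} p"
  shows "real (sum_list (map (weight \<sigma>) p)) \<le> real TM + 1 + S"
proof -
  define w where "w p = real (sum_list (map (weight \<sigma>) p))" for p
  \<comment> \<open>Induction along the path. If it ends outside \<open>U\<close>, its weight is
    bounded by the stamp of its last instruction, plus \<open>S\<close> once it is past
    \<open>X\<close>; if it ends inside \<open>U\<close>, it is a prefix of weight at most
    \<open>X + 1\<close> followed by a segment within one class.\<close>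
  have "p \<noteq> [] \<longrightarrow>
     (last p \<notin> U \<longrightarrow> w p \<le> real (tau (last p)) + 1 + (if tau (last p) \<le> X then 0 else S)) \<and>
     (last p \<in> U \<longrightarrow> (\<exists>q r. p = q @ r \<and> path_in \<sigma> {i \<in> U. i < ninstr \<sigma> \<and> ev i = ev (last p)} r \<and>
        w q \<le> real X + 1))"
    if "set p \<subseteq> {..<ninstr \<sigma>}" "successively (\<lambda>i j. (i, j) \<in> edges \<sigma>) p" for p
    using that
  proof (induction p rule: rev_induct)
    case (snoc j p)
    have j: "j < ninstr \<sigma>"
      using snoc.prems by auto
    have wj: "w (p @ [j]) = w p + real (weight \<sigma> j)"
      by (simp add: w_def)
    show ?case
    proof (cases "p = []")
      case True
      have "path_in \<sigma> {i \<in> U. i < ninstr \<sigma> \<and> ev i = ev j} [j]" if "j \<in> U"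
        using j that by (simp add: path_in_def)
      then have "\<exists>q r. [j] = q @ r \<and> path_in \<sigma> {i \<in> U. i < ninstr \<sigma> \<and> ev i = ev j} r \<and>
          w q \<le> real X + 1" if "j \<in> U"
        using that by (intro exI [of _ "[]"] exI [of _ "[j]"]) (simp add: w_def)
      then show ?thesis
        using True W [OF j] S(2) by (auto simp: w_def)
    next
      case False
      define i where "i = last p"
      have ij: "(i, j) \<in> edges \<sigma>"
        and sp: "successively (\<lambda>i j. (i, j) \<in> edges \<sigma>) p" "set p \<subseteq> {..<ninstr \<sigma>}"
        using snoc.prems False by (auto simp: successively_append_iff i_def)
      have i: "i < ninstr \<sigma>"
        using sp(2) last_in_set [OF False] unfolding i_def by blast
      note IH = snoc.IH [OF sp(2,1), rule_format, OF False, folded i_def]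
      note E = E [OF ij i j]
      show ?thesis
      proof (cases "j \<in> U")
        case jU: True
        show ?thesis
        proof (cases "i \<in> U")
          case True
          with IH obtain q r where qr: "p = q @ r" "w q \<le> real X + 1"
            "path_in \<sigma> {l \<in> U. l < ninstr \<sigma> \<and> ev l = ev i} r"
            by auto
          have "path_in \<sigma> {l \<in> U. l < ninstr \<sigma> \<and> ev l = ev j} (r @ [j])"
            using qr(3) E True jU ij j qr(1) by (auto simp: path_in_def successively_append_iff i_def)
          with qr show ?thesis
            using jU by (intro conjI impI exI [of _ q] exI [of _ "r @ [j]"]) auto
        next
          case False
          have "path_in \<sigma> {l \<in> U. l < ninstr \<sigma> \<and> ev l = ev j} [j]"
            using j jU by (simp add: path_in_def)
          moreover have "w p \<le> real X + 1"
            using IH False E jU by auto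
          ultimately show ?thesis
            using jU by (intro conjI impI exI [of _ p] exI [of _ "[j]"]) auto
        qed
      next
        case jU: False
        have w1: "real (weight \<sigma> j) \<le> 1"
          using W [OF j jU] by simp
        show ?thesis
        proof (cases "i \<in> U")
          case True
          with IH obtain q r where qr: "p = q @ r" "w q \<le> real X + 1"
            "path_in \<sigma> {l \<in> U. l < ninstr \<sigma> \<and> ev l = ev i} r"
            by auto
          have "w p \<le> real X + 1 + S"
            using S(1) [OF qr(3)] qr(1,2) by (simp add: w_def)
          moreover have "X < tau j"
            using E True jU by simp
          ultimately show ?thesis
            using jU wj w1 by simp
        next
          case False
          then have "tau i < tau j"
            using E jU by simp
          moreover have "w p \<le> real (tau i) + 1 + (if tau i \<le> X then 0 else S)"
            using IH False by simp
          ultimately show ?thesis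
            using jU wj w1 S(2) by (auto split: if_splits)
        qed
      qed
    qed
  qed simp
  from this [of p] p have *: "(last p \<notin> U \<longrightarrow> w p \<le> real (tau (last p)) + 1 + (if tau (last p) \<le> X then 0 else S)) \<and>
     (last p \<in> U \<longrightarrow> (\<exists>q r. p = q @ r \<and> path_in \<sigma> {i \<in> U. i < ninstr \<sigma> \<and> ev i = ev (last p)} r \<and>
        w q \<le> real X + 1))"
    by (auto simp: path_in_def)
  have l: "last p < ninstr \<sigma>"
    using p last_in_set [of p] unfolding path_in_def by blast
  show ?thesis
  proof (cases "last p \<in> U")
    case True
    with * obtain q r where qr: "p = q @ r" "w q \<le> real X + 1"
      "path_in \<sigma> {l \<in> U. l < ninstr \<sigma> \<and> ev l = ev (last p)} r"
      by auto
    show ?thesis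
      using S(1) [OF qr(3)] qr(1,2) TM(2) by (simp add: w_def)
  next
    case False
    then show ?thesis
      using * TM(1) [OF l] S(2) by (auto simp: w_def split: if_splits)
  qed
qed

section \<open>Symbolic execution\<close>

text \<open>Roles \<open>'r\<close> name threads, labels \<open>'l\<close> name nodes. The initial thread of the evaluation forked
  by role \<open>\<rho>\<close> is \<open>Cnd \<rho>\<close>.\<close>

datatype ('r, 'l) aval = Raw val | Nd 'l | Th 'r | Cnd 'r
datatype ('r, 'l) fact = Ended 'r | Filled 'l nat
datatype 'r tag = AlgT 'r | CondT 'r

text \<open>Names never denote \<open>Null\<close>; comparing a name with \<open>Null\<close> is how
  the code tests for a missing child, neighbour or accepted leaf. A branch on a comparison that
  yields \<open>None\<close> is rejected by \<open>good\<close>.\<close>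

fun aeq :: "('r, 'l) aval \<Rightarrow> ('r, 'l) aval \<Rightarrow> bool option" where
  "aeq (Raw x) (Raw y) = Some (x = y)"
| "aeq (Nd _) (Raw Null) = Some False"
| "aeq (Th _) (Raw Null) = Some False"
| "aeq _ _ = None"

text \<open>A static account of one run. A role executes procedure \<open>prc\<close> on arguments
  \<open>ain\<close> and returns \<open>ret\<close>; it may rely on the facts \<open>K0\<close> when
  it starts and guarantees \<open>KD\<close> when it has ended. \<open>chd\<close> and
  \<open>nlab\<close> name the thread or node created at a code position, \<open>par\<close> and
  \<open>cre\<close> invert them, and \<open>cpc\<close> is the position at which a condition is
  forked. \<open>MV\<close> gives the designated contents of cells, \<open>wr\<close> and
  \<open>rd\<close> their writer and reader, \<open>old\<close> the input nodes a role reads;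
  \<open>start\<close> and \<open>fin\<close> delimit its stamps.\<close>

locale plan_sig =
  fixes K :: nat and A :: "instr list list" and m :: "nat \<Rightarrow> nat \<Rightarrow> val" and N :: nat
    and \<phi> :: "val \<Rightarrow> bool" and itm :: "'r \<Rightarrow> val"
    and Roles :: "'r set" and Evals :: "'r set"
    and prc :: "'r \<Rightarrow> nat" and ain :: "'r \<Rightarrow> ('r, 'l) aval list"
    and chd :: "'r \<Rightarrow> nat \<Rightarrow> 'r" and par :: "'r \<Rightarrow> ('r \<times> nat) option"
    and nlab :: "'r \<Rightarrow> nat \<Rightarrow> 'l" and cre :: "'l \<Rightarrow> 'r \<times> nat" and cpc :: "'r \<Rightarrow> nat"
    and MV :: "'l \<Rightarrow> nat \<Rightarrow> ('r, 'l) aval" and ret :: "'r \<Rightarrow> ('r, 'l) aval"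
    and KD :: "'r \<Rightarrow> ('r, 'l) fact set" and K0 :: "'r \<Rightarrow> ('r, 'l) fact set"
    and wr :: "'l \<Rightarrow> nat \<Rightarrow> 'r" and rd :: "'l \<Rightarrow> nat \<Rightarrow> 'r" and old :: "'r \<Rightarrow> nat \<Rightarrow> bool"
    and start :: "'r \<Rightarrow> nat" and fin :: "'r \<Rightarrow> nat" and X :: nat
begin

definition access :: "'r \<Rightarrow> ('r, 'l) fact set \<Rightarrow> 'l \<Rightarrow> nat \<Rightarrow> bool" where
  "access \<rho> F L c \<longleftrightarrow> \<rho> = wr L c \<or> \<rho> = rd L c \<and> Ended (wr L c) \<in> F"

text \<open>\<open>good \<rho> t F p cs E\<close>: role \<open>\<rho>\<close> runs through \<open>cs\<close>, its code from position \<open>p\<close> on, when its registers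
  contain \<open>E\<close>, the facts \<open>F\<close> hold and the stamps of its past are less than \<open>t\<close>. Jumps lead forward, so a
  role executes at most as many instructions as its code has. A condition can be forked only when all
  readers of the input (the roles \<open>\<rho>'\<close> with \<open>old \<rho>' a\<close>) have ended; the stamp \<open>X\<close> separates the
  forks of conditions from their joins. The value \<open>MV L c\<close> is the only one ever written
  to cell \<open>c\<close> of node \<open>L\<close>, although the cell may initially contain \<open>Null\<close>.\<close>

fun good :: "'r \<Rightarrow> nat \<Rightarrow> ('r, 'l) fact set \<Rightarrow> nat \<Rightarrow> instr list \<Rightarrow> (reg \<Rightarrow> ('r, 'l) aval) \<Rightarrow> bool" where
  "good \<rho> t F p [] E \<longleftrightarrow> False"
| "good \<rho> t F p (Const r k # cs) E \<longleftrightarrow> good \<rho> (Suc t) F (Suc p) cs (E(r := Raw (IntV k)))"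
| "good \<rho> t F p (SetNull r # cs) E \<longleftrightarrow> good \<rho> (Suc t) F (Suc p) cs (E(r := Raw Null))"
| "good \<rho> t F p (Move r r' # cs) E \<longleftrightarrow> good \<rho> (Suc t) F (Suc p) cs (E(r := E r'))"
| "good \<rho> t F p (Arith f r r1 r2 # cs) E \<longleftrightarrow>
     (case (E r1, E r2) of (Raw (IntV x), Raw (IntV y)) \<Rightarrow>
        good \<rho> (Suc t) F (Suc p) cs (E(r := Raw (IntV (arith_op f x y)))) | _ \<Rightarrow> False)"
| "good \<rho> t F p (Jump l # cs) E \<longleftrightarrow> p < l \<and> good \<rho> (Suc t) F l (drop (l - Suc p) cs) E"
| "good \<rho> t F p (BranchLess r1 r2 l # cs) E \<longleftrightarrow>
     (case (E r1, E r2) of (Raw (IntV x), Raw (IntV y)) \<Rightarrow> p < l \<and>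
        (if x < y then good \<rho> (Suc t) F l (drop (l - Suc p) cs) E
         else good \<rho> (Suc t) F (Suc p) cs E) | _ \<Rightarrow> False)"
| "good \<rho> t F p (BranchEq r1 r2 l # cs) E \<longleftrightarrow>
     (case aeq (E r1) (E r2) of None \<Rightarrow> False | Some b \<Rightarrow> p < l \<and>
        (if b then good \<rho> (Suc t) F l (drop (l - Suc p) cs) E
         else good \<rho> (Suc t) F (Suc p) cs E))"
| "good \<rho> t F p (New r # cs) E \<longleftrightarrow> cre (nlab \<rho> p) = (\<rho>, p) \<and>
     good \<rho> (Suc t) (F \<union> Filled (nlab \<rho> p) ` {c. MV (nlab \<rho> p) c = Raw Null}) (Suc p) cs
       (E(r := Nd (nlab \<rho> p)))"
| "good \<rho> t F p (RMW r q c f # cs) E \<longleftrightarrow> c < K \<and> (case f of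
      Read \<Rightarrow> (case E q of
          Nd L \<Rightarrow> Filled L c \<in> F \<and> access \<rho> F L c \<and> good \<rho> (Suc t) F (Suc p) cs (E(r := MV L c))
        | Raw x \<Rightarrow> (case x of
             NodeP a \<Rightarrow> a < N \<and> old \<rho> a \<and> good \<rho> (Suc t) F (Suc p) cs (E(r := Raw (m a c)))
           | _ \<Rightarrow> False)
        | _ \<Rightarrow> False)
    | Write r' \<Rightarrow> (case E q of
          Nd L \<Rightarrow> E r' = MV L c \<and> access \<rho> F L c \<and>
            good \<rho> (Suc t) (insert (Filled L c) F) (Suc p) cs (E(r := MV L c))
        | _ \<Rightarrow> False)
    | _ \<Rightarrow> False)"
| "good \<rho> t F p (Fork r q rs # cs) E \<longleftrightarrow> (case q of
      Alg j \<Rightarrow> chd \<rho> p \<in> Roles \<and> par (chd \<rho> p) = Some (\<rho>, p) \<and> prc (chd \<rho> p) = j \<and>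
        map E rs = ain (chd \<rho> p) \<and> t < start (chd \<rho> p) \<and> K0 (chd \<rho> p) \<subseteq> F \<and>
        good \<rho> (Suc t) F (Suc p) cs (E(r := Th (chd \<rho> p)))
    | Cond j \<Rightarrow> j = 0 \<and> map E rs = [Raw (itm \<rho>)] \<and> \<rho> \<in> Evals \<and> cpc \<rho> = p \<and> t \<le> X \<and>
        (\<forall>\<rho>' a. old \<rho>' a \<longrightarrow> Ended \<rho>' \<in> F) \<and> good \<rho> (Suc t) F (Suc p) cs (E(r := Cnd \<rho>)))"
| "good \<rho> t F p (Join r x # cs) E \<longleftrightarrow> (case E x of
      Th \<rho>' \<Rightarrow> good \<rho> (Suc (max t (Suc (fin \<rho>')))) (insert (Ended \<rho>') (KD \<rho>' \<union> F)) (Suc p) cs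
        (E(r := ret \<rho>'))
    | Cnd \<rho>' \<Rightarrow> good \<rho> (Suc (max t (Suc X))) F (Suc p) cs
        (E(r := Raw (IntV (if \<phi> (itm \<rho>') then 1 else 0))))
    | _ \<Rightarrow> False)"
| "good \<rho> t F p (Self r # cs) E \<longleftrightarrow> good \<rho> (Suc t) F (Suc p) cs (E(r := Th \<rho>))"
| "good \<rho> t F p (Suspend # cs) E \<longleftrightarrow> False"
| "good \<rho> t F p (Resume x # cs) E \<longleftrightarrow> False"
| "good \<rho> t F p (Return r # cs) E \<longleftrightarrow> E r = ret \<rho> \<and> KD \<rho> \<subseteq> insert (Ended \<rho>) F \<and> t \<le> fin \<rho>"

definition init_env :: "'r \<Rightarrow> reg \<Rightarrow> ('r, 'l) aval" where
  "init_env \<rho> r = (if r < length (ain \<rho>) then ain \<rho> ! r else Raw Null)"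

lemma good_ArithD:
  assumes "good \<rho> t F p (Arith f r r1 r2 # cs) E"
  obtains x y where "E r1 = Raw (IntV x)" "E r2 = Raw (IntV y)"
    "good \<rho> (Suc t) F (Suc p) cs (E(r := Raw (IntV (arith_op f x y))))"
  using assms that by (cases "E r1"; cases "E r2"; auto split: val.split_asm)

lemma good_BranchLessD:
  assumes "good \<rho> t F p (BranchLess r1 r2 l # cs) E"
  obtains x y where "E r1 = Raw (IntV x)" "E r2 = Raw (IntV y)" "p < l"
    "x < y \<Longrightarrow> good \<rho> (Suc t) F l (drop (l - Suc p) cs) E"
    "\<not> x < y \<Longrightarrow> good \<rho> (Suc t) F (Suc p) cs E"
  using assms that by (cases "E r1"; cases "E r2"; auto split: val.split_asm if_split_asm)

lemma good_BranchEqD: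
  assumes "good \<rho> t F p (BranchEq r1 r2 l # cs) E"
  obtains b where "aeq (E r1) (E r2) = Some b" "p < l"
    "b \<Longrightarrow> good \<rho> (Suc t) F l (drop (l - Suc p) cs) E"
    "\<not> b \<Longrightarrow> good \<rho> (Suc t) F (Suc p) cs E"
  using assms that by (cases "aeq (E r1) (E r2)") auto

lemma good_RMWD:
  assumes "good \<rho> t F p (RMW r q c f # cs) E"
  obtains (load) L where "f = Read" "c < K" "E q = Nd L" "Filled L c \<in> F" "access \<rho> F L c"
      "good \<rho> (Suc t) F (Suc p) cs (E(r := MV L c))"
    | (old) a where "f = Read" "c < K" "E q = Raw (NodeP a)" "a < N" "old \<rho> a"
      "good \<rho> (Suc t) F (Suc p) cs (E(r := Raw (m a c)))"
    | (store) L r' where "f = Write r'" "c < K" "E q = Nd L" "E r' = MV L c" "access \<rho> F L c"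
      "good \<rho> (Suc t) (insert (Filled L c) F) (Suc p) cs (E(r := MV L c))"
  using assms that by (cases f; cases "E q"; auto split: val.split_asm)

lemma good_JoinD:
  assumes "good \<rho> t F p (Join r x # cs) E"
  obtains (alg) \<rho>' where "E x = Th \<rho>'"
      "good \<rho> (Suc (max t (Suc (fin \<rho>')))) (insert (Ended \<rho>') (KD \<rho>' \<union> F)) (Suc p) cs (E(r := ret \<rho>'))"
    | (cond) \<rho>' where "E x = Cnd \<rho>'"
      "good \<rho> (Suc (max t (Suc X))) F (Suc p) cs
         (E(r := Raw (IntV (if \<phi> (itm \<rho>') then 1 else 0))))"
  using assms that by (cases "E x") auto

text \<open>Stamps grow along the code and \<open>Return\<close> compares the last one with
  \<open>fin\<close>. Since a \<open>Join\<close> pushes the stamp beyond \<open>fin\<close> of the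
  joined role, \<open>fin\<close> strictly decreases from a waiting role to the role it waits
  for.\<close>

lemma good_le_fin: "good \<rho> t F p cs E \<Longrightarrow> t \<le> fin \<rho>"
proof (induction "length cs" arbitrary: t F p cs E rule: less_induct)
  case less
  have IH: "t \<le> fin \<rho>" if "good \<rho> t' F' p' cs' E'" "length cs' < length cs" "t \<le> t'" for t' F' p' cs' E'
    using less.hyps [OF that(2,1)] that(3) by linarith
  show ?case
  proof (cases cs)
    case (Cons I cs')
    note g = less.prems [unfolded Cons]
    have len: "length (drop k cs') < length cs" "length cs' < length cs" for k
      by (simp_all add: Cons)
    show ?thesis
    proof (cases I)
      case (Arith f r r1 r2)
      from g [unfolded Arith] show ?thesis
        by (rule good_ArithD) (erule IH; simp add: len)
    next
      case (BranchLess r1 r2 l)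
      from g [unfolded BranchLess] show ?thesis
        by (rule good_BranchLessD) (metis IH len le_SucI order_refl)
    next
      case (BranchEq r1 r2 l)
      from g [unfolded BranchEq] show ?thesis
        by (rule good_BranchEqD) (metis IH len le_SucI order_refl)
    next
      case (RMW r q c f)
      from g [unfolded RMW] show ?thesis
        by (rule good_RMWD) (erule IH; simp add: len)+
    next
      case (Fork r q rs)
      from g [unfolded Fork] show ?thesis
        by (cases q; simp) (elim conjE, erule IH; simp add: len)+
    next
      case (Join r x)
      from g [unfolded Join] show ?thesis
        by (rule good_JoinD) (erule IH; simp add: len)+
    qed (use g in auto, (erule IH; use Cons in auto)+)
  qed (use less.prems in simp)
qed

end

section \<open>The invariant of a run\<close>

locale plan = plan_sig +
  fixes C :: "instr list list" and v :: val and xs :: "val list" and main :: 'a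
    and M :: nat and TM :: nat
  assumes good_role: "\<rho> \<in> Roles \<Longrightarrow> good \<rho> (start \<rho>) (K0 \<rho>) 0 (A ! prc \<rho>) (init_env \<rho>)"
    and prc_less: "\<rho> \<in> Roles \<Longrightarrow> prc \<rho> < length A"
    and main: "main \<in> Roles" "par main = None" "ain main = [Raw v]" "prc main = 0" "K0 main = {}"
    and old_inj: "old \<rho> a \<Longrightarrow> old \<rho>' a \<Longrightarrow> \<rho> = \<rho>'"
    and finite_Roles: "finite Roles" and finite_Evals: "finite Evals"
    and cond_code: "cond_code C"
    and memory: "wf_memory K m N"
    and itm: "\<rho> \<in> Evals \<Longrightarrow> itm \<rho> \<in> set xs"
    and itm_safe: "\<rho> \<in> Evals \<Longrightarrow> case itm \<rho> of NodeP a \<Rightarrow> a < N | ThreadP u \<Rightarrow> False | _ \<Rightarrow> True"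
    and code_length: "\<rho> \<in> Roles \<Longrightarrow> length (A ! prc \<rho>) \<le> M"
    and fin_TM: "\<rho> \<in> Roles \<Longrightarrow> fin \<rho> \<le> TM" and X_TM: "X \<le> TM"
begin

abbreviation P :: program where
  "P \<equiv> link A C"

abbreviation code :: "'a \<Rightarrow> instr list" where
  "code \<rho> \<equiv> A ! prc \<rho>"

definition is_alg :: "config \<Rightarrow> nat \<Rightarrow> bool" where
  "is_alg \<sigma> t \<longleftrightarrow> eval_of (thr \<sigma> t) = None"

text \<open>Ghost state: \<open>lab\<close> and \<open>rl\<close> name the nodes and threads created by the algorithm (and the
  initial threads of evaluations), \<open>tau\<close> stamps its instructions.\<close>

primrec rep :: "(nat \<Rightarrow> 'b option) \<Rightarrow> (nat \<Rightarrow> 'a tag option) \<Rightarrow> val \<Rightarrow> ('a, 'b) aval \<Rightarrow> bool" where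
  "rep lab rl x (Raw y) \<longleftrightarrow> x = y"
| "rep lab rl x (Nd L) \<longleftrightarrow> (\<exists>a. x = NodeP a \<and> lab a = Some L)"
| "rep lab rl x (Th \<rho>) \<longleftrightarrow> (\<exists>t. x = ThreadP t \<and> rl t = Some (AlgT \<rho>))"
| "rep lab rl x (Cnd \<rho>) \<longleftrightarrow> (\<exists>t. x = ThreadP t \<and> rl t = Some (CondT \<rho>))"

primrec holds :: "(nat \<Rightarrow> 'b option) \<Rightarrow> (nat \<Rightarrow> 'a tag option) \<Rightarrow> config \<Rightarrow> ('a, 'b) fact \<Rightarrow> bool" where
  "holds lab rl \<sigma> (Ended \<rho>) \<longleftrightarrow> (\<exists>t x. rl t = Some (AlgT \<rho>) \<and> status (thr \<sigma> t) = Done x)"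
| "holds lab rl \<sigma> (Filled L c) \<longleftrightarrow> (\<exists>a. lab a = Some L \<and> rep lab rl (mem \<sigma> a c) (MV L c))"

text \<open>The witnesses \<open>s\<close>, \<open>F\<close>, \<open>E\<close> are what symbolic
  execution has reached at this position. As \<open>s\<close> exceeds the stamps of all
  dependencies, it can become the stamp of the next instruction.\<close>

definition ready_ok where
  "ready_ok lab rl tau \<sigma> \<rho> th \<longleftrightarrow> status th = Ready \<and> (\<exists>s F E.
     good \<rho> s F (pc th) (drop (pc th) (code \<rho>)) E \<and> (\<forall>r. rep lab rl (regs th r) (E r)) \<and>
     (\<forall>f \<in> F. holds lab rl \<sigma> f) \<and> (\<forall>i \<in> deps th. is_alg \<sigma> (thread_of \<sigma> i) \<and> tau i < s))"

definition may where
  "may lab rl \<sigma> \<rho> L c \<longleftrightarrow> \<rho> = wr L c \<or> \<rho> = rd L c \<and> holds lab rl \<sigma> (Ended (wr L c))"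

text \<open>The disjuncts are loads from and stores to nodes of the algorithm, and loads from the
  input tree. A store is promised its fact \<open>Filled L c\<close> in advance, since the fact need
  not be true before the request is served.\<close>

definition request_ok where
  "request_ok lab rl \<sigma> \<rho> a c f av F \<longleftrightarrow>
     (\<exists>L. lab a = Some L \<and> av = MV L c \<and> may lab rl \<sigma> \<rho> L c \<and>
        f = Read \<and> holds lab rl \<sigma> (Filled L c) \<and> (\<forall>f \<in> F. holds lab rl \<sigma> f)) \<or>
     (\<exists>L x. lab a = Some L \<and> av = MV L c \<and> may lab rl \<sigma> \<rho> L c \<and>
        f = Write x \<and> rep lab rl x av \<and> (\<forall>f \<in> F - {Filled L c}. holds lab rl \<sigma> f)) \<or>
     f = Read \<and> a < N \<and> c < K \<and> old \<rho> a \<and> av = Raw (m a c) \<and> (\<forall>f \<in> F. holds lab rl \<sigma> f)"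

text \<open>The registers still represent \<open>E\<close>, while \<open>good\<close> already refers
  to the environment in which \<open>r\<close> holds the awaited value \<open>av\<close>. Weight 0
  says that the request has not been charged yet; one service then leaves weight 1.\<close>

definition wait_ok where
  "wait_ok lab rl tau \<sigma> \<rho> th \<longleftrightarrow> (\<exists>a c f r s F E av. status th = Waiting a c f r \<and>
     good \<rho> s F (pc th) (drop (pc th) (code \<rho>)) (E(r := av)) \<and> (\<forall>r. rep lab rl (regs th r) (E r)) \<and>
     (\<forall>i \<in> deps th. is_alg \<sigma> (thread_of \<sigma> i) \<and> tau i < s \<and> weight \<sigma> i = 0) \<and>
     request_ok lab rl \<sigma> \<rho> a c f av F)"

definition done_ok where
  "done_ok lab rl tau \<sigma> \<rho> th \<longleftrightarrow> (\<exists>x. status th = Done x \<and> rep lab rl x (ret \<rho>)) \<and>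
     (\<forall>f \<in> KD \<rho>. holds lab rl \<sigma> f) \<and>
     (\<forall>i \<in> deps th. is_alg \<sigma> (thread_of \<sigma> i) \<and> tau i \<le> fin \<rho>)"

text \<open>Since jumps lead forward, the program counter bounds the number of executed
  instructions; the work of a role is read off from this conjunct.\<close>

definition alg_ok where
  "alg_ok lab rl tau \<sigma> \<rho> t \<longleftrightarrow> proc (thr \<sigma> t) = Alg (prc \<rho>) \<and> pc (thr \<sigma> t) \<le> length (code \<rho>) \<and>
     card {i. i < ninstr \<sigma> \<and> thread_of \<sigma> i = t} \<le> pc (thr \<sigma> t) \<and>
     (ready_ok lab rl tau \<sigma> \<rho> (thr \<sigma> t) \<or> wait_ok lab rl tau \<sigma> \<rho> (thr \<sigma> t) \<or>
      done_ok lab rl tau \<sigma> \<rho> (thr \<sigma> t))"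

text \<open>Values an evaluation can get hold of: they give no access to the algorithm's data.\<close>

definition low :: "(nat \<Rightarrow> 'b option) \<Rightarrow> config \<Rightarrow> val \<Rightarrow> bool" where
  "low lab \<sigma> x \<longleftrightarrow> (case x of NodeP a \<Rightarrow> a < nnodes \<sigma> \<and> lab a = None
     | ThreadP u \<Rightarrow> u < nthr \<sigma> \<and> \<not> is_alg \<sigma> u | _ \<Rightarrow> True)"

text \<open>Containment for code about which only \<open>cond_code\<close> is known. An algorithm
  instruction among its dependencies is a fork of an evaluation, hence stamped at most
  \<open>X\<close>.\<close>

definition cond_ok where
  "cond_ok lab tau \<sigma> th \<longleftrightarrow> (\<exists>j. proc th = Cond j) \<and> (\<forall>r. low lab \<sigma> (regs th r)) \<and>
     (\<forall>i \<in> deps th. is_alg \<sigma> (thread_of \<sigma> i) \<longrightarrow> tau i \<le> X) \<and>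
     (\<forall>a c f r. status th = Waiting a c f r \<longrightarrow>
        a < nnodes \<sigma> \<and> c < K \<and> lab a = None \<and> (\<forall>x \<in> set_rmw f. low lab \<sigma> x)) \<and>
     (\<forall>x. status th = Done x \<longrightarrow> low lab \<sigma> x)"

text \<open>The program counter of a role never goes back, so a role standing at position
  \<open>p\<close> has not passed \<open>p\<close>. As every name of a thread or node comes with the
  position that creates it, a name about to be given is fresh.\<close>

definition passed :: "(nat \<Rightarrow> 'a tag option) \<Rightarrow> config \<Rightarrow> 'a \<Rightarrow> nat \<Rightarrow> bool" where
  "passed rl \<sigma> \<rho> p \<longleftrightarrow> (\<exists>t. rl t = Some (AlgT \<rho>) \<and> p < pc (thr \<sigma> t))"

definition tags_ok where
  "tags_ok rl \<sigma> \<longleftrightarrow>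
     (\<forall>t. rl t \<noteq> None \<longrightarrow> t < nthr \<sigma>) \<and>
     (\<forall>t < nthr \<sigma>. is_alg \<sigma> t \<longleftrightarrow> (\<exists>\<rho>. rl t = Some (AlgT \<rho>))) \<and>
     (\<forall>t < nthr \<sigma>. eval_of (thr \<sigma> t) = Some t \<longleftrightarrow> (\<exists>\<rho>. rl t = Some (CondT \<rho>))) \<and>
     (\<forall>t t' x. rl t = Some x \<longrightarrow> rl t' = Some x \<longrightarrow> t = t') \<and>
     rl 0 = Some (AlgT main) \<and>
     (\<forall>t \<rho>. rl t = Some (AlgT \<rho>) \<longrightarrow> \<rho> \<in> Roles \<and>
        (\<forall>\<rho>' p. par \<rho> = Some (\<rho>', p) \<longrightarrow> passed rl \<sigma> \<rho>' p)) \<and>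
     (\<forall>t \<rho>. rl t = Some (CondT \<rho>) \<longrightarrow> \<rho> \<in> Evals \<and> proc (thr \<sigma> t) = Cond 0 \<and>
        args (thr \<sigma> t) = [itm \<rho>] \<and> passed rl \<sigma> \<rho> (cpc \<rho>))"

definition labs_ok where
  "labs_ok lab rl \<sigma> \<longleftrightarrow>
     (\<forall>a L. lab a = Some L \<longrightarrow> N \<le> a \<and> a < nnodes \<sigma> \<and> passed rl \<sigma> (fst (cre L)) (snd (cre L))) \<and>
     (\<forall>a a' L. lab a = Some L \<longrightarrow> lab a' = Some L \<longrightarrow> a = a')"

text \<open>The input is known to be intact only as long as no evaluation exists;
  \<open>gate_ok\<close> complements this by the end of all its readers as soon as one does.\<close>

definition mem_ok where
  "mem_ok lab \<sigma> \<longleftrightarrow> N \<le> nnodes \<sigma> \<and>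
     (\<forall>a < nnodes \<sigma>. \<forall>c < K. lab a = None \<longrightarrow> low lab \<sigma> (mem \<sigma> a c)) \<and>
     ((\<forall>t < nthr \<sigma>. is_alg \<sigma> t) \<longrightarrow> (\<forall>a < N. \<forall>c < K. mem \<sigma> a c = m a c))"

definition gate_ok where
  "gate_ok lab rl \<sigma> \<longleftrightarrow> (\<exists>t < nthr \<sigma>. \<not> is_alg \<sigma> t) \<longrightarrow> (\<forall>\<rho> a. old \<rho> a \<longrightarrow> holds lab rl \<sigma> (Ended \<rho>))"

definition dag_ok where
  "dag_ok tau \<sigma> \<longleftrightarrow>
     (\<forall>i < ninstr \<sigma>. is_alg \<sigma> (thread_of \<sigma> i) \<longrightarrow> weight \<sigma> i \<le> 1 \<and> tau i \<le> TM) \<and>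
     (\<forall>i j. (i, j) \<in> edges \<sigma> \<longrightarrow>
        (is_alg \<sigma> (thread_of \<sigma> i) \<and> is_alg \<sigma> (thread_of \<sigma> j) \<longrightarrow> tau i < tau j) \<and>
        (is_alg \<sigma> (thread_of \<sigma> i) \<and> \<not> is_alg \<sigma> (thread_of \<sigma> j) \<longrightarrow> tau i \<le> X) \<and>
        (\<not> is_alg \<sigma> (thread_of \<sigma> i) \<and> is_alg \<sigma> (thread_of \<sigma> j) \<longrightarrow> X < tau j))"

definition core where
  "core lab rl tau \<sigma> \<longleftrightarrow> tags_ok rl \<sigma> \<and> labs_ok lab rl \<sigma> \<and> mem_ok lab \<sigma> \<and> gate_ok lab rl \<sigma> \<and>
     dag_ok tau \<sigma> \<and> (\<forall>t \<rho>. rl t = Some (AlgT \<rho>) \<longrightarrow> alg_ok lab rl tau \<sigma> \<rho> t) \<and>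
     (\<forall>t < nthr \<sigma>. \<not> is_alg \<sigma> t \<longrightarrow> cond_ok lab tau \<sigma> (thr \<sigma> t))"

lemma coreD:
  assumes "core lab rl tau \<sigma>"
  shows "tags_ok rl \<sigma>" "labs_ok lab rl \<sigma>" "mem_ok lab \<sigma>" "gate_ok lab rl \<sigma>" "dag_ok tau \<sigma>"
    "rl t = Some (AlgT \<rho>) \<Longrightarrow> alg_ok lab rl tau \<sigma> \<rho> t"
    "t < nthr \<sigma> \<Longrightarrow> \<not> is_alg \<sigma> t \<Longrightarrow> cond_ok lab tau \<sigma> (thr \<sigma> t)"
  using assms by (auto simp: core_def)

lemma tags_okD:
  assumes "tags_ok rl \<sigma>"
  shows "rl t = Some y \<Longrightarrow> t < nthr \<sigma>"
    "t < nthr \<sigma> \<Longrightarrow> is_alg \<sigma> t \<longleftrightarrow> (\<exists>\<rho>. rl t = Some (AlgT \<rho>))"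
    "t < nthr \<sigma> \<Longrightarrow> eval_of (thr \<sigma> t) = Some t \<longleftrightarrow> (\<exists>\<rho>. rl t = Some (CondT \<rho>))"
    "rl t = Some y \<Longrightarrow> rl t' = Some y \<Longrightarrow> t = t'"
    "rl 0 = Some (AlgT main)"
    "rl t = Some (AlgT \<rho>) \<Longrightarrow> \<rho> \<in> Roles"
    "rl t = Some (AlgT \<rho>) \<Longrightarrow> par \<rho> = Some (\<rho>', p) \<Longrightarrow> passed rl \<sigma> \<rho>' p"
    "rl t = Some (CondT \<rho>) \<Longrightarrow> \<rho> \<in> Evals \<and> proc (thr \<sigma> t) = Cond 0 \<and>
        args (thr \<sigma> t) = [itm \<rho>] \<and> passed rl \<sigma> \<rho> (cpc \<rho>)"
    "rl t = Some (AlgT \<rho>) \<Longrightarrow> is_alg \<sigma> t"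
    "rl t = Some (CondT \<rho>) \<Longrightarrow> \<not> is_alg \<sigma> t"
proof -
  note t = assms [unfolded tags_ok_def]
  show 1: "\<And>t y. rl t = Some y \<Longrightarrow> t < nthr \<sigma>"
    using t by blast
  show 2: "\<And>t. t < nthr \<sigma> \<Longrightarrow> is_alg \<sigma> t \<longleftrightarrow> (\<exists>\<rho>. rl t = Some (AlgT \<rho>))"
    using t by blast
  show "t < nthr \<sigma> \<Longrightarrow> eval_of (thr \<sigma> t) = Some t \<longleftrightarrow> (\<exists>\<rho>. rl t = Some (CondT \<rho>))"
    using t by blast
  show "rl t = Some y \<Longrightarrow> rl t' = Some y \<Longrightarrow> t = t'"
    using t by blast
  show "rl 0 = Some (AlgT main)"
    using t by blast
  show "rl t = Some (AlgT \<rho>) \<Longrightarrow> \<rho> \<in> Roles"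
    using t by blast
  show "rl t = Some (AlgT \<rho>) \<Longrightarrow> par \<rho> = Some (\<rho>', p) \<Longrightarrow> passed rl \<sigma> \<rho>' p"
    using t by blast
  show "rl t = Some (CondT \<rho>) \<Longrightarrow> \<rho> \<in> Evals \<and> proc (thr \<sigma> t) = Cond 0 \<and>
        args (thr \<sigma> t) = [itm \<rho>] \<and> passed rl \<sigma> \<rho> (cpc \<rho>)"
    using t by blast
  show "rl t = Some (AlgT \<rho>) \<Longrightarrow> is_alg \<sigma> t"
    using 1 2 by blast
  show "rl t = Some (CondT \<rho>) \<Longrightarrow> \<not> is_alg \<sigma> t"
    using 1 [of t] 2 [of t] by auto
qed

section \<open>Stability of the invariant under steps of other threads\<close>

lemma rep_mono:
  "rep lab rl x av \<Longrightarrow> lab \<subseteq>\<^sub>m lab' \<Longrightarrow> rl \<subseteq>\<^sub>m rl' \<Longrightarrow> rep lab' rl' x av"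
  by (cases av) (auto simp: map_le_def dom_def)

lemma map_leD: "f \<subseteq>\<^sub>m g \<Longrightarrow> f x = Some y \<Longrightarrow> g x = Some y"
  by (auto simp: map_le_def dom_def)

lemma effect_frame:
  assumes "t < nthr \<sigma>" "status (thr \<sigma> t) = Ready" "effect t \<sigma> \<sigma>'"
  shows "ninstr \<sigma>' = Suc (ninstr \<sigma>)" "thread_of \<sigma>' = (thread_of \<sigma>)(ninstr \<sigma> := t)"
    "i < ninstr \<sigma> \<Longrightarrow> weight \<sigma>' i = weight \<sigma> i" "weight \<sigma>' (ninstr \<sigma>) \<le> 1"
    "nnodes \<sigma> \<le> nnodes \<sigma>'" "a < nnodes \<sigma> \<Longrightarrow> mem \<sigma>' a = mem \<sigma> a"
    "u < nthr \<sigma> \<Longrightarrow> u \<noteq> t \<Longrightarrow> thr \<sigma>' u = thr \<sigma> u \<or> status (thr \<sigma> u) = Suspended"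
    "(i, j) \<in> edges \<sigma>' \<Longrightarrow> (i, j) \<in> edges \<sigma> \<or> j = ninstr \<sigma>"
  using assms(3) by (cases; use assms(1,2) in auto)+

lemma effect_pc:
  assumes "t < nthr \<sigma>" "status (thr \<sigma> t) = Ready" "effect t \<sigma> \<sigma>'" "u < nthr \<sigma>" "u \<noteq> t"
  shows "pc (thr \<sigma>' u) = pc (thr \<sigma> u)"
  using assms(3) by cases (use assms in auto)

lemma persists_is_alg: "persists \<sigma> \<sigma>' \<Longrightarrow> u < nthr \<sigma> \<Longrightarrow> is_alg \<sigma>' u = is_alg \<sigma> u"
  by (simp add: persists_def same_frame_def is_alg_def)

text \<open>An ended thread stays ended, and the last assumption lets filled cells keep their
  designated contents. This stability makes facts learned at a join usable at any later
  time.\<close>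

lemma holds_mono:
  assumes "holds lab rl \<sigma> f" "tags_ok rl \<sigma>" "lab \<subseteq>\<^sub>m lab'" "rl \<subseteq>\<^sub>m rl'" "persists \<sigma> \<sigma>'"
    and "\<And>a L c. lab a = Some L \<Longrightarrow> rep lab rl (mem \<sigma> a c) (MV L c) \<Longrightarrow> rep lab rl (mem \<sigma>' a c) (MV L c)"
  shows "holds lab' rl' \<sigma>' f"
proof (cases f)
  case (Ended \<rho>)
  then obtain t x where t: "rl t = Some (AlgT \<rho>)" "status (thr \<sigma> t) = Done x"
    using assms(1) by auto
  have "t < nthr \<sigma>"
    using tags_okD(1) [OF assms(2) t(1)] .
  then show ?thesis
    using t assms(5) map_leD [OF assms(4) t(1)] Ended by (auto simp: persists_def)
next
  case (Filled L c)
  then obtain a where a: "lab a = Some L" "rep lab rl (mem \<sigma> a c) (MV L c)"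
    using assms(1) by auto
  show ?thesis
    using Filled map_leD [OF assms(3) a(1)] rep_mono [OF assms(6) [OF a] assms(3,4)] by auto
qed

lemma low_mono:
  assumes "low lab \<sigma> x" "nnodes \<sigma> \<le> nnodes \<sigma>'" "persists \<sigma> \<sigma>'" "\<And>a. a < nnodes \<sigma> \<Longrightarrow> lab' a = lab a"
  shows "low lab' \<sigma>' x"
  using assms persists_is_alg [OF assms(3)]
  by (auto simp: low_def persists_def split: val.splits)

text \<open>Code of the condition may jump backwards; a growing program counter is demanded of
  algorithm threads only, and \<open>passed\<close> speaks of these alone.\<close>

lemma passed_mono:
  assumes "passed rl \<sigma> \<rho> p" "tags_ok rl \<sigma>" "rl \<subseteq>\<^sub>m rl'"
    and "t < nthr \<sigma>" "status (thr \<sigma> t) = Ready" "effect t \<sigma> \<sigma>'"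
    and "is_alg \<sigma> t \<Longrightarrow> pc (thr \<sigma> t) \<le> pc (thr \<sigma>' t)"
  shows "passed rl' \<sigma>' \<rho> p"
proof -
  obtain u where u: "rl u = Some (AlgT \<rho>)" "p < pc (thr \<sigma> u)"
    using assms(1) by (auto simp: passed_def)
  have "p < pc (thr \<sigma>' u)"
    using u effect_pc [OF assms(4-6), of u] tags_okD(1,9) [OF assms(2) u(1)] assms(7)
    by (cases "u = t") auto
  then show ?thesis
    using map_leD [OF assms(3) u(1)] by (auto simp: passed_def)
qed

text \<open>The invariant of a thread mentions the rest of the configuration only through names,
  facts, and data of its own instructions and dependencies. Names and facts may grow, the data must
  not change.\<close>

lemma alg_ok_same:
  assumes ok: "alg_ok lab rl tau \<sigma> \<rho> u"
    and thr: "thr \<sigma>' u = thr \<sigma> u"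
    and lab: "lab \<subseteq>\<^sub>m lab'" "rl \<subseteq>\<^sub>m rl'"
    and holds: "\<And>f. holds lab rl \<sigma> f \<Longrightarrow> holds lab' rl' \<sigma>' f"
    and count: "{i. i < ninstr \<sigma>' \<and> thread_of \<sigma>' i = u} = {i. i < ninstr \<sigma> \<and> thread_of \<sigma> i = u}"
    and deps: "\<And>i. i \<in> deps (thr \<sigma> u) \<Longrightarrow> (is_alg \<sigma>' (thread_of \<sigma>' i) \<longleftrightarrow> is_alg \<sigma> (thread_of \<sigma> i)) \<and>
        tau' i = tau i"
    and weights: "\<And>i. waiting (thr \<sigma> u) \<Longrightarrow> i \<in> deps (thr \<sigma> u) \<Longrightarrow> weight \<sigma>' i = weight \<sigma> i"
  shows "alg_ok lab' rl' tau' \<sigma>' \<rho> u"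
proof -
  have req: "request_ok lab rl \<sigma> \<rho> a c f av F \<Longrightarrow> request_ok lab' rl' \<sigma>' \<rho> a c f av F" for a c f av F
  proof -
    have may: "may lab rl \<sigma> \<rho> L c \<Longrightarrow> may lab' rl' \<sigma>' \<rho> L c" for L c
      unfolding may_def using holds by blast
    show "request_ok lab rl \<sigma> \<rho> a c f av F \<Longrightarrow> request_ok lab' rl' \<sigma>' \<rho> a c f av F"
      unfolding request_ok_def
      by (elim disjE exE conjE) (use may holds map_leD [OF lab(1)] rep_mono [OF _ lab] in blast)+
  qed
  from ok consider (ready) "ready_ok lab rl tau \<sigma> \<rho> (thr \<sigma> u)"
    | (wait) "wait_ok lab rl tau \<sigma> \<rho> (thr \<sigma> u)" | (ended) "done_ok lab rl tau \<sigma> \<rho> (thr \<sigma> u)"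
    by (auto simp: alg_ok_def)
  then have "ready_ok lab' rl' tau' \<sigma>' \<rho> (thr \<sigma> u) \<or> wait_ok lab' rl' tau' \<sigma>' \<rho> (thr \<sigma> u) \<or>
      done_ok lab' rl' tau' \<sigma>' \<rho> (thr \<sigma> u)"
  proof cases
    case ready
    then have "ready_ok lab' rl' tau' \<sigma>' \<rho> (thr \<sigma> u)"
      unfolding ready_ok_def using holds rep_mono [OF _ lab] deps by metis
    then show ?thesis ..
  next
    case wait
    then obtain a c f r s F E av where w: "status (thr \<sigma> u) = Waiting a c f r"
      "good \<rho> s F (pc (thr \<sigma> u)) (drop (pc (thr \<sigma> u)) (code \<rho>)) (E(r := av))"
      "\<forall>r. rep lab rl (regs (thr \<sigma> u) r) (E r)"
      "\<forall>i \<in> deps (thr \<sigma> u). is_alg \<sigma> (thread_of \<sigma> i) \<and> tau i < s \<and> weight \<sigma> i = 0"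
      "request_ok lab rl \<sigma> \<rho> a c f av F"
      unfolding wait_ok_def by blast
    have "\<forall>i \<in> deps (thr \<sigma> u). is_alg \<sigma>' (thread_of \<sigma>' i) \<and> tau' i < s \<and> weight \<sigma>' i = 0"
      using w(1,4) deps weights by (auto simp: waiting_def)
    then have "wait_ok lab' rl' tau' \<sigma>' \<rho> (thr \<sigma> u)"
      unfolding wait_ok_def using w(1,2,3) req [OF w(5)] rep_mono [OF _ lab] by blast
    then show ?thesis by simp
  next
    case ended
    then have "done_ok lab' rl' tau' \<sigma>' \<rho> (thr \<sigma> u)"
      unfolding done_ok_def using holds rep_mono [OF _ lab] deps by metis
    then show ?thesis by simp
  qed
  then show ?thesis
    using ok unfolding alg_ok_def thr count by blast
qed

lemma cond_ok_same:
  assumes ok: "cond_ok lab tau \<sigma> th" and n: "nnodes \<sigma> \<le> nnodes \<sigma>'" and pe: "persists \<sigma> \<sigma>'"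
    and lab: "\<And>a. a < nnodes \<sigma> \<Longrightarrow> lab' a = lab a"
    and deps: "\<And>i. i \<in> deps th \<Longrightarrow> (is_alg \<sigma>' (thread_of \<sigma>' i) \<longleftrightarrow> is_alg \<sigma> (thread_of \<sigma> i)) \<and>
        tau' i = tau i"
  shows "cond_ok lab' tau' \<sigma>' th"
proof -
  have low: "low lab \<sigma> x \<Longrightarrow> low lab' \<sigma>' x" for x
    by (rule low_mono [OF _ n pe lab])
  show ?thesis
    using ok n lab low deps unfolding cond_ok_def by (metis less_le_trans)
qed

text \<open>A frame rule: what remains to be shown after a step of \<open>t\<close> concerns
  \<open>t\<close> itself, new threads and nodes, edges into the new instruction, and evaluation
  threads changed by a resumption.\<close>

lemma core_exec:
  assumes core: "core lab rl tau \<sigma>" and wf: "wf_config \<sigma>"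
    and t: "t < nthr \<sigma>" "status (thr \<sigma> t) = Ready" and eff: "effect t \<sigma> \<sigma>'"
    and lab: "lab \<subseteq>\<^sub>m lab'" "\<And>a. a < nnodes \<sigma> \<Longrightarrow> lab' a = lab a" and rl: "rl \<subseteq>\<^sub>m rl'"
    and tags: "tags_ok rl' \<sigma>'" and labs: "labs_ok lab' rl' \<sigma>'"
    and edges: "\<And>i. (i, ninstr \<sigma>) \<in> edges \<sigma>' \<Longrightarrow> i < ninstr \<sigma> \<Longrightarrow>
      (is_alg \<sigma> t \<longrightarrow> (if is_alg \<sigma> (thread_of \<sigma> i) then tau i < s else X < s)) \<and>
      (\<not> is_alg \<sigma> t \<longrightarrow> is_alg \<sigma> (thread_of \<sigma> i) \<longrightarrow> tau i \<le> X)"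
    and s: "is_alg \<sigma> t \<Longrightarrow> s \<le> TM"
    and mem: "\<And>a c. nnodes \<sigma> \<le> a \<Longrightarrow> a < nnodes \<sigma>' \<Longrightarrow> lab' a = None \<Longrightarrow> low lab' \<sigma>' (mem \<sigma>' a c)"
    and gate: "\<And>u. u < nthr \<sigma>' \<Longrightarrow> \<not> is_alg \<sigma>' u \<Longrightarrow>
      (\<exists>u < nthr \<sigma>. \<not> is_alg \<sigma> u) \<or> (\<forall>\<rho> a. old \<rho> a \<longrightarrow> holds lab rl \<sigma> (Ended \<rho>))"
    and algs: "\<And>u \<rho>. rl' u = Some (AlgT \<rho>) \<Longrightarrow> u = t \<or> rl u = None \<Longrightarrow>
      alg_ok lab' rl' (tau(ninstr \<sigma> := s)) \<sigma>' \<rho> u"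
    and conds: "\<And>u. u < nthr \<sigma>' \<Longrightarrow> \<not> is_alg \<sigma>' u \<Longrightarrow> u = t \<or> nthr \<sigma> \<le> u \<or> thr \<sigma>' u \<noteq> thr \<sigma> u \<Longrightarrow>
      cond_ok lab' (tau(ninstr \<sigma> := s)) \<sigma>' (thr \<sigma>' u)"
  shows "core lab' rl' (tau(ninstr \<sigma> := s)) \<sigma>'"
proof -
  note fr = effect_frame [OF t eff]
  have pe: "persists \<sigma> \<sigma>'"
    by (rule effect_persists [OF t eff])
  have wf': "wf_config \<sigma>'"
    by (rule effect_wf [OF wf t eff])
  have nthr: "nthr \<sigma> \<le> nthr \<sigma>'"
    using pe by (simp add: persists_def)
  have alg: "u < nthr \<sigma> \<Longrightarrow> is_alg \<sigma>' u = is_alg \<sigma> u" for u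
    by (rule persists_is_alg [OF pe])
  have algi: "is_alg \<sigma>' (thread_of \<sigma>' i) = is_alg \<sigma> (thread_of \<sigma> i)" if "i < ninstr \<sigma>" for i
    using that fr(2) wf_configD(2) [OF wf that] alg by simp
  note cd = coreD [OF core]
  have laba: "lab a = Some L \<Longrightarrow> a < nnodes \<sigma>" for a L
    using cd(2) by (auto simp: labs_ok_def)
  have holds: "holds lab rl \<sigma> f \<Longrightarrow> holds lab' rl' \<sigma>' f" for f
    by (rule holds_mono [OF _ cd(1) lab(1) rl pe]) (use laba fr(6) in auto)
  have dep: "(is_alg \<sigma>' (thread_of \<sigma>' i) \<longleftrightarrow> is_alg \<sigma> (thread_of \<sigma> i)) \<and> (tau(ninstr \<sigma> := s)) i = tau i"
    if "u < nthr \<sigma>" "i \<in> deps (thr \<sigma> u)" for u i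
    using that wf_configD(1) [OF wf that(1)] algi by auto
  have alg_same: "alg_ok lab' rl' (tau(ninstr \<sigma> := s)) \<sigma>' \<rho> u" if "rl u = Some (AlgT \<rho>)" "u \<noteq> t" for u \<rho>
  proof (rule alg_ok_same [OF cd(6) [OF that(1)] _ lab(1) rl holds])
    have u: "u < nthr \<sigma>"
      using tags_okD(1) [OF cd(1) that(1)] .
    \<comment> \<open>Algorithm threads are never suspended, so no \<open>Resume\<close> can alter
      one.\<close>
    have "status (thr \<sigma> u) \<noteq> Suspended"
      using cd(6) [OF that(1)] by (auto simp: alg_ok_def ready_ok_def wait_ok_def done_ok_def)
    then show "thr \<sigma>' u = thr \<sigma> u"
      using fr(7) [OF u that(2)] by simp
    show "{i. i < ninstr \<sigma>' \<and> thread_of \<sigma>' i = u} = {i. i < ninstr \<sigma> \<and> thread_of \<sigma> i = u}"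
      using that(2) fr(1,2) by (auto simp: less_Suc_eq)
    show "(is_alg \<sigma>' (thread_of \<sigma>' i) \<longleftrightarrow> is_alg \<sigma> (thread_of \<sigma> i)) \<and> (tau(ninstr \<sigma> := s)) i = tau i"
      if "i \<in> deps (thr \<sigma> u)" for i
      using dep [OF u that] .
    show "weight \<sigma>' i = weight \<sigma> i" if "i \<in> deps (thr \<sigma> u)" for i
      using fr(3) wf_configD(1) [OF wf u] that by auto
  qed
  have "alg_ok lab' rl' (tau(ninstr \<sigma> := s)) \<sigma>' \<rho> u" if "rl' u = Some (AlgT \<rho>)" for u \<rho>
  proof (cases "u = t \<or> rl u = None")
    case True
    with algs [OF that] show ?thesis .
  next
    case False
    then obtain x where x: "rl u = Some x" "u \<noteq> t" by auto
    with map_leD [OF rl x(1)] that show ?thesis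
      using alg_same by simp
  qed
  moreover have "cond_ok lab' (tau(ninstr \<sigma> := s)) \<sigma>' (thr \<sigma>' u)" if u: "u < nthr \<sigma>'" "\<not> is_alg \<sigma>' u" for u
  proof (cases "u = t \<or> nthr \<sigma> \<le> u \<or> thr \<sigma>' u \<noteq> thr \<sigma> u")
    case True
    with conds [OF u] show ?thesis .
  next
    case False
    then have u': "u < nthr \<sigma>" "thr \<sigma>' u = thr \<sigma> u" by auto
    have "cond_ok lab tau \<sigma> (thr \<sigma> u)"
      using cd(7) [OF u'(1)] u u' alg by simp
    then show ?thesis
      unfolding u'(2) by (rule cond_ok_same [OF _ fr(5) pe lab(2) dep [OF u'(1)]])
  qed
  moreover have "mem_ok lab' \<sigma>'"
  proof -
    have m: "N \<le> nnodes \<sigma>" "\<And>a c. a < nnodes \<sigma> \<Longrightarrow> c < K \<Longrightarrow> lab a = None \<Longrightarrow> low lab \<sigma> (mem \<sigma> a c)"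
      "(\<forall>t < nthr \<sigma>. is_alg \<sigma> t) \<Longrightarrow> a < N \<Longrightarrow> c < K \<Longrightarrow> mem \<sigma> a c = m a c" for a c
      using cd(3) by (auto simp: mem_ok_def)
    have "low lab' \<sigma>' (mem \<sigma>' a c)" if "a < nnodes \<sigma>'" "c < K" "lab' a = None" for a c
    proof (cases "a < nnodes \<sigma>")
      case True
      then have "low lab \<sigma> (mem \<sigma> a c)"
        using m(2) that lab(2) by simp
      then show ?thesis
        using low_mono [OF _ fr(5) pe lab(2)] fr(6) [OF True] by simp
    next
      case False
      with mem that show ?thesis by simp
    qed
    moreover have "mem \<sigma>' a c = m a c" if "\<forall>t < nthr \<sigma>'. is_alg \<sigma>' t" "a < N" "c < K" for a c
    proof -
      have "\<forall>t < nthr \<sigma>. is_alg \<sigma> t"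
        using that(1) nthr alg by auto
      then show ?thesis
        using m(3) [of a c] m(1) fr(6) [of a] that by simp
    qed
    ultimately show ?thesis
      using m(1) fr(5) by (auto simp: mem_ok_def)
  qed
  moreover have "gate_ok lab' rl' \<sigma>'"
    using gate cd(4) holds unfolding gate_ok_def by meson
  moreover have "dag_ok (tau(ninstr \<sigma> := s)) \<sigma>'"
    unfolding dag_ok_def
  proof (intro conjI allI impI)
    fix i
    assume i: "i < ninstr \<sigma>'" "is_alg \<sigma>' (thread_of \<sigma>' i)"
    show "weight \<sigma>' i \<le> 1"
      using i cd(5) fr(1,3,4) algi by (cases "i = ninstr \<sigma>") (auto simp: dag_ok_def)
    show "(tau(ninstr \<sigma> := s)) i \<le> TM"
      using i cd(5) fr(1,2) algi s alg t(1) by (cases "i = ninstr \<sigma>") (auto simp: dag_ok_def)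
  next
    fix i j
    assume ij: "(i, j) \<in> edges \<sigma>'"
    have less: "i < j" "j < Suc (ninstr \<sigma>)"
      using wf_configD(3) [OF wf' ij] fr(1) by auto
    have new: "j = ninstr \<sigma> \<Longrightarrow> thread_of \<sigma>' j = t \<and> is_alg \<sigma>' t = is_alg \<sigma> t"
      using fr(2) alg t(1) by simp
    have old: "j \<noteq> ninstr \<sigma> \<Longrightarrow> (i, j) \<in> edges \<sigma> \<and> i < ninstr \<sigma> \<and> j < ninstr \<sigma>"
      using fr(8) [OF ij] less by auto
    show "(tau(ninstr \<sigma> := s)) i < (tau(ninstr \<sigma> := s)) j"
      if "is_alg \<sigma>' (thread_of \<sigma>' i) \<and> is_alg \<sigma>' (thread_of \<sigma>' j)"
      using that edges [of i] ij less new old algi [of i] algi [of j] cd(5)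
      by (cases "j = ninstr \<sigma>") (auto simp: dag_ok_def)
    show "(tau(ninstr \<sigma> := s)) i \<le> X"
      if "is_alg \<sigma>' (thread_of \<sigma>' i) \<and> \<not> is_alg \<sigma>' (thread_of \<sigma>' j)"
      using that edges [of i] ij less new old algi [of i] algi [of j] cd(5)
      by (cases "j = ninstr \<sigma>") (auto simp: dag_ok_def)
    show "X < (tau(ninstr \<sigma> := s)) j"
      if "\<not> is_alg \<sigma>' (thread_of \<sigma>' i) \<and> is_alg \<sigma>' (thread_of \<sigma>' j)"
      using that edges [of i] ij less new old algi [of i] algi [of j] cd(5)
      by (cases "j = ninstr \<sigma>") (auto simp: dag_ok_def)
  qed
  ultimately show ?thesis
    using tags labs by (simp add: core_def)
qed

text \<open>Weaker than \<open>evaluates\<close>, but inherited by earlier configurations, because a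
  result never changes. The invariant needs results at the moment they are joined.\<close>

definition honest :: "config \<Rightarrow> bool" where
  "honest \<sigma> \<longleftrightarrow> (\<forall>e x y. evaluation \<sigma> e x \<longrightarrow> x \<in> set xs \<longrightarrow> status (thr \<sigma> e) = Done y \<longrightarrow>
     y = IntV (if \<phi> x then 1 else 0))"

lemma tags_same:
  assumes tags: "tags_ok rl \<sigma>" and t: "t < nthr \<sigma>" "status (thr \<sigma> t) = Ready" and eff: "effect t \<sigma> \<sigma>'"
    and nthr: "nthr \<sigma>' = nthr \<sigma>" and pc: "is_alg \<sigma> t \<Longrightarrow> pc (thr \<sigma> t) \<le> pc (thr \<sigma>' t)"
  shows "tags_ok rl \<sigma>'"
proof -
  have pe: "persists \<sigma> \<sigma>'"
    by (rule effect_persists [OF t eff])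
  have pa: "passed rl \<sigma> \<rho> p \<Longrightarrow> passed rl \<sigma>' \<rho> p" for \<rho> p
    by (rule passed_mono [OF _ tags map_le_refl t eff pc])
  have fr: "same_frame (thr \<sigma> u) (thr \<sigma>' u)" if "u < nthr \<sigma>" for u
    using pe that by (simp add: persists_def)
  note tg = tags_okD [OF tags]
  show ?thesis
    unfolding tags_ok_def nthr
  proof (intro conjI allI impI)
    show "rl u \<noteq> None \<Longrightarrow> u < nthr \<sigma>" for u
      using tg(1) by blast
    show "is_alg \<sigma>' u \<longleftrightarrow> (\<exists>\<rho>. rl u = Some (AlgT \<rho>))" if "u < nthr \<sigma>" for u
      using tg(2) [OF that] persists_is_alg [OF pe that] by simp
    show "eval_of (thr \<sigma>' u) = Some u \<longleftrightarrow> (\<exists>\<rho>. rl u = Some (CondT \<rho>))" if "u < nthr \<sigma>" for u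
      using tg(3) [OF that] fr [OF that] by (simp add: same_frame_def)
    show "rl u = Some y \<Longrightarrow> rl u' = Some y \<Longrightarrow> u = u'" for u u' y
      using tg(4) by blast
    show "rl 0 = Some (AlgT main)"
      by (rule tg(5))
    show "\<rho> \<in> Roles" if "rl u = Some (AlgT \<rho>)" for u \<rho>
      using tg(6) that by blast
    show "passed rl \<sigma>' \<rho>' p" if "rl u = Some (AlgT \<rho>)" "par \<rho> = Some (\<rho>', p)" for u \<rho> \<rho>' p
      using tg(7) that pa by blast
    fix u \<rho>
    assume u: "rl u = Some (CondT \<rho>)"
    have "u < nthr \<sigma>"
      by (rule tg(1) [OF u])
    then show "\<rho> \<in> Evals" "proc (thr \<sigma>' u) = Cond 0" "args (thr \<sigma>' u) = [itm \<rho>]" "passed rl \<sigma>' \<rho> (cpc \<rho>)"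
      using tg(8) [OF u] fr [of u] pa by (auto simp: same_frame_def)
  qed
qed

lemma labs_same:
  assumes labs: "labs_ok lab rl \<sigma>" and tags: "tags_ok rl \<sigma>" and rl: "rl \<subseteq>\<^sub>m rl'"
    and t: "t < nthr \<sigma>" "status (thr \<sigma> t) = Ready" and eff: "effect t \<sigma> \<sigma>'"
    and pc: "is_alg \<sigma> t \<Longrightarrow> pc (thr \<sigma> t) \<le> pc (thr \<sigma>' t)"
  shows "labs_ok lab rl' \<sigma>'"
  using labs passed_mono [OF _ tags rl t eff pc] effect_frame(5) [OF t eff]
  unfolding labs_ok_def by (meson less_le_trans)

lemma alg_ready:
  assumes core: "core lab rl tau \<sigma>" and t: "t < nthr \<sigma>" "status (thr \<sigma> t) = Ready"
    and eff: "effect t \<sigma> \<sigma>'" and alg: "is_alg \<sigma> t"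
    and lab: "lab \<subseteq>\<^sub>m lab'" and rl: "rl \<subseteq>\<^sub>m rl'"
    and th: "status (thr \<sigma>' t) = Ready" "deps (thr \<sigma>' t) = {ninstr \<sigma>}"
    and good: "good \<rho> (Suc s) F (pc (thr \<sigma>' t)) (drop (pc (thr \<sigma>' t)) (code \<rho>)) E"
    and regs: "\<And>r. rep lab' rl' (regs (thr \<sigma>' t) r) (E r)"
    and F: "\<And>f. f \<in> F \<Longrightarrow> holds lab rl \<sigma> f \<or> holds lab' rl' \<sigma>' f"
  shows "ready_ok lab' rl' (tau(ninstr \<sigma> := s)) \<sigma>' \<rho> (thr \<sigma>' t)"
proof -
  have pe: "persists \<sigma> \<sigma>'"
    by (rule effect_persists [OF t eff])
  have "holds lab' rl' \<sigma>' f" if "holds lab rl \<sigma> f" for f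
    by (rule holds_mono [OF that coreD(1) [OF core] lab rl pe])
      (use coreD(2) [OF core] effect_frame(6) [OF t eff] in \<open>auto simp: labs_ok_def\<close>)
  then have "\<forall>f \<in> F. holds lab' rl' \<sigma>' f"
    using F by blast
  moreover have "is_alg \<sigma>' (thread_of \<sigma>' i) \<and> (tau(ninstr \<sigma> := s)) i < Suc s"
    if "i \<in> deps (thr \<sigma>' t)" for i
    using that th(2) effect_frame(2) [OF t eff] alg persists_is_alg [OF pe t(1)] by simp
  ultimately show ?thesis
    unfolding ready_ok_def using th(1) good regs by blast
qed

lemma alg_exec:
  assumes core: "core lab rl tau \<sigma>" and wf: "wf_config \<sigma>"
    and rlt: "rl t = Some (AlgT \<rho>)" and st: "status (thr \<sigma> t) = Ready" and eff: "effect t \<sigma> \<sigma>'"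
    and lab: "lab \<subseteq>\<^sub>m lab'" "\<And>a. a < nnodes \<sigma> \<Longrightarrow> lab' a = lab a" and rl: "rl \<subseteq>\<^sub>m rl'"
    and tags: "tags_ok rl' \<sigma>'" and labs: "labs_ok lab' rl' \<sigma>'"
    and edges: "\<And>i. (i, ninstr \<sigma>) \<in> edges \<sigma>' \<Longrightarrow> i < ninstr \<sigma> \<Longrightarrow>
      (if is_alg \<sigma> (thread_of \<sigma> i) then tau i < s else X < s)"
    and s: "s \<le> fin \<rho>"
    and mem: "\<And>a. nnodes \<sigma> \<le> a \<Longrightarrow> a < nnodes \<sigma>' \<Longrightarrow> lab' a \<noteq> None"
    and gate: "\<And>u. u < nthr \<sigma>' \<Longrightarrow> \<not> is_alg \<sigma>' u \<Longrightarrow>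
      (\<exists>u < nthr \<sigma>. \<not> is_alg \<sigma> u) \<or> (\<forall>\<rho> a. old \<rho> a \<longrightarrow> holds lab rl \<sigma> (Ended \<rho>))"
    and pc: "pc (thr \<sigma> t) < pc (thr \<sigma>' t)" "pc (thr \<sigma>' t) \<le> length (code \<rho>)"
    and ok: "ready_ok lab' rl' (tau(ninstr \<sigma> := s)) \<sigma>' \<rho> (thr \<sigma>' t) \<or>
      wait_ok lab' rl' (tau(ninstr \<sigma> := s)) \<sigma>' \<rho> (thr \<sigma>' t) \<or>
      done_ok lab' rl' (tau(ninstr \<sigma> := s)) \<sigma>' \<rho> (thr \<sigma>' t)"
    and algs: "\<And>u \<rho>. rl' u = Some (AlgT \<rho>) \<Longrightarrow> rl u = None \<Longrightarrow>
      alg_ok lab' rl' (tau(ninstr \<sigma> := s)) \<sigma>' \<rho> u"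
    and conds: "\<And>u. nthr \<sigma> \<le> u \<Longrightarrow> u < nthr \<sigma>' \<Longrightarrow> \<not> is_alg \<sigma>' u \<Longrightarrow>
      cond_ok lab' (tau(ninstr \<sigma> := s)) \<sigma>' (thr \<sigma>' u)"
    and same: "\<And>u. u < nthr \<sigma> \<Longrightarrow> u \<noteq> t \<Longrightarrow> thr \<sigma>' u = thr \<sigma> u"
  shows "core lab' rl' (tau(ninstr \<sigma> := s)) \<sigma>'"
proof -
  have t: "t < nthr \<sigma>"
    using tags_okD(1) [OF coreD(1) [OF core] rlt] .
  have alg: "is_alg \<sigma> t"
    using tags_okD(9) [OF coreD(1) [OF core] rlt] .
  have \<rho>: "\<rho> \<in> Roles"
    using tags_okD(6) [OF coreD(1) [OF core] rlt] .
  have pe: "persists \<sigma> \<sigma>'"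
    by (rule effect_persists [OF t st eff])
  have alg': "is_alg \<sigma>' t"
    using persists_is_alg [OF pe t] alg by simp
  note fr = effect_frame [OF t st eff]
  show ?thesis
  proof (rule core_exec [OF core wf t st eff lab rl tags labs])
    show "(is_alg \<sigma> t \<longrightarrow> (if is_alg \<sigma> (thread_of \<sigma> i) then tau i < s else X < s)) \<and>
        (\<not> is_alg \<sigma> t \<longrightarrow> is_alg \<sigma> (thread_of \<sigma> i) \<longrightarrow> tau i \<le> X)"
      if "(i, ninstr \<sigma>) \<in> edges \<sigma>'" "i < ninstr \<sigma>" for i
      using edges [OF that] alg by simp
    show "s \<le> TM"
      using s fin_TM [OF \<rho>] by simp
    show "low lab' \<sigma>' (mem \<sigma>' a c)" if "nnodes \<sigma> \<le> a" "a < nnodes \<sigma>'" "lab' a = None" for a c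
      using mem [OF that(1,2)] that(3) by simp
    show "(\<exists>u<nthr \<sigma>. \<not> is_alg \<sigma> u) \<or> (\<forall>\<rho> a. old \<rho> a \<longrightarrow> holds lab rl \<sigma> (Ended \<rho>))"
      if "u < nthr \<sigma>'" "\<not> is_alg \<sigma>' u" for u
      using gate that .
    show "cond_ok lab' (tau(ninstr \<sigma> := s)) \<sigma>' (thr \<sigma>' u)"
      if "u < nthr \<sigma>'" "\<not> is_alg \<sigma>' u" "u = t \<or> nthr \<sigma> \<le> u \<or> thr \<sigma>' u \<noteq> thr \<sigma> u" for u
      using that conds same alg' by (metis not_le)
    fix u \<rho>'
    assume u: "rl' u = Some (AlgT \<rho>')" "u = t \<or> rl u = None"
    show "alg_ok lab' rl' (tau(ninstr \<sigma> := s)) \<sigma>' \<rho>' u"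
    proof (cases "rl u = None")
      case True
      with algs u show ?thesis by blast
    next
      case False
      with u rlt map_leD [OF rl rlt] have u': "u = t" "\<rho>' = \<rho>" by auto
      have eq: "{i. i < ninstr \<sigma>' \<and> thread_of \<sigma>' i = t} =
          insert (ninstr \<sigma>) {i. i < ninstr \<sigma> \<and> thread_of \<sigma> i = t}"
        using fr(1,2) by (auto simp: less_Suc_eq)
      have "card {i. i < ninstr \<sigma>' \<and> thread_of \<sigma>' i = t} \<le> Suc (pc (thr \<sigma> t))"
        unfolding eq using coreD(6) [OF core rlt] by (simp add: alg_ok_def)
      moreover have "proc (thr \<sigma>' t) = Alg (prc \<rho>)"
        using pe t coreD(6) [OF core rlt] by (auto simp: persists_def same_frame_def alg_ok_def)
      ultimately show ?thesis
        unfolding u' alg_ok_def using ok pc by simp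
    qed
  qed
qed

lemma alg_local:
  assumes core: "core lab rl tau \<sigma>" and wf: "wf_config \<sigma>"
    and rlt: "rl t = Some (AlgT \<rho>)" and st: "status (thr \<sigma> t) = Ready" and eff: "effect t \<sigma> \<sigma>'"
    and nthr: "nthr \<sigma>' = nthr \<sigma>" and nnodes: "nnodes \<sigma>' = nnodes \<sigma>"
    and same: "\<And>u. u < nthr \<sigma> \<Longrightarrow> u \<noteq> t \<Longrightarrow> thr \<sigma>' u = thr \<sigma> u"
    and edges: "\<And>i. (i, ninstr \<sigma>) \<in> edges \<sigma>' \<Longrightarrow> i < ninstr \<sigma> \<Longrightarrow>
      (if is_alg \<sigma> (thread_of \<sigma> i) then tau i < s else X < s)"
    and s: "s \<le> fin \<rho>"
    and pc: "pc (thr \<sigma> t) < pc (thr \<sigma>' t)" "pc (thr \<sigma>' t) \<le> length (code \<rho>)"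
    and ok: "ready_ok lab rl (tau(ninstr \<sigma> := s)) \<sigma>' \<rho> (thr \<sigma>' t) \<or>
      wait_ok lab rl (tau(ninstr \<sigma> := s)) \<sigma>' \<rho> (thr \<sigma>' t) \<or>
      done_ok lab rl (tau(ninstr \<sigma> := s)) \<sigma>' \<rho> (thr \<sigma>' t)"
  shows "core lab rl (tau(ninstr \<sigma> := s)) \<sigma>'"
proof -
  note tg = tags_okD [OF coreD(1) [OF core]]
  have t: "t < nthr \<sigma>"
    using tg(1) [OF rlt] .
  have pe: "persists \<sigma> \<sigma>'"
    by (rule effect_persists [OF t st eff])
  show ?thesis
  proof (rule alg_exec [OF core wf rlt st eff map_le_refl refl map_le_refl])
    show "tags_ok rl \<sigma>'"
      by (rule tags_same [OF coreD(1) [OF core] t st eff nthr]) (use pc in simp)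
    show "labs_ok lab rl \<sigma>'"
      by (rule labs_same [OF coreD(2) [OF core] coreD(1) [OF core] map_le_refl t st eff]) (use pc in simp)
    show "(\<exists>u<nthr \<sigma>. \<not> is_alg \<sigma> u) \<or> (\<forall>\<rho> a. old \<rho> a \<longrightarrow> holds lab rl \<sigma> (Ended \<rho>))"
      if "u < nthr \<sigma>'" "\<not> is_alg \<sigma>' u" for u
      using that persists_is_alg [OF pe, of u] nthr by auto
  qed (use edges s pc ok same nthr nnodes in auto)
qed

section \<open>Preservation of the invariant\<close>

lemma holds_effect:
  assumes core: "core lab rl tau \<sigma>" and t: "t < nthr \<sigma>" "status (thr \<sigma> t) = Ready"
    and eff: "effect t \<sigma> \<sigma>'" and lab: "lab \<subseteq>\<^sub>m lab'" and rl: "rl \<subseteq>\<^sub>m rl'"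
    and holds: "holds lab rl \<sigma> f"
  shows "holds lab' rl' \<sigma>' f"
  by (rule holds_mono [OF holds coreD(1) [OF core] lab rl effect_persists [OF t eff]])
    (use coreD(2) [OF core] effect_frame(6) [OF t eff] in \<open>auto simp: labs_ok_def\<close>)

lemma aeq_rep:
  "aeq x y = Some b \<Longrightarrow> rep lab rl u x \<Longrightarrow> rep lab rl w y \<Longrightarrow> (u = w) = b"
  by (cases "(x, y)" rule: aeq.cases) auto

text \<open>Covers the instructions after which the thread is ready again and no thread, node or
  request has been created; they differ only in the new environment and, for joins, in the
  dependencies \<open>D\<close>.\<close>

lemma alg_plain:
  assumes core: "core lab rl tau \<sigma>" and wf: "wf_config \<sigma>"
    and rlt: "rl t = Some (AlgT \<rho>)" and st: "status (thr \<sigma> t) = Ready"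
    and ex: "exec K P t \<sigma> = Some \<sigma>'" and \<sigma>': "\<sigma>' = set_thr t th' (add_instr t D (Suc 0) \<sigma>)"
    and th': "status th' = Ready" "deps th' = {ninstr \<sigma>}" "pc (thr \<sigma> t) < pc th'"
    and D: "\<And>i. i \<in> D \<Longrightarrow> if is_alg \<sigma> (thread_of \<sigma> i) then tau i < s else X < s"
    and good: "good \<rho> (Suc s) F (pc th') (drop (pc th') (code \<rho>)) E"
    and regs: "\<And>r. rep lab rl (regs th' r) (E r)"
    and F: "\<And>f. f \<in> F \<Longrightarrow> holds lab rl \<sigma> f"
  shows "core lab rl (tau(ninstr \<sigma> := s)) \<sigma>'"
proof -
  have t: "t < nthr \<sigma>" and alg: "is_alg \<sigma> t"
    using tags_okD(1,9) [OF coreD(1) [OF core] rlt] .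
  have eff: "effect t \<sigma> \<sigma>'"
    by (rule exec_effect [OF ex])
  \<comment> \<open>\<open>good\<close> fails on empty code, so a jump cannot leave the
    procedure.\<close>
  have "pc th' \<le> length (code \<rho>)"
    using good by (cases "pc th' \<le> length (code \<rho>)") auto
  moreover have "ready_ok lab rl (tau(ninstr \<sigma> := s)) \<sigma>' \<rho> (thr \<sigma>' t)"
    by (rule alg_ready [OF core t st eff alg map_le_refl map_le_refl]) (use good regs F th' \<sigma>' in auto)
  ultimately show ?thesis
    using D th' good_le_fin [OF good] wf_configD(3) [OF wf]
    by (intro alg_local [OF core wf rlt st eff]) (auto simp: \<sigma>')
qed

lemma tags_fork:
  assumes tags: "tags_ok rl \<sigma>" and t: "t < nthr \<sigma>" "status (thr \<sigma> t) = Ready" and eff: "effect t \<sigma> \<sigma>'"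
    and nthr: "nthr \<sigma>' = Suc (nthr \<sigma>)" and pc: "is_alg \<sigma> t \<Longrightarrow> pc (thr \<sigma> t) \<le> pc (thr \<sigma>' t)"
    and rl: "rl \<subseteq>\<^sub>m rl'" "\<And>u. u \<noteq> nthr \<sigma> \<Longrightarrow> rl' u = rl u"
    and fresh: "\<And>x u. rl' (nthr \<sigma>) = Some x \<Longrightarrow> rl u \<noteq> Some x"
    and alg: "is_alg \<sigma>' (nthr \<sigma>) \<longleftrightarrow> (\<exists>\<rho>. rl' (nthr \<sigma>) = Some (AlgT \<rho>))"
    and ev: "eval_of (thr \<sigma>' (nthr \<sigma>)) = Some (nthr \<sigma>) \<longleftrightarrow> (\<exists>\<rho>. rl' (nthr \<sigma>) = Some (CondT \<rho>))"
    and roles: "\<And>\<rho>. rl' (nthr \<sigma>) = Some (AlgT \<rho>) \<Longrightarrow> \<rho> \<in> Roles \<and>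
      (\<forall>\<rho>' p. par \<rho> = Some (\<rho>', p) \<longrightarrow> passed rl' \<sigma>' \<rho>' p)"
    and evals: "\<And>\<rho>. rl' (nthr \<sigma>) = Some (CondT \<rho>) \<Longrightarrow> \<rho> \<in> Evals \<and> proc (thr \<sigma>' (nthr \<sigma>)) = Cond 0 \<and>
        args (thr \<sigma>' (nthr \<sigma>)) = [itm \<rho>] \<and> passed rl' \<sigma>' \<rho> (cpc \<rho>)"
  shows "tags_ok rl' \<sigma>'"
proof -
  have pe: "persists \<sigma> \<sigma>'"
    by (rule effect_persists [OF t eff])
  have pa: "passed rl \<sigma> \<rho> p \<Longrightarrow> passed rl' \<sigma>' \<rho> p" for \<rho> p
    by (rule passed_mono [OF _ tags rl(1) t eff pc])
  have fr: "same_frame (thr \<sigma> u) (thr \<sigma>' u)" if "u < nthr \<sigma>" for u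
    using pe that by (simp add: persists_def)
  note tg = tags_okD [OF tags]
  have ne: "u = nthr \<sigma> \<or> (u < nthr \<sigma> \<and> rl u = Some x)" if "rl' u = Some x" for u x
    using that rl(2) tg(1) by (cases "u = nthr \<sigma>") auto
  show ?thesis
    unfolding tags_ok_def nthr
  proof (intro conjI allI impI)
    show "u < Suc (nthr \<sigma>)" if "rl' u \<noteq> None" for u
      using that ne by fastforce
    show "is_alg \<sigma>' u \<longleftrightarrow> (\<exists>\<rho>. rl' u = Some (AlgT \<rho>))" if "u < Suc (nthr \<sigma>)" for u
      using alg tg(2) [of u] persists_is_alg [OF pe, of u] rl(2) that
      by (cases "u = nthr \<sigma>") auto
    show "eval_of (thr \<sigma>' u) = Some u \<longleftrightarrow> (\<exists>\<rho>. rl' u = Some (CondT \<rho>))" if "u < Suc (nthr \<sigma>)" for u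
      using ev tg(3) [of u] fr [of u] rl(2) that
      by (cases "u = nthr \<sigma>") (auto simp: same_frame_def)
    show "u = u'" if "rl' u = Some y" "rl' u' = Some y" for u u' y
      using ne [OF that(1)] ne [OF that(2)] fresh that tg(4) by metis
    show "rl' 0 = Some (AlgT main)"
      by (rule map_leD [OF rl(1) tg(5)])
    show "\<rho> \<in> Roles" if "rl' u = Some (AlgT \<rho>)" for u \<rho>
      using ne [OF that] roles that tg(6) by blast
    show "passed rl' \<sigma>' \<rho>' p" if "rl' u = Some (AlgT \<rho>)" "par \<rho> = Some (\<rho>', p)" for u \<rho> \<rho>' p
      using ne [OF that(1)] roles that tg(7) pa by blast
    fix u \<rho>
    assume u: "rl' u = Some (CondT \<rho>)"
    show "\<rho> \<in> Evals" "proc (thr \<sigma>' u) = Cond 0" "args (thr \<sigma>' u) = [itm \<rho>]" "passed rl' \<sigma>' \<rho> (cpc \<rho>)"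
      using ne [OF u] evals u tg(8) [of u \<rho>] fr [of u] pa by (auto simp: same_frame_def)
  qed
qed

lemma prog_code: "\<rho> \<in> Roles \<Longrightarrow> P (Alg (prc \<rho>)) = code \<rho>"
  using prc_less by (simp add: link_def)

lemma alg_readyD:
  assumes core: "core lab rl tau \<sigma>" and rlt: "rl t = Some (AlgT \<rho>)" and en: "enabled P t \<sigma>"
  obtains s F E where "good \<rho> s F (pc (thr \<sigma> t)) (drop (pc (thr \<sigma> t)) (code \<rho>)) E"
    "\<And>r. rep lab rl (regs (thr \<sigma> t) r) (E r)" "\<And>f. f \<in> F \<Longrightarrow> holds lab rl \<sigma> f"
    "\<And>i. i \<in> deps (thr \<sigma> t) \<Longrightarrow> is_alg \<sigma> (thread_of \<sigma> i) \<and> tau i < s"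
proof -
  have "status (thr \<sigma> t) = Ready"
    using en by (simp add: enabled_def)
  then have "ready_ok lab rl tau \<sigma> \<rho> (thr \<sigma> t)"
    using coreD(6) [OF core rlt] by (auto simp: alg_ok_def wait_ok_def done_ok_def)
  then show ?thesis
    using that unfolding ready_ok_def by blast
qed

text \<open>Each case matches one equation of \<open>good\<close> with the concrete instruction: the
  symbolic values determine what it yields, and the rest of the code is again
  \<open>good\<close>.\<close>

lemma alg_step:
  assumes core: "core lab rl tau \<sigma>" and wf: "wf_config \<sigma>" and honest: "honest \<sigma>"
    and rlt: "rl t = Some (AlgT \<rho>)" and ex: "exec K P t \<sigma> = Some \<sigma>'"
  shows "\<exists>lab' rl' tau'. core lab' rl' tau' \<sigma>'"
proof -
  have en: "enabled P t \<sigma>"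
    by (rule exec_enabled [OF ex])
  then have st: "status (thr \<sigma> t) = Ready"
    by (simp add: enabled_def)
  note tg = tags_okD [OF coreD(1) [OF core]]
  have t: "t < nthr \<sigma>" and alg: "is_alg \<sigma> t" and \<rho>: "\<rho> \<in> Roles"
    using tg(1,9,6) [OF rlt] .
  have eff: "effect t \<sigma> \<sigma>'"
    by (rule exec_effect [OF ex])
  define th where "th = thr \<sigma> t"
  have prog: "P (proc th) = code \<rho>"
    using coreD(6) [OF core rlt] prog_code [OF \<rho>] by (simp add: alg_ok_def th_def)
  have len: "pc th < length (code \<rho>)"
    using en prog by (simp add: enabled_def th_def)
  obtain s F E where good0: "good \<rho> s F (pc th) (drop (pc th) (code \<rho>)) E"
    and regs: "\<And>r. rep lab rl (regs th r) (E r)" and F: "\<And>f. f \<in> F \<Longrightarrow> holds lab rl \<sigma> f"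
    and deps: "\<And>i. i \<in> deps th \<Longrightarrow> is_alg \<sigma> (thread_of \<sigma> i) \<and> tau i < s"
    using alg_readyD [OF core rlt en] unfolding th_def by metis
  define p where "p = pc th"
  define I where "I = code \<rho> ! p"
  define cs where "cs = drop (Suc p) (code \<rho>)"
  have good: "good \<rho> s F p (I # cs) E"
    using good0 len Cons_nth_drop_Suc unfolding p_def I_def cs_def by metis
  have jump: "drop (l - Suc p) cs = drop l (code \<rho>)" if "p < l" for l
    using that by (simp add: cs_def)
  note ex' = ex [unfolded exec_def Let_def, folded th_def, unfolded prog, folded p_def, folded I_def]
  define th1 where "th1 = th\<lparr>pc := Suc p, deps := {ninstr \<sigma>}\<rparr>"
  have enc: "t < nthr \<sigma> \<and> status th = Ready \<and> p < length (code \<rho>)"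
    using t st len by (simp add: th_def p_def)
  have laba: "lab a = Some L \<Longrightarrow> a < nnodes \<sigma> \<and> N \<le> a \<and> passed rl \<sigma> (fst (cre L)) (snd (cre L))" for a L
    using coreD(2) [OF core] by (auto simp: labs_ok_def)
  \<comment> \<open>The thread still stands at \<open>p\<close>; a child or node already named for
    this position would contradict that.\<close>
  have not_passed: "\<not> passed rl \<sigma> \<rho> p"
    using tg(4) [OF rlt] by (auto simp: passed_def p_def th_def)
  have deps1: "if is_alg \<sigma> (thread_of \<sigma> i) then tau i < s else X < s" if "i \<in> deps th" for i
    using deps [OF that] by simp
  note plain = alg_plain [OF core wf rlt st ex, where th' = th1]
  have th1: "status th1 = Ready" "deps th1 = {ninstr \<sigma>}" "regs th1 = regs th" "pc th1 = Suc p"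
    "same_frame th th1"
    using st by (simp_all add: th1_def th_def same_frame_def)
  have thp: "pc (thr \<sigma> t) = p"
    by (simp add: p_def th_def)
  show ?thesis
  proof (cases I)
    case (Const r k)
    have \<sigma>': "\<sigma>' = set_thr t (set_reg r (IntV k) th1) (add_instr t (deps th) (Suc 0) \<sigma>)"
      using ex' enc unfolding Const th1_def by simp
    have "\<exists>s. core lab rl (tau(ninstr \<sigma> := s)) \<sigma>'"
      by (rule exI, rule alg_plain [OF core wf rlt st ex \<sigma>' _ _ _ deps1, of F "E(r := Raw (IntV k))"])
        (use good [unfolded Const] regs F th1 thp in \<open>auto simp: cs_def\<close>)
    then show ?thesis by blast
  next
    case (SetNull r)
    have \<sigma>': "\<sigma>' = set_thr t (set_reg r Null th1) (add_instr t (deps th) (Suc 0) \<sigma>)"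
      using ex' enc unfolding SetNull th1_def by simp
    have "\<exists>s. core lab rl (tau(ninstr \<sigma> := s)) \<sigma>'"
      by (rule exI, rule alg_plain [OF core wf rlt st ex \<sigma>' _ _ _ deps1, of F "E(r := Raw Null)"])
        (use good [unfolded SetNull] regs F th1 thp in \<open>auto simp: cs_def\<close>)
    then show ?thesis by blast
  next
    case (Move r r')
    have \<sigma>': "\<sigma>' = set_thr t (set_reg r (regs th r') th1) (add_instr t (deps th) (Suc 0) \<sigma>)"
      using ex' enc unfolding Move th1_def by simp
    have "\<exists>s. core lab rl (tau(ninstr \<sigma> := s)) \<sigma>'"
      by (rule exI, rule alg_plain [OF core wf rlt st ex \<sigma>' _ _ _ deps1, of F "E(r := E r')"])
        (use good [unfolded Move] regs F th1 thp in \<open>auto simp: cs_def\<close>)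
    then show ?thesis by blast
  next
    case (Arith f r r1 r2)
    from good [unfolded Arith] obtain x y where xy: "E r1 = Raw (IntV x)" "E r2 = Raw (IntV y)"
      "good \<rho> (Suc s) F (Suc p) cs (E(r := Raw (IntV (arith_op f x y))))"
      by (rule good_ArithD)
    have "regs th r1 = IntV x" "regs th r2 = IntV y"
      using regs [of r1] regs [of r2] xy by simp_all
    then have \<sigma>': "\<sigma>' = set_thr t (set_reg r (IntV (arith_op f x y)) th1) (add_instr t (deps th) (Suc 0) \<sigma>)"
      using ex' enc unfolding Arith th1_def by simp
    have "\<exists>s. core lab rl (tau(ninstr \<sigma> := s)) \<sigma>'"
      by (rule exI, rule alg_plain [OF core wf rlt st ex \<sigma>' _ _ _ deps1, of F "E(r := Raw (IntV (arith_op f x y)))"])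
        (use xy regs F th1 thp in \<open>auto simp: cs_def\<close>)
    then show ?thesis by blast
  next
    case (Jump l)
    have \<sigma>': "\<sigma>' = set_thr t (th1\<lparr>pc := l\<rparr>) (add_instr t (deps th) (Suc 0) \<sigma>)"
      using ex' enc unfolding Jump th1_def by simp
    have "\<exists>s. core lab rl (tau(ninstr \<sigma> := s)) \<sigma>'"
      by (rule exI, rule alg_plain [OF core wf rlt st ex \<sigma>' _ _ _ deps1, of F E])
        (use good [unfolded Jump] regs F th1 thp jump in \<open>auto\<close>)
    then show ?thesis by blast
  next
    case (BranchLess r1 r2 l)
    from good [unfolded BranchLess] obtain x y where xy: "E r1 = Raw (IntV x)" "E r2 = Raw (IntV y)"
      "p < l" "x < y \<Longrightarrow> good \<rho> (Suc s) F l (drop (l - Suc p) cs) E"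
      "\<not> x < y \<Longrightarrow> good \<rho> (Suc s) F (Suc p) cs E"
      by (rule good_BranchLessD) blast
    have "regs th r1 = IntV x" "regs th r2 = IntV y"
      using regs [of r1] regs [of r2] xy by simp_all
    then have \<sigma>': "\<sigma>' = set_thr t (if x < y then th1\<lparr>pc := l\<rparr> else th1) (add_instr t (deps th) (Suc 0) \<sigma>)"
      using ex' enc unfolding BranchLess th1_def by simp
    have "\<exists>s. core lab rl (tau(ninstr \<sigma> := s)) \<sigma>'"
      by (rule exI, rule alg_plain [OF core wf rlt st ex \<sigma>' _ _ _ deps1, of F E])
        (use xy regs F th1 thp jump in \<open>auto simp: cs_def\<close>)
    then show ?thesis by blast
  next
    case (BranchEq r1 r2 l)
    from good [unfolded BranchEq] obtain b where b: "aeq (E r1) (E r2) = Some b"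
      "p < l" "b \<Longrightarrow> good \<rho> (Suc s) F l (drop (l - Suc p) cs) E"
      "\<not> b \<Longrightarrow> good \<rho> (Suc s) F (Suc p) cs E"
      by (rule good_BranchEqD) blast
    have "(regs th r1 = regs th r2) = b"
      by (rule aeq_rep [OF b(1) regs regs])
    then have \<sigma>': "\<sigma>' = set_thr t (if b then th1\<lparr>pc := l\<rparr> else th1) (add_instr t (deps th) (Suc 0) \<sigma>)"
      using ex' enc unfolding BranchEq th1_def by simp
    have "\<exists>s. core lab rl (tau(ninstr \<sigma> := s)) \<sigma>'"
      by (rule exI, rule alg_plain [OF core wf rlt st ex \<sigma>' _ _ _ deps1, of F E])
        (use b regs F th1 thp jump in \<open>auto simp: cs_def\<close>)
    then show ?thesis by blast
  next
    case (Self r)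
    have \<sigma>': "\<sigma>' = set_thr t (set_reg r (ThreadP t) th1) (add_instr t (deps th) (Suc 0) \<sigma>)"
      using ex' enc unfolding Self th1_def by simp
    have "\<exists>s. core lab rl (tau(ninstr \<sigma> := s)) \<sigma>'"
      by (rule exI, rule alg_plain [OF core wf rlt st ex \<sigma>' _ _ _ deps1, of F "E(r := Th \<rho>)"])
        (use good [unfolded Self] regs F th1 thp rlt in \<open>auto simp: cs_def\<close>)
    then show ?thesis by blast
  next
    case (Return r)
    have g: "E r = ret \<rho>" "KD \<rho> \<subseteq> insert (Ended \<rho>) F" "s \<le> fin \<rho>"
      using good unfolding Return by auto
    have \<sigma>': "\<sigma>' = set_thr t (th1\<lparr>status := Done (regs th r)\<rparr>) (add_instr t (deps th) (Suc 0) \<sigma>)"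
      using ex' enc unfolding Return th1_def by simp
    have h: "holds lab rl \<sigma> f \<Longrightarrow> holds lab rl \<sigma>' f" for f
      by (rule holds_effect [OF core t st eff map_le_refl map_le_refl])
    have "holds lab rl \<sigma>' (Ended \<rho>)"
      using rlt by (auto simp: \<sigma>')
    then have "\<forall>f \<in> KD \<rho>. holds lab rl \<sigma>' f"
      using g(2) F h by blast
    moreover have "is_alg \<sigma>' (thread_of \<sigma>' (ninstr \<sigma>))"
      using alg effect_frame(2) [OF t st eff] persists_is_alg [OF effect_persists [OF t st eff] t] by simp
    ultimately have "done_ok lab rl (tau(ninstr \<sigma> := s)) \<sigma>' \<rho> (thr \<sigma>' t)"
      unfolding done_ok_def using regs [of r] g th1 by (simp add: \<sigma>')
    then have "core lab rl (tau(ninstr \<sigma> := s)) \<sigma>'"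
      using deps1 g(3) len thp th1 wf_configD(3) [OF wf]
      by (intro alg_local [OF core wf rlt st eff]) (auto simp: \<sigma>' p_def)
    then show ?thesis by blast
  next
    case (Join r x)
    from good [unfolded Join] show ?thesis
    proof (cases rule: good_JoinD)
      case (alg \<rho>')
      obtain u where u: "regs th x = ThreadP u" "rl u = Some (AlgT \<rho>')"
        using regs [of x] alg(1) by auto
      obtain y where y: "status (thr \<sigma> u) = Done y"
        and \<sigma>': "\<sigma>' = set_thr t (set_reg r y th1) (add_instr t (deps th \<union> deps (thr \<sigma> u)) (Suc 0) \<sigma>)"
        using ex' enc u(1) unfolding Join th1_def by (auto split: status.splits if_splits)
      have "done_ok lab rl tau \<sigma> \<rho>' (thr \<sigma> u)"
        using coreD(6) [OF core u(2)] y by (auto simp: alg_ok_def ready_ok_def wait_ok_def)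
      then have d: "rep lab rl y (ret \<rho>')" "\<And>f. f \<in> KD \<rho>' \<Longrightarrow> holds lab rl \<sigma> f"
        "\<And>i. i \<in> deps (thr \<sigma> u) \<Longrightarrow> is_alg \<sigma> (thread_of \<sigma> i) \<and> tau i \<le> fin \<rho>'"
        using y by (auto simp: done_ok_def)
      \<comment> \<open>The join depends on both threads, so its stamp must exceed those in its own
        past and that of the last instruction of the joined role, which is at most
        \<open>fin\<close>.\<close>
      have dd: "if is_alg \<sigma> (thread_of \<sigma> i) then tau i < max s (Suc (fin \<rho>')) else X < max s (Suc (fin \<rho>'))"
        if "i \<in> deps th \<union> deps (thr \<sigma> u)" for i
        using that deps [of i] d(3) [of i] by (auto simp: less_max_iff_disj less_Suc_eq_le)
      have he: "holds lab rl \<sigma> (Ended \<rho>')"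
        using u y by auto
      have "\<exists>s. core lab rl (tau(ninstr \<sigma> := s)) \<sigma>'"
        by (rule exI, rule alg_plain [OF core wf rlt st ex \<sigma>' _ _ _ dd, of "insert (Ended \<rho>') (KD \<rho>' \<union> F)" "E(r := ret \<rho>')"])
          (use alg(2) regs F th1 thp d he in \<open>auto simp: cs_def simp del: holds.simps\<close>)
      then show ?thesis by blast
    next
      case (cond \<rho>')
      obtain u where u: "regs th x = ThreadP u" "rl u = Some (CondT \<rho>')"
        using regs [of x] cond(1) by auto
      obtain y where y: "status (thr \<sigma> u) = Done y" "u < nthr \<sigma>"
        and \<sigma>': "\<sigma>' = set_thr t (set_reg r y th1) (add_instr t (deps th \<union> deps (thr \<sigma> u)) (Suc 0) \<sigma>)"
        using ex' enc u(1) unfolding Join th1_def by (auto split: status.splits if_splits)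
      have ev: "eval_of (thr \<sigma> u) = Some u" "\<rho>' \<in> Evals" "proc (thr \<sigma> u) = Cond 0" "args (thr \<sigma> u) = [itm \<rho>']"
        using tg(3) [OF y(2)] tg(8) [OF u(2)] u(2) by auto
      \<comment> \<open>Here the hypothesis on the results of the condition enters.\<close>
      then have "y = IntV (if \<phi> (itm \<rho>') then 1 else 0)"
        using honest itm [OF ev(2)] y unfolding honest_def evaluation_def by blast
      note y_val = this
      have "cond_ok lab tau \<sigma> (thr \<sigma> u)"
        using coreD(7) [OF core y(2)] tg(10) [OF u(2)] by blast
      then have d: "is_alg \<sigma> (thread_of \<sigma> i) \<Longrightarrow> tau i \<le> X" if "i \<in> deps (thr \<sigma> u)" for i
        using that by (auto simp: cond_ok_def)
      have dd: "if is_alg \<sigma> (thread_of \<sigma> i) then tau i < max s (Suc X) else X < max s (Suc X)"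
        if "i \<in> deps th \<union> deps (thr \<sigma> u)" for i
        using that deps [of i] d [of i] by (auto simp: less_max_iff_disj less_Suc_eq_le)
      have "\<exists>s. core lab rl (tau(ninstr \<sigma> := s)) \<sigma>'"
        by (rule exI, rule alg_plain [OF core wf rlt st ex \<sigma>' _ _ _ dd, of F "E(r := Raw (IntV (if \<phi> (itm \<rho>') then 1 else 0)))"])
          (use cond(2) regs F th1 thp y_val in \<open>auto simp: cs_def\<close>)
      then show ?thesis by blast
    qed
  next
    case (RMW r q c f)
    obtain a where a: "regs th q = NodeP a" "a < nnodes \<sigma>" "c < K"
      and \<sigma>': "\<sigma>' = set_thr t (th1\<lparr>status := Waiting a c (map_rmw (regs th) f) r\<rparr>)
         ((add_instr t (deps th) 0 \<sigma>)\<lparr>queue := (queue \<sigma>)(a := (queue \<sigma> a)(c := queue \<sigma> a c @ [t]))\<rparr>)"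
      using ex' enc unfolding RMW th1_def by (auto split: val.splits if_splits)
    have h: "holds lab rl \<sigma> f \<Longrightarrow> holds lab rl \<sigma>' f" for f
      by (rule holds_effect [OF core t st eff map_le_refl map_le_refl])
    have algi: "is_alg \<sigma>' (thread_of \<sigma>' (ninstr \<sigma>))"
      using alg effect_frame(2) [OF t st eff] persists_is_alg [OF effect_persists [OF t st eff] t] by simp
    have wait: "\<exists>lab' rl' tau'. core lab' rl' tau' \<sigma>'"
      if g: "good \<rho> (Suc s) F' (Suc p) cs (E(r := av))"
        and req: "request_ok lab rl \<sigma>' \<rho> a c (map_rmw (regs th) f) av F'" for F' av
    proof -
      have "wait_ok lab rl (tau(ninstr \<sigma> := s)) \<sigma>' \<rho> (thr \<sigma>' t)"
        unfolding wait_ok_def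
      proof (intro exI conjI)
        show "status (thr \<sigma>' t) = Waiting a c (map_rmw (regs th) f) r"
          by (simp add: \<sigma>')
        show "good \<rho> (Suc s) F' (pc (thr \<sigma>' t)) (drop (pc (thr \<sigma>' t)) (code \<rho>)) (E(r := av))"
          using g by (simp add: \<sigma>' th1 cs_def)
        show "\<forall>r. rep lab rl (regs (thr \<sigma>' t) r) (E r)"
          using regs by (simp add: \<sigma>' th1)
        show "\<forall>i\<in>deps (thr \<sigma>' t). is_alg \<sigma>' (thread_of \<sigma>' i) \<and> (tau(ninstr \<sigma> := s)) i < Suc s \<and> weight \<sigma>' i = 0"
          using algi by (simp add: \<sigma>' th1)
      qed (rule req)
      then have "core lab rl (tau(ninstr \<sigma> := s)) \<sigma>'"
        using deps1 good_le_fin [OF g] len thp th1 wf_configD(3) [OF wf]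
        by (intro alg_local [OF core wf rlt st eff]) (auto simp: \<sigma>' p_def)
      then show ?thesis by blast
    qed
    have may: "may lab rl \<sigma>' \<rho> L c" if "access \<rho> F L c" for L
      using that F h unfolding access_def may_def by blast
    from good [unfolded RMW] show ?thesis
    proof (cases rule: good_RMWD)
      case (load L)
      have l: "lab a = Some L"
        using regs [of q] load(3) a(1) by auto
      show ?thesis
        by (rule wait [OF load(6)])
          (use l load may F h in \<open>auto simp: request_ok_def simp del: holds.simps\<close>)
    next
      case (old a')
      have l: "a = a'"
        using regs [of q] old(3) a(1) by auto
      show ?thesis
        by (rule wait [OF old(6)])
          (use l old a F h in \<open>auto simp: request_ok_def simp del: holds.simps\<close>)
    next
      case (store L r')
      have l: "lab a = Some L"
        using regs [of q] store(3) a(1) by auto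
      have rr: "rep lab rl (regs th r') (MV L c)"
        using regs [of r'] store(4) by simp
      show ?thesis
        by (rule wait [OF store(6)])
          (use l store may F h rr in \<open>auto simp: request_ok_def simp del: holds.simps\<close>)
    qed
  next
    case (New r)
    define L where "L = nlab \<rho> p"
    have g: "cre L = (\<rho>, p)"
      "good \<rho> (Suc s) (F \<union> Filled L ` {c. MV L c = Raw Null}) (Suc p) cs (E(r := Nd L))"
      using good unfolding New L_def by auto
    have \<sigma>': "\<sigma>' = set_thr t (set_reg r (NodeP (nnodes \<sigma>)) th1)
        ((add_instr t (deps th) (Suc 0) \<sigma>)\<lparr>nnodes := Suc (nnodes \<sigma>), mem := (mem \<sigma>)(nnodes \<sigma> := (\<lambda>_. Null))\<rparr>)"
      using ex' enc unfolding New th1_def by simp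
    have fresh: "lab a \<noteq> Some L" for a
      using laba [of a L] not_passed g(1) by auto
    have none: "lab (nnodes \<sigma>) = None"
      using laba [of "nnodes \<sigma>"] by (cases "lab (nnodes \<sigma>)") auto
    let ?lab = "lab(nnodes \<sigma> \<mapsto> L)"
    have le: "lab \<subseteq>\<^sub>m ?lab"
      using none by (auto simp: map_le_def)
    have tags': "tags_ok rl \<sigma>'"
      by (rule tags_same [OF coreD(1) [OF core] t st eff]) (use th1 thp in \<open>auto simp: \<sigma>'\<close>)
    have pa: "passed rl \<sigma>' \<rho> p"
      using rlt th1 by (auto simp: passed_def \<sigma>')
    have "labs_ok lab rl \<sigma>'"
      by (rule labs_same [OF coreD(2) [OF core] coreD(1) [OF core] map_le_refl t st eff])
        (use th1 thp in \<open>auto simp: \<sigma>'\<close>)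
    moreover have "N \<le> nnodes \<sigma>"
      using coreD(3) [OF core] by (simp add: mem_ok_def)
    ultimately have labs': "labs_ok ?lab rl \<sigma>'"
      using pa g(1) fresh by (auto simp: labs_ok_def \<sigma>')
    have null: "holds ?lab rl \<sigma>' (Filled L c)" if "MV L c = Raw Null" for c
      using that by (auto simp: \<sigma>' intro!: exI [of _ "nnodes \<sigma>"])
    have ok: "ready_ok ?lab rl (tau(ninstr \<sigma> := s)) \<sigma>' \<rho> (thr \<sigma>' t)"
    proof (rule alg_ready [OF core t st eff alg le map_le_refl])
      show "status (thr \<sigma>' t) = Ready" "deps (thr \<sigma>' t) = {ninstr \<sigma>}"
        using th1 by (simp_all add: \<sigma>')
      show "good \<rho> (Suc s) (F \<union> Filled L ` {c. MV L c = Raw Null}) (pc (thr \<sigma>' t))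
          (drop (pc (thr \<sigma>' t)) (code \<rho>)) (E(r := Nd L))"
        using g(2) th1 by (simp add: \<sigma>' cs_def)
      show "rep ?lab rl (regs (thr \<sigma>' t) r') ((E(r := Nd L)) r')" for r'
        using rep_mono [OF regs le map_le_refl, of r'] th1 by (simp add: \<sigma>')
      show "holds lab rl \<sigma> f \<or> holds ?lab rl \<sigma>' f" if "f \<in> F \<union> Filled L ` {c. MV L c = Raw Null}" for f
        using that F null by (auto simp del: holds.simps)
    qed
    have "core ?lab rl (tau(ninstr \<sigma> := s)) \<sigma>'"
    proof (rule alg_exec [OF core wf rlt st eff le _ map_le_refl tags' labs'])
      show "(\<exists>u<nthr \<sigma>. \<not> is_alg \<sigma> u) \<or> (\<forall>\<rho> a. old \<rho> a \<longrightarrow> holds lab rl \<sigma> (Ended \<rho>))"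
        if "u < nthr \<sigma>'" "\<not> is_alg \<sigma>' u" for u
        using that persists_is_alg [OF effect_persists [OF t st eff], of u] by (auto simp: \<sigma>')
    qed (use ok deps1 good_le_fin [OF g(2)] len thp th1 wf_configD(3) [OF wf] in \<open>auto simp: \<sigma>' p_def\<close>)
    then show ?thesis by blast
  next
    case (Fork r q rs)
    define u where "u = nthr \<sigma>"
    have ev0: "eval_of th = None"
      using alg by (simp add: is_alg_def th_def)
    have rlu: "rl u = None"
      using tg(1) [of u] by (cases "rl u") (auto simp: u_def)
    have tu: "t \<noteq> u"
      using t by (simp add: u_def)
    have pe: "persists \<sigma> \<sigma>'"
      by (rule effect_persists [OF t st eff])
    have algi: "is_alg \<sigma>' (thread_of \<sigma>' (ninstr \<sigma>))"
      using alg effect_frame(2) [OF t st eff] persists_is_alg [OF pe t] by simp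
    have labs': "labs_ok lab rl' \<sigma>'" if "rl \<subseteq>\<^sub>m rl'" "pc (thr \<sigma>' t) = Suc p" for rl'
      by (rule labs_same [OF coreD(2) [OF core] coreD(1) [OF core] that(1) t st eff])
        (use that(2) thp in simp)
    show ?thesis
    proof (cases q)
      case (Alg j)
      define \<rho>' where "\<rho>' = chd \<rho> p"
      have g: "\<rho>' \<in> Roles" "par \<rho>' = Some (\<rho>, p)" "prc \<rho>' = j" "map E rs = ain \<rho>'" "s < start \<rho>'"
        "K0 \<rho>' \<subseteq> F" "good \<rho> (Suc s) F (Suc p) cs (E(r := Th \<rho>'))"
        using good unfolding Fork Alg \<rho>'_def by auto
      have \<sigma>': "\<sigma>' = set_thr u (new_thread (Alg j) (map (regs th) rs) {ninstr \<sigma>} None)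
          (set_thr t (set_reg r (ThreadP u) th1) ((add_instr t (deps th) (Suc 0) \<sigma>)\<lparr>nthr := Suc u\<rparr>))"
        using ex' enc ev0 unfolding Fork Alg th1_def u_def by simp
      let ?rl = "rl(u \<mapsto> AlgT \<rho>')"
      have le: "rl \<subseteq>\<^sub>m ?rl"
        using rlu by (auto simp: map_le_def)
      have pa: "passed ?rl \<sigma>' \<rho> p"
        using rlt th1 tu by (auto simp: passed_def \<sigma>')
      have tags': "tags_ok ?rl \<sigma>'"
      proof (rule tags_fork [OF coreD(1) [OF core] t st eff])
        show "rl v \<noteq> Some x" if "?rl (nthr \<sigma>) = Some x" for x v
          using that tg(7) [of v \<rho>' \<rho> p] g(2) not_passed by (auto simp: u_def)
      qed (use th1 thp le g(1,2) tu pa in \<open>auto simp: \<sigma>' u_def is_alg_def\<close>)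
      have ok: "ready_ok lab ?rl (tau(ninstr \<sigma> := s)) \<sigma>' \<rho> (thr \<sigma>' t)"
      proof (rule alg_ready [OF core t st eff alg map_le_refl le])
        show "good \<rho> (Suc s) F (pc (thr \<sigma>' t)) (drop (pc (thr \<sigma>' t)) (code \<rho>)) (E(r := Th \<rho>'))"
          using g(7) th1 tu by (simp add: \<sigma>' cs_def)
        show "rep lab ?rl (regs (thr \<sigma>' t) r') ((E(r := Th \<rho>')) r')" for r'
          using rep_mono [OF regs map_le_refl le, of r'] th1 tu by (simp add: \<sigma>')
      qed (use th1 F tu in \<open>auto simp: \<sigma>'\<close>)
      have child: "alg_ok lab ?rl (tau(ninstr \<sigma> := s)) \<sigma>' \<rho>' u"
      proof -
        have "ready_ok lab ?rl (tau(ninstr \<sigma> := s)) \<sigma>' \<rho>' (thr \<sigma>' u)"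
          unfolding ready_ok_def
        proof (intro conjI exI)
          show "good \<rho>' (start \<rho>') (K0 \<rho>') (pc (thr \<sigma>' u)) (drop (pc (thr \<sigma>' u)) (code \<rho>')) (init_env \<rho>')"
            using good_role [OF g(1)] by (simp add: \<sigma>')
          show "\<forall>r. rep lab ?rl (regs (thr \<sigma>' u) r) (init_env \<rho>' r)"
          proof
            fix r'
            have "length (ain \<rho>') = length rs"
              using g(4) by (metis length_map)
            moreover have "ain \<rho>' ! r' = E (rs ! r')" if "r' < length rs"
              using g(4) that by (metis nth_map)
            ultimately show "rep lab ?rl (regs (thr \<sigma>' u) r') (init_env \<rho>' r')"
              using rep_mono [OF regs map_le_refl le, of "rs ! r'"] by (auto simp: \<sigma>' init_env_def)
          qed
          show "\<forall>f\<in>K0 \<rho>'. holds lab ?rl \<sigma>' f"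
            using g(6) F holds_effect [OF core t st eff map_le_refl le] by blast
          show "\<forall>i\<in>deps (thr \<sigma>' u). is_alg \<sigma>' (thread_of \<sigma>' i) \<and> (tau(ninstr \<sigma> := s)) i < start \<rho>'"
            using algi g(5) by (simp add: \<sigma>')
        qed (simp add: \<sigma>')
        moreover have "{i. i < ninstr \<sigma>' \<and> thread_of \<sigma>' i = u} = {}"
          using tu by (auto simp: \<sigma>' u_def less_Suc_eq dest: wf_configD(2) [OF wf])
        ultimately show ?thesis
          using g(3) by (simp add: alg_ok_def \<sigma>')
      qed
      have "core lab ?rl (tau(ninstr \<sigma> := s)) \<sigma>'"
      proof (rule alg_exec [OF core wf rlt st eff map_le_refl refl le tags' labs' [OF le]])
        show "(\<exists>v<nthr \<sigma>. \<not> is_alg \<sigma> v) \<or> (\<forall>\<rho> a. old \<rho> a \<longrightarrow> holds lab rl \<sigma> (Ended \<rho>))"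
          if "v < nthr \<sigma>'" "\<not> is_alg \<sigma>' v" for v
          using that persists_is_alg [OF pe, of v] by (auto simp: \<sigma>' u_def is_alg_def less_Suc_eq)
        show "alg_ok lab ?rl (tau(ninstr \<sigma> := s)) \<sigma>' \<rho>'' v" if "?rl v = Some (AlgT \<rho>'')" "rl v = None" for v \<rho>''
          using child that by (auto split: if_splits)
        show "cond_ok lab (tau(ninstr \<sigma> := s)) \<sigma>' (thr \<sigma>' v)"
          if "nthr \<sigma> \<le> v" "v < nthr \<sigma>'" "\<not> is_alg \<sigma>' v" for v
          using that by (auto simp: \<sigma>' u_def is_alg_def less_Suc_eq)
      qed (use ok deps1 good_le_fin [OF g(7)] len thp th1 tu wf_configD(3) [OF wf] in \<open>auto simp: \<sigma>' p_def u_def\<close>)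
      then show ?thesis by blast
    next
      case (Cond j)
      have g: "j = 0" "map E rs = [Raw (itm \<rho>)]" "\<rho> \<in> Evals" "cpc \<rho> = p" "s \<le> X"
        "\<And>\<rho>' a. old \<rho>' a \<Longrightarrow> Ended \<rho>' \<in> F" "good \<rho> (Suc s) F (Suc p) cs (E(r := Cnd \<rho>))"
        using good unfolding Fork Cond by auto
      obtain x where x: "rs = [x]" "E x = Raw (itm \<rho>)"
        using g(2) by auto
      have ax: "regs th x = itm \<rho>"
        using regs [of x] x(2) by simp
      have \<sigma>': "\<sigma>' = set_thr u (new_thread (Cond 0) [itm \<rho>] {ninstr \<sigma>} (Some u))
          (set_thr t (set_reg r (ThreadP u) th1) ((add_instr t (deps th) (Suc 0) \<sigma>)\<lparr>nthr := Suc u\<rparr>))"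
        using ex' enc ev0 unfolding Fork Cond th1_def u_def by (simp add: x ax g(1))
      let ?rl = "rl(u \<mapsto> CondT \<rho>)"
      have le: "rl \<subseteq>\<^sub>m ?rl"
        using rlu by (auto simp: map_le_def)
      have pa: "passed ?rl \<sigma>' \<rho> p"
        using rlt th1 tu by (auto simp: passed_def \<sigma>')
      have tags': "tags_ok ?rl \<sigma>'"
      proof (rule tags_fork [OF coreD(1) [OF core] t st eff])
        show "rl v \<noteq> Some y" if "?rl (nthr \<sigma>) = Some y" for y v
          using that tg(8) [of v \<rho>] g(4) not_passed by (auto simp: u_def)
      qed (use th1 thp le g(3,4) tu pa in \<open>auto simp: \<sigma>' u_def is_alg_def\<close>)
      have ok: "ready_ok lab ?rl (tau(ninstr \<sigma> := s)) \<sigma>' \<rho> (thr \<sigma>' t)"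
      proof (rule alg_ready [OF core t st eff alg map_le_refl le])
        show "good \<rho> (Suc s) F (pc (thr \<sigma>' t)) (drop (pc (thr \<sigma>' t)) (code \<rho>)) (E(r := Cnd \<rho>))"
          using g(7) th1 tu by (simp add: \<sigma>' cs_def)
        show "rep lab ?rl (regs (thr \<sigma>' t) r') ((E(r := Cnd \<rho>)) r')" for r'
          using rep_mono [OF regs map_le_refl le, of r'] th1 tu by (simp add: \<sigma>')
      qed (use th1 F tu in \<open>auto simp: \<sigma>'\<close>)
      have "N \<le> nnodes \<sigma>"
        using coreD(3) [OF core] by (simp add: mem_ok_def)
      \<comment> \<open>An item that is a pointer points into the input, below \<open>N\<close>,
        whereas named nodes lie at \<open>N\<close> or above; the evaluation starts without access
        to the algorithm's data.\<close>
      then have low: "low lab \<sigma>' (itm \<rho>)"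
        using itm_safe [OF g(3)] laba
        by (cases "itm \<rho>") (auto simp: low_def \<sigma>' option.case_eq_if, metis not_le option.exhaust)
      have child: "cond_ok lab (tau(ninstr \<sigma> := s)) \<sigma>' (thr \<sigma>' u)"
        using g(5) low by (auto simp: cond_ok_def \<sigma>') (auto simp: low_def)
      have "core lab ?rl (tau(ninstr \<sigma> := s)) \<sigma>'"
      proof (rule alg_exec [OF core wf rlt st eff map_le_refl refl le tags' labs' [OF le]])
        show "(\<exists>v<nthr \<sigma>. \<not> is_alg \<sigma> v) \<or> (\<forall>\<rho> a. old \<rho> a \<longrightarrow> holds lab rl \<sigma> (Ended \<rho>))" for v
          using g(6) F by blast
        show "cond_ok lab (tau(ninstr \<sigma> := s)) \<sigma>' (thr \<sigma>' v)"
          if "nthr \<sigma> \<le> v" "v < nthr \<sigma>'" "\<not> is_alg \<sigma>' v" for v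
          using that child by (auto simp: \<sigma>' u_def less_Suc_eq)
      qed (use rlu ok deps1 good_le_fin [OF g(7)] len thp th1 tu wf_configD(3) [OF wf] in
          \<open>auto simp: \<sigma>' p_def u_def split: if_splits\<close>)
      then show ?thesis by blast
    qed
  qed (use good in auto)
qed

section \<open>Steps of evaluation threads\<close>

lemma cond_exec:
  assumes core: "core lab rl tau \<sigma>" and wf: "wf_config \<sigma>"
    and t: "t < nthr \<sigma>" "\<not> is_alg \<sigma> t" and st: "status (thr \<sigma> t) = Ready" and eff: "effect t \<sigma> \<sigma>'"
    and tags: "tags_ok rl \<sigma>'"
    and D: "\<And>i. (i, ninstr \<sigma>) \<in> edges \<sigma>' \<Longrightarrow> i < ninstr \<sigma> \<Longrightarrow>
      \<exists>u < nthr \<sigma>. \<not> is_alg \<sigma> u \<and> i \<in> deps (thr \<sigma> u)"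
    and mem: "\<And>a c. nnodes \<sigma> \<le> a \<Longrightarrow> a < nnodes \<sigma>' \<Longrightarrow> low lab \<sigma>' (mem \<sigma>' a c)"
    and conds: "\<And>u. u < nthr \<sigma>' \<Longrightarrow> \<not> is_alg \<sigma>' u \<Longrightarrow> u = t \<or> nthr \<sigma> \<le> u \<or> thr \<sigma>' u \<noteq> thr \<sigma> u \<Longrightarrow>
      (\<exists>j. proc (thr \<sigma>' u) = Cond j) \<and> (\<forall>r. low lab \<sigma>' (regs (thr \<sigma>' u) r)) \<and>
      deps (thr \<sigma>' u) \<subseteq> insert (ninstr \<sigma>) (if u < nthr \<sigma> then deps (thr \<sigma> u) else {}) \<and>
      (\<forall>a c f r. status (thr \<sigma>' u) = Waiting a c f r \<longrightarrow>
        a < nnodes \<sigma> \<and> c < K \<and> lab a = None \<and> (\<forall>x \<in> set_rmw f. low lab \<sigma> x)) \<and>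
      (\<forall>x. status (thr \<sigma>' u) = Done x \<longrightarrow> low lab \<sigma> x)"
  shows "core lab rl (tau(ninstr \<sigma> := 0)) \<sigma>'"
proof -
  note tg = tags_okD [OF coreD(1) [OF core]]
  note fr = effect_frame [OF t(1) st eff]
  have pe: "persists \<sigma> \<sigma>'"
    by (rule effect_persists [OF t(1) st eff])
  have alg: "is_alg \<sigma>' u = is_alg \<sigma> u" if "u < nthr \<sigma>" for u
    by (rule persists_is_alg [OF pe that])
  have low: "low lab \<sigma>' x" if "low lab \<sigma> x" for x
    by (rule low_mono [OF that fr(5) pe refl])
  have noalg: "rl t \<noteq> Some (AlgT \<rho>)" for \<rho>
    using tg(9) t(2) by blast
  have tauX: "tau i \<le> X" if "u < nthr \<sigma>" "\<not> is_alg \<sigma> u" "i \<in> deps (thr \<sigma> u)" "is_alg \<sigma> (thread_of \<sigma> i)" for u i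
    using coreD(7) [OF core that(1,2)] that by (auto simp: cond_ok_def)
  show ?thesis
  \<comment> \<open>The new instruction gets the dummy stamp 0: \<open>dag_ok\<close> constrains the
    stamps of algorithm instructions only.\<close>
  proof (rule core_exec [OF core wf t(1) st eff map_le_refl refl map_le_refl tags])
    show "labs_ok lab rl \<sigma>'"
      by (rule labs_same [OF coreD(2) [OF core] coreD(1) [OF core] map_le_refl t(1) st eff]) (use t in simp)
    show "(is_alg \<sigma> t \<longrightarrow> (if is_alg \<sigma> (thread_of \<sigma> i) then tau i < 0 else X < 0)) \<and>
        (\<not> is_alg \<sigma> t \<longrightarrow> is_alg \<sigma> (thread_of \<sigma> i) \<longrightarrow> tau i \<le> X)"
      if "(i, ninstr \<sigma>) \<in> edges \<sigma>'" "i < ninstr \<sigma>" for i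
      using D [OF that] tauX t by blast
    show "low lab \<sigma>' (mem \<sigma>' a c)" if "nnodes \<sigma> \<le> a" "a < nnodes \<sigma>'" for a c
      using mem that .
    show "(\<exists>u<nthr \<sigma>. \<not> is_alg \<sigma> u) \<or> (\<forall>\<rho> a. old \<rho> a \<longrightarrow> holds lab rl \<sigma> (Ended \<rho>))" for u
      using t by blast
    show "alg_ok lab rl (tau(ninstr \<sigma> := 0)) \<sigma>' \<rho> u" if "rl u = Some (AlgT \<rho>)" "u = t \<or> rl u = None" for u \<rho>
      using that noalg by auto
    fix u
    assume u: "u < nthr \<sigma>'" "\<not> is_alg \<sigma>' u" "u = t \<or> nthr \<sigma> \<le> u \<or> thr \<sigma>' u \<noteq> thr \<sigma> u"
    note c = conds [OF u]
    have "(tau(ninstr \<sigma> := 0)) i \<le> X" if "i \<in> deps (thr \<sigma>' u)" "is_alg \<sigma>' (thread_of \<sigma>' i)" for i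
    proof (cases "i = ninstr \<sigma>")
      case False
      then have *: "u < nthr \<sigma>" "i \<in> deps (thr \<sigma> u)"
        using c that(1) by (auto split: if_splits)
      then have "i < ninstr \<sigma>"
        using wf_configD(1) [OF wf] by blast
      then have "is_alg \<sigma> (thread_of \<sigma> i)"
        using that(2) fr(2) wf_configD(2) [OF wf, of i] alg by simp
      then show ?thesis
        using tauX [OF *(1) _ *(2)] u(2) alg [OF *(1)] False by simp
    qed simp
    then show "cond_ok lab (tau(ninstr \<sigma> := 0)) \<sigma>' (thr \<sigma>' u)"
      unfolding cond_ok_def using c low fr(5) by (meson less_le_trans)
  qed (use t in simp)
qed

text \<open>An RMW only passes on the old contents, its operands and integers, so it cannot forge
  access to the algorithm's data.\<close>

lemma low_rmw:
  assumes "low lab \<sigma> x" "\<forall>y \<in> set_rmw f. low lab \<sigma> y"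
  shows "low lab \<sigma> (fst (rmw_op f x))" "low lab \<sigma> (snd (rmw_op f x))"
  using assms by (cases f; auto simp: low_def split: val.splits)+

text \<open>Little is known of the code, so the argument is by reachability: pointers cannot be
  computed, hence every node accessed and every thread joined or resumed is one that evaluations may
  reach anyway. No name is given or changed.\<close>

lemma cond_step:
  assumes core: "core lab rl tau \<sigma>" and wf: "wf_config \<sigma>"
    and t: "t < nthr \<sigma>" "\<not> is_alg \<sigma> t" and ex: "exec K P t \<sigma> = Some \<sigma>'"
  shows "\<exists>lab' rl' tau'. core lab' rl' tau' \<sigma>'"
proof -
  have en: "enabled P t \<sigma>"
    by (rule exec_enabled [OF ex])
  then have st: "status (thr \<sigma> t) = Ready"
    by (simp add: enabled_def)
  note tg = tags_okD [OF coreD(1) [OF core]]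
  have eff: "effect t \<sigma> \<sigma>'"
    by (rule exec_effect [OF ex])
  note fr = effect_frame [OF t(1) st eff]
  have pe: "persists \<sigma> \<sigma>'"
    by (rule effect_persists [OF t(1) st eff])
  have alg: "is_alg \<sigma>' u = is_alg \<sigma> u" if "u < nthr \<sigma>" for u
    by (rule persists_is_alg [OF pe that])
  have low: "low lab \<sigma>' x" if "low lab \<sigma> x" for x
    by (rule low_mono [OF that fr(5) pe refl])
  have laba: "lab a = Some L \<Longrightarrow> a < nnodes \<sigma>" for a L
    using coreD(2) [OF core] by (auto simp: labs_ok_def)
  have nedge: "(i, ninstr \<sigma>) \<notin> edges \<sigma>" for i
    using wf_configD(3) [OF wf, of i "ninstr \<sigma>"] by auto
  define th where "th = thr \<sigma> t"
  define R where "R = regs th"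
  define th1 where "th1 = th\<lparr>pc := Suc (pc th), deps := {ninstr \<sigma>}\<rparr>"
  define p where "p = pc th"
  define I where "I = P (proc th) ! pc th"
  have c: "cond_ok lab tau \<sigma> th"
    using coreD(7) [OF core t] by (simp add: th_def)
  have lowR: "low lab \<sigma> (R r)" for r
    using c by (simp add: cond_ok_def R_def)
  obtain j where j: "proc th = Cond j"
    using c by (auto simp: cond_ok_def)
  have enc: "t < nthr \<sigma> \<and> status th = Ready \<and> pc th < length (P (proc th))"
    using en by (simp add: enabled_def th_def)
  note ex' = ex [unfolded exec_def Let_def, folded th_def, folded I_def, folded R_def]
  have th1: "status th1 = Ready" "deps th1 = {ninstr \<sigma>}" "regs th1 = R" "proc th1 = Cond j"
    using st j by (simp_all add: th1_def th_def R_def)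
  have tags: "nthr \<sigma>' = nthr \<sigma> \<Longrightarrow> tags_ok rl \<sigma>'"
    by (rule tags_same [OF coreD(1) [OF core] t(1) st eff]) (use t in simp_all)
  have int: "low lab \<sigma> (IntV k)" "low lab \<sigma> Null" for k
    by (simp_all add: low_def)
  have self: "low lab \<sigma> (ThreadP t)"
    using t by (simp add: low_def)
  have local: "\<exists>lab' rl' tau'. core lab' rl' tau' \<sigma>'"
    if \<sigma>': "\<sigma>' = set_thr t th' (add_instr t D (Suc 0) \<sigma>)"
      and D: "D = deps th \<or> (\<exists>u < nthr \<sigma>. \<not> is_alg \<sigma> u \<and> D = deps th \<union> deps (thr \<sigma> u))"
      and th': "proc th' = proc th1" "deps th' = deps th1" "\<And>r. low lab \<sigma> (regs th' r)" "\<not> waiting th'"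
        "\<And>x. status th' = Done x \<Longrightarrow> low lab \<sigma> x" for th' D
  proof -
    have "\<exists>u<nthr \<sigma>. \<not> is_alg \<sigma> u \<and> i \<in> deps (thr \<sigma> u)" if "i \<in> D" for i
      using D that t by (auto simp: th_def)
    then have "core lab rl (tau(ninstr \<sigma> := 0)) \<sigma>'"
      using th' th1 low t nedge
      by (intro cond_exec [OF core wf t st eff tags]) (auto simp: \<sigma>' waiting_def split: if_splits)
    then show ?thesis by blast
  qed
  show ?thesis
  proof (cases I)
    case (Const r k)
    have "\<sigma>' = set_thr t (set_reg r (IntV k) th1) (add_instr t (deps th) (Suc 0) \<sigma>)"
      using ex' enc unfolding Const th1_def by simp
    then show ?thesis
      by (rule local) (use th1 lowR int in \<open>auto simp: waiting_def split: if_splits\<close>)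
  next
    case (SetNull r)
    have "\<sigma>' = set_thr t (set_reg r Null th1) (add_instr t (deps th) (Suc 0) \<sigma>)"
      using ex' enc unfolding SetNull th1_def by simp
    then show ?thesis
      by (rule local) (use th1 lowR int in \<open>auto simp: waiting_def split: if_splits\<close>)
  next
    case (Move r r')
    have "\<sigma>' = set_thr t (set_reg r (R r') th1) (add_instr t (deps th) (Suc 0) \<sigma>)"
      using ex' enc unfolding Move th1_def by simp
    then show ?thesis
      by (rule local) (use th1 lowR int in \<open>auto simp: waiting_def split: if_splits\<close>)
  next
    case (Arith f r r1 r2)
    obtain x y where "\<sigma>' = set_thr t (set_reg r (IntV (arith_op f x y)) th1) (add_instr t (deps th) (Suc 0) \<sigma>)"
      using ex' enc unfolding Arith th1_def by (auto split: val.splits)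
    then show ?thesis
      by (rule local) (use th1 lowR int in \<open>auto simp: waiting_def split: if_splits\<close>)
  next
    case (Jump l)
    have "\<sigma>' = set_thr t (th1\<lparr>pc := l\<rparr>) (add_instr t (deps th) (Suc 0) \<sigma>)"
      using ex' enc unfolding Jump th1_def by simp
    then show ?thesis
      by (rule local) (use th1 lowR int in \<open>auto simp: waiting_def split: if_splits\<close>)
  next
    case (BranchLess r1 r2 l)
    obtain b where "\<sigma>' = set_thr t (if b then th1\<lparr>pc := l\<rparr> else th1) (add_instr t (deps th) (Suc 0) \<sigma>)"
      using ex' enc unfolding BranchLess th1_def by (auto split: val.splits)
    then show ?thesis
      by (rule local) (use th1 lowR int in \<open>auto simp: waiting_def split: if_splits\<close>)
  next
    case (BranchEq r1 r2 l)
    have "\<sigma>' = set_thr t (if R r1 = R r2 then th1\<lparr>pc := l\<rparr> else th1) (add_instr t (deps th) (Suc 0) \<sigma>)"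
      using ex' enc unfolding BranchEq th1_def by simp
    then show ?thesis
      by (rule local) (use th1 lowR int in \<open>auto simp: waiting_def split: if_splits\<close>)
  next
    case (Self r)
    have "\<sigma>' = set_thr t (set_reg r (ThreadP t) th1) (add_instr t (deps th) (Suc 0) \<sigma>)"
      using ex' enc unfolding Self th1_def by simp
    then show ?thesis
      by (rule local) (use th1 lowR self in \<open>auto simp: waiting_def split: if_splits\<close>)
  next
    case Suspend
    have "\<sigma>' = set_thr t (th1\<lparr>status := Suspended\<rparr>) (add_instr t (deps th) (Suc 0) \<sigma>)"
      using ex' enc unfolding Suspend th1_def by simp
    then show ?thesis
      by (rule local) (use th1 lowR in \<open>auto simp: waiting_def split: if_splits\<close>)
  next
    case (Return r)
    have "\<sigma>' = set_thr t (th1\<lparr>status := Done (R r)\<rparr>) (add_instr t (deps th) (Suc 0) \<sigma>)"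
      using ex' enc unfolding Return th1_def by simp
    then show ?thesis
      by (rule local) (use th1 lowR in \<open>auto simp: waiting_def split: if_splits\<close>)
  next
    case (Join r x)
    obtain u y where u: "R x = ThreadP u" "status (thr \<sigma> u) = Done y" "u < nthr \<sigma>"
      and \<sigma>': "\<sigma>' = set_thr t (set_reg r y th1) (add_instr t (deps th \<union> deps (thr \<sigma> u)) (Suc 0) \<sigma>)"
      using ex' enc unfolding Join th1_def by (auto split: val.splits status.splits if_splits)
    have nu: "\<not> is_alg \<sigma> u"
      using lowR [of x] u(1) by (simp add: low_def)
    have "low lab \<sigma> y"
      using coreD(7) [OF core u(3) nu] u(2) by (simp add: cond_ok_def)
    then show ?thesis
      by (intro local [OF \<sigma>']) (use th1 lowR u(3) nu in \<open>auto simp: waiting_def split: if_splits\<close>)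
  next
    case (New r)
    have \<sigma>': "\<sigma>' = set_thr t (set_reg r (NodeP (nnodes \<sigma>)) th1)
        ((add_instr t (deps th) (Suc 0) \<sigma>)\<lparr>nnodes := Suc (nnodes \<sigma>), mem := (mem \<sigma>)(nnodes \<sigma> := (\<lambda>_. Null))\<rparr>)"
      using ex' enc unfolding New th1_def by simp
    have none: "lab (nnodes \<sigma>) = None"
      using laba [of "nnodes \<sigma>"] by (cases "lab (nnodes \<sigma>)") auto
    have l: "low lab \<sigma>' (NodeP (nnodes \<sigma>))"
      using none by (simp add: low_def \<sigma>')
    have l2: "low lab \<sigma>' (R r)" for r
      using low [OF lowR] .
    have "core lab rl (tau(ninstr \<sigma> := 0)) \<sigma>'"
    proof (rule cond_exec [OF core wf t st eff])
      show "tags_ok rl \<sigma>'"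
        by (rule tags) (simp add: \<sigma>')
      show "\<exists>u<nthr \<sigma>. \<not> is_alg \<sigma> u \<and> i \<in> deps (thr \<sigma> u)"
        if "(i, ninstr \<sigma>) \<in> edges \<sigma>'" "i < ninstr \<sigma>" for i
        using that t nedge by (auto simp: \<sigma>' th_def)
      show "low lab \<sigma>' (mem \<sigma>' a c)" if "nnodes \<sigma> \<le> a" "a < nnodes \<sigma>'" for a c
        using that by (simp add: \<sigma>' low_def)
    qed (use th1 l l2 in \<open>auto simp: \<sigma>' split: if_splits\<close>)
    then show ?thesis by blast
  next
    case (RMW r q c f)
    obtain a where a: "R q = NodeP a" "a < nnodes \<sigma>" "c < K"
      and \<sigma>': "\<sigma>' = set_thr t (th1\<lparr>status := Waiting a c (map_rmw R f) r\<rparr>)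
         ((add_instr t (deps th) 0 \<sigma>)\<lparr>queue := (queue \<sigma>)(a := (queue \<sigma> a)(c := queue \<sigma> a c @ [t]))\<rparr>)"
      using ex' enc unfolding RMW th1_def by (auto split: val.splits if_splits)
    have "lab a = None"
      using lowR [of q] a(1) by (simp add: low_def)
    moreover have "\<forall>x \<in> set_rmw (map_rmw R f). low lab \<sigma> x"
      using lowR by (auto simp: rmw.set_map)
    moreover have l2: "low lab \<sigma>' (R r)" for r
      using low [OF lowR] .
    ultimately have "core lab rl (tau(ninstr \<sigma> := 0)) \<sigma>'"
      using th1 a t nedge
      by (intro cond_exec [OF core wf t st eff tags]) (auto simp: \<sigma>' th_def split: if_splits)
    then show ?thesis by blast
  next
    case (Fork r q rs)
    obtain e where e: "eval_of th = Some e"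
      using t by (auto simp: is_alg_def th_def)
    have en: "e < nthr \<sigma>"
      using wf_configD(7) [OF wf t(1)] e by (simp add: th_def)
    have "Fork r q rs \<in> set (P (proc th))"
      using enc Fork unfolding I_def by (metis nth_mem)
    then have "\<exists>j'. q = Cond j'"
      using j cond_code by (auto simp: link_def cond_code_def split: if_splits) (metis nth_mem)
    then obtain j' where j': "q = Cond j'" by blast
    define u where "u = nthr \<sigma>"
    have \<sigma>': "\<sigma>' = set_thr u (new_thread (Cond j') (map R rs) {ninstr \<sigma>} (Some e))
        (set_thr t (set_reg r (ThreadP u) th1) ((add_instr t (deps th) (Suc 0) \<sigma>)\<lparr>nthr := Suc u\<rparr>))"
      using ex' enc e unfolding Fork j' th1_def u_def by simp
    have tu: "t \<noteq> u"
      using t by (simp add: u_def)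
    have rlu: "rl u = None"
      using tg(1) [of u] by (cases "rl u") (auto simp: u_def)
    have l: "low lab \<sigma>' (ThreadP u)"
      by (simp add: low_def is_alg_def \<sigma>')
    have l2: "low lab \<sigma>' (R r)" for r
      using low [OF lowR] .
    have l3: "low lab \<sigma>' Null"
      by (simp add: low_def)
    have "core lab rl (tau(ninstr \<sigma> := 0)) \<sigma>'"
    proof (rule cond_exec [OF core wf t st eff])
      show "tags_ok rl \<sigma>'"
        by (rule tags_fork [OF coreD(1) [OF core] t(1) st eff])
          (use t rlu en in \<open>auto simp: \<sigma>' u_def is_alg_def\<close>)
      show "\<exists>u<nthr \<sigma>. \<not> is_alg \<sigma> u \<and> i \<in> deps (thr \<sigma> u)"
        if "(i, ninstr \<sigma>) \<in> edges \<sigma>'" "i < ninstr \<sigma>" for i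
        using that t nedge by (auto simp: \<sigma>' th_def)
      show "low lab \<sigma>' (mem \<sigma>' a c)" if "nnodes \<sigma> \<le> a" "a < nnodes \<sigma>'" for a c
        using that by (simp add: \<sigma>')
    qed (use th1 l l2 l3 tu in \<open>auto simp: \<sigma>' u_def less_Suc_eq split: if_splits\<close>)
    then show ?thesis by blast
  next
    case (Resume x)
    obtain u where u: "R x = ThreadP u" "u < nthr \<sigma>"
      and \<sigma>': "\<sigma>' = (let \<sigma>2 = set_thr t th1 (add_instr t (deps th) (Suc 0) \<sigma>); tu = thr \<sigma> u
         in if status tu = Suspended
            then set_thr u (tu\<lparr>status := Ready, deps := insert (ninstr \<sigma>) (deps tu)\<rparr>) \<sigma>2 else \<sigma>2)"
      using ex' enc unfolding Resume th1_def Let_def by (auto split: val.splits if_splits)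
    have nu: "\<not> is_alg \<sigma> u"
      using lowR [of x] u(1) by (simp add: low_def)
    show ?thesis
    proof (cases "status (thr \<sigma> u) = Suspended")
      case False
      then have "\<sigma>' = set_thr t th1 (add_instr t (deps th) (Suc 0) \<sigma>)"
        using \<sigma>' by (simp add: Let_def)
      then show ?thesis
        by (rule local) (use th1 lowR in \<open>auto simp: waiting_def split: if_splits\<close>)
    next
      case True
      then have \<sigma>': "\<sigma>' = set_thr u ((thr \<sigma> u)\<lparr>status := Ready, deps := insert (ninstr \<sigma>) (deps (thr \<sigma> u))\<rparr>)
          (set_thr t th1 (add_instr t (deps th) (Suc 0) \<sigma>))"
        using \<sigma>' by (simp add: Let_def)
      have tu: "t \<noteq> u"
        using True st by auto
      have cu: "cond_ok lab tau \<sigma> (thr \<sigma> u)"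
        by (rule coreD(7) [OF core u(2) nu])
      have "core lab rl (tau(ninstr \<sigma> := 0)) \<sigma>'"
      proof (rule cond_exec [OF core wf t st eff])
        show "tags_ok rl \<sigma>'"
          by (rule tags) (simp add: \<sigma>')
        show "\<exists>u<nthr \<sigma>. \<not> is_alg \<sigma> u \<and> i \<in> deps (thr \<sigma> u)"
          if "(i, ninstr \<sigma>) \<in> edges \<sigma>'" "i < ninstr \<sigma>" for i
          using that t nedge by (auto simp: \<sigma>' th_def)
        show "low lab \<sigma>' (mem \<sigma>' a c)" if "nnodes \<sigma> \<le> a" "a < nnodes \<sigma>'" for a c
          using that by (simp add: \<sigma>')
      qed (use th1 lowR low tu cu in \<open>auto simp: \<sigma>' cond_ok_def split: if_splits\<close>)
      then show ?thesis by blast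
    qed
  qed
qed

section \<open>Serving requests\<close>

lemma waiting_alg:
  assumes core: "core lab rl tau \<sigma>" and rlt: "rl t = Some (AlgT \<rho>)"
    and w: "status (thr \<sigma> t) = Waiting a c f r"
  obtains s F E av where "good \<rho> s F (pc (thr \<sigma> t)) (drop (pc (thr \<sigma> t)) (code \<rho>)) (E(r := av))"
    "\<And>r. rep lab rl (regs (thr \<sigma> t) r) (E r)"
    "\<And>i. i \<in> deps (thr \<sigma> t) \<Longrightarrow> is_alg \<sigma> (thread_of \<sigma> i) \<and> tau i < s \<and> weight \<sigma> i = 0"
    "request_ok lab rl \<sigma> \<rho> a c f av F"
proof -
  have "wait_ok lab rl tau \<sigma> \<rho> (thr \<sigma> t)"
    using coreD(6) [OF core rlt] w by (auto simp: alg_ok_def ready_ok_def done_ok_def)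
  then show ?thesis
    using that w unfolding wait_ok_def by auto
qed

lemma waiting_request:
  assumes "core lab rl tau \<sigma>" "rl t = Some (AlgT \<rho>)" "status (thr \<sigma> t) = Waiting a c f r"
  shows "\<exists>av F. request_ok lab rl \<sigma> \<rho> a c f av F" "i \<in> deps (thr \<sigma> t) \<Longrightarrow> weight \<sigma> i = 0"
  by (rule waiting_alg [OF assms]; metis)+

lemma waiting_not_ended:
  assumes core: "core lab rl tau \<sigma>" and rlt: "rl t = Some (AlgT \<rho>)"
    and w: "status (thr \<sigma> t) = Waiting a c f r"
  shows "\<not> holds lab rl \<sigma> (Ended \<rho>)"
  using tags_okD(4) [OF coreD(1) [OF core] rlt] w by auto

text \<open>A reader of the input with a pending request has not ended, and \<open>gate_ok\<close>
  makes the end of all such readers a condition for the existence of any evaluation thread.\<close>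

lemma waiting_old:
  assumes core: "core lab rl tau \<sigma>" and rlt: "rl t = Some (AlgT \<rho>)"
    and w: "status (thr \<sigma> t) = Waiting a c f r" and old: "old \<rho> a'" and u: "u < nthr \<sigma>"
  shows "is_alg \<sigma> u"
  using coreD(4) [OF core] waiting_not_ended [OF core rlt w] old u unfolding gate_ok_def by blast

text \<open>Evaluations queue only at unnamed cells, where the algorithm does nothing but read the
  input, and this only before any evaluation exists. At a named cell writer and reader cannot both
  be waiting, since the reader's access presupposes the end of the writer.\<close>

lemma exclusive:
  assumes core: "core lab rl tau \<sigma>" and wf: "wf_config \<sigma>" and rlt: "rl t = Some (AlgT \<rho>)"
    and w: "status (thr \<sigma> t) = Waiting a c f r"
  shows "queue \<sigma> a c = [t]"
proof -
  note tg = tags_okD [OF coreD(1) [OF core]]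
  have labN: "lab a = Some L \<Longrightarrow> N \<le> a" for L
    using coreD(2) [OF core] by (auto simp: labs_ok_def)
  obtain av F where req: "request_ok lab rl \<sigma> \<rho> a c f av F"
    using waiting_request(1) [OF core rlt w] by blast
  have "u = t" if u: "u \<in> set (queue \<sigma> a c)" for u
  proof -
    obtain f' r' where u': "u < nthr \<sigma>" and wu: "status (thr \<sigma> u) = Waiting a c f' r'"
      using wf_configD(5) [OF wf, of u a c] u by blast
    show ?thesis
    proof (cases "is_alg \<sigma> u")
      case False
      then have "lab a = None"
        using coreD(7) [OF core u'] wu by (auto simp: cond_ok_def)
      then have "old \<rho> a"
        using req by (auto simp: request_ok_def)
      with False waiting_old [OF core rlt w _ u'] show ?thesis by blast
    next
      case True
      then obtain \<rho>' where rlu: "rl u = Some (AlgT \<rho>')"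
        using tg(2) [OF u'] by blast
      obtain av' F' where req': "request_ok lab rl \<sigma> \<rho>' a c f' av' F'"
        using waiting_request(1) [OF core rlu wu] by blast
      note ne = waiting_not_ended [OF core rlt w] waiting_not_ended [OF core rlu wu]
      have "\<rho> = \<rho>'"
      proof (cases "lab a")
        case None
        then have "old \<rho> a" "old \<rho>' a"
          using req req' by (auto simp: request_ok_def)
        then show ?thesis
          by (rule old_inj)
      next
        case (Some L)
        then have "may lab rl \<sigma> \<rho> L c" "may lab rl \<sigma> \<rho>' L c"
          using req req' labN [OF Some] by (auto simp: request_ok_def)
        then show ?thesis
          using ne unfolding may_def by blast
      qed
      then show ?thesis
        using tg(4) rlu rlt by metis
    qed
  qed
  moreover have "t \<in> set (queue \<sigma> a c)"
    using wf_configD(5) [OF wf, of t a c] tg(1) [OF rlt] w by blast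
  ultimately have "set (queue \<sigma> a c) = {t}"
    by blast
  moreover from this have "length (queue \<sigma> a c) = 1"
    using distinct_card [OF wf_configD(4) [OF wf, of a c]] by simp
  ultimately show ?thesis
    by (cases "queue \<sigma> a c") auto
qed

lemma service_served:
  assumes "queue \<sigma> a c = [t]" "status (thr \<sigma> t) = Waiting a c f r"
  shows "thr (service \<sigma>) t = set_reg r (snd (rmw_op f (mem \<sigma> a c))) ((thr \<sigma> t)\<lparr>status := Ready\<rparr>)"
    "mem (service \<sigma>) a c = fst (rmw_op f (mem \<sigma> a c))"
  using assms by (simp_all add: service_thr service_mem)

lemma service_mem_cases:
  assumes wf: "wf_config \<sigma>"
  obtains "mem (service \<sigma>) a c = mem \<sigma> a c"
  | t f r where "t < nthr \<sigma>" "status (thr \<sigma> t) = Waiting a c f r"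
    "mem (service \<sigma>) a c = fst (rmw_op f (mem \<sigma> a c))" "queue \<sigma> a c \<noteq> []"
proof (cases "queue \<sigma> a c")
  case Nil
  then show ?thesis
    using that(1) by (simp add: service_mem)
next
  case (Cons t ts)
  then obtain f r where "t < nthr \<sigma>" "status (thr \<sigma> t) = Waiting a c f r"
    using wf_configD(5) [OF wf, of t a c] by auto
  then show ?thesis
    using that(2) Cons by (simp add: service_mem)
qed

lemma core_service:
  assumes core: "core lab rl tau \<sigma>" and wf: "wf_config \<sigma>"
  shows "core lab rl tau (service \<sigma>)"
proof -
  define \<sigma>' where "\<sigma>' = service \<sigma>"
  note tg = tags_okD [OF coreD(1) [OF core]]
  have pe: "persists \<sigma> \<sigma>'"
    unfolding \<sigma>'_def by (rule service_persists)
  have same: "same_frame (thr \<sigma> u) (thr \<sigma>' u)" "deps (thr \<sigma>' u) = deps (thr \<sigma> u)"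
    "pc (thr \<sigma>' u) = pc (thr \<sigma> u)" for u
    unfolding \<sigma>'_def by (rule service_thr_frame)+
  have alg: "is_alg \<sigma>' u = is_alg \<sigma> u" for u
    using same(1) [of u] by (simp add: is_alg_def same_frame_def)
  have num: "nnodes \<sigma>' = nnodes \<sigma>" "nthr \<sigma>' = nthr \<sigma>" "ninstr \<sigma>' = ninstr \<sigma>"
    "thread_of \<sigma>' = thread_of \<sigma>" "edges \<sigma>' = edges \<sigma>"
    by (simp_all add: \<sigma>'_def)
  have passed: "passed rl \<sigma>' = passed rl \<sigma>"
    by (simp add: fun_eq_iff passed_def same)
  have low: "low lab \<sigma>' = low lab \<sigma>"
    by (simp add: fun_eq_iff low_def alg num split: val.splits)
  have labN: "lab a = Some L \<Longrightarrow> N \<le> a" and lab_inj: "lab a = Some L \<Longrightarrow> lab a' = Some L \<Longrightarrow> a' = a" for a a' L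
    using coreD(2) [OF core] by (auto simp: labs_ok_def)
  \<comment> \<open>A request served at a named cell either reads or stores the designated
    value.\<close>
  have filled: "rep lab rl (mem \<sigma>' a c) (MV L c)"
    if l: "lab a = Some L" and r: "rep lab rl (mem \<sigma> a c) (MV L c)" for a c L
  proof (cases rule: service_mem_cases [OF wf, of a c])
    case 1
    then show ?thesis using r by (simp add: \<sigma>'_def)
  next
    case (2 t f r')
    have "is_alg \<sigma> t"
      using coreD(7) [OF core 2(1)] 2(2) l by (auto simp: cond_ok_def)
    then obtain \<rho> where rlt: "rl t = Some (AlgT \<rho>)"
      using tg(2) [OF 2(1)] by blast
    obtain av F where "request_ok lab rl \<sigma> \<rho> a c f av F"
      using waiting_request(1) [OF core rlt 2(2)] by blast
    then show ?thesis
      using l labN [OF l] r 2(3) by (auto simp: request_ok_def \<sigma>'_def)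
  qed
  have holds: "holds lab rl \<sigma>' f" if "holds lab rl \<sigma> f" for f
    by (rule holds_mono [OF that coreD(1) [OF core] map_le_refl map_le_refl pe filled])
  have tags': "tags_ok rl \<sigma>'"
  proof -
    have "proc (thr \<sigma>' u) = proc (thr \<sigma> u)" "args (thr \<sigma>' u) = args (thr \<sigma> u)"
      "eval_of (thr \<sigma>' u) = eval_of (thr \<sigma> u)" for u
      using same(1) [of u] by (simp_all add: same_frame_def)
    then show ?thesis
      using coreD(1) [OF core] unfolding tags_ok_def num alg passed by simp
  qed
  have labs': "labs_ok lab rl \<sigma>'"
    using coreD(2) [OF core] unfolding labs_ok_def num passed .
  have gate': "gate_ok lab rl \<sigma>'"
    using coreD(4) [OF core] holds unfolding gate_ok_def num alg by blast
  have mem': "mem_ok lab \<sigma>'"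
    unfolding mem_ok_def num low alg
  proof (intro conjI allI impI)
    show "N \<le> nnodes \<sigma>"
      using coreD(3) [OF core] by (simp add: mem_ok_def)
    fix a c
    assume a: "a < nnodes \<sigma>" "c < K" "lab a = None"
    have l: "low lab \<sigma> (mem \<sigma> a c)"
      using coreD(3) [OF core] a by (simp add: mem_ok_def)
    show "low lab \<sigma> (mem \<sigma>' a c)"
    proof (cases rule: service_mem_cases [OF wf, of a c])
      case 1
      then show ?thesis using l by (simp add: \<sigma>'_def)
    next
      case (2 t f r')
      show ?thesis
      proof (cases "is_alg \<sigma> t")
        case True
        then obtain \<rho> where rlt: "rl t = Some (AlgT \<rho>)"
          using tg(2) [OF 2(1)] by blast
        obtain av F where "request_ok lab rl \<sigma> \<rho> a c f av F"
          using waiting_request(1) [OF core rlt 2(2)] by blast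
        then show ?thesis
          using a l 2(3) by (auto simp: request_ok_def \<sigma>'_def)
      next
        case False
        then show ?thesis
          using coreD(7) [OF core 2(1)] 2(2,3) low_rmw(1) [OF l] by (auto simp: cond_ok_def \<sigma>'_def)
      qed
    qed
  next
    fix a c
    assume all: "\<forall>t<nthr \<sigma>. is_alg \<sigma> t" and a: "a < N" "c < K"
    have l: "mem \<sigma> a c = m a c"
      using coreD(3) [OF core] a all by (simp add: mem_ok_def)
    show "mem \<sigma>' a c = m a c"
    proof (cases rule: service_mem_cases [OF wf, of a c])
      case 1
      then show ?thesis using l by (simp add: \<sigma>'_def)
    next
      case (2 t f r')
      then obtain \<rho> where rlt: "rl t = Some (AlgT \<rho>)"
        using tg(2) all by blast
      obtain av F where "request_ok lab rl \<sigma> \<rho> a c f av F"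
        using waiting_request(1) [OF core rlt 2(2)] by blast
      then show ?thesis
        using a l 2(3) labN by (fastforce simp: request_ok_def \<sigma>'_def)
    qed
  qed
  have dag': "dag_ok tau \<sigma>'"
  proof -
    \<comment> \<open>A queued request of the algorithm still has weight 0, so this charge raises it
      to 1; alone in its queue, it is served by the same \<open>service\<close>.\<close>
    have "weight \<sigma>' i \<le> 1" if i: "i < ninstr \<sigma>" "is_alg \<sigma> (thread_of \<sigma> i)" for i
    proof (cases "\<exists>t < nthr \<sigma>. waiting (thr \<sigma> t) \<and> i \<in> deps (thr \<sigma> t)")
      case True
      then obtain t a c f r where t: "t < nthr \<sigma>" "status (thr \<sigma> t) = Waiting a c f r" "i \<in> deps (thr \<sigma> t)"
        by (auto simp: waiting_def)
      then have "thread_of \<sigma> i = t"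
        using wf_configD(6) [OF wf t(1)] by (auto simp: waiting_def)
      then obtain \<rho> where rlt: "rl t = Some (AlgT \<rho>)"
        using tg(2) [OF t(1)] i(2) by blast
      have "weight \<sigma> i = 0"
        by (rule waiting_request(2) [OF core rlt t(2,3)])
      then show ?thesis by (simp add: \<sigma>'_def)
    next
      case False
      then have "weight \<sigma>' i = weight \<sigma> i"
        by (auto simp: \<sigma>'_def)
      then show ?thesis
        using coreD(5) [OF core] i by (simp add: dag_ok_def)
    qed
    then show ?thesis
      using coreD(5) [OF core] unfolding dag_ok_def num alg by blast
  qed
  have algs': "alg_ok lab rl tau \<sigma>' \<rho> t" if rlt: "rl t = Some (AlgT \<rho>)" for t \<rho>
  proof (cases "waiting (thr \<sigma> t)")
    case False
    then have "thr \<sigma>' t = thr \<sigma> t"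
      unfolding \<sigma>'_def by (rule service_thr_idle)
    then show ?thesis
      by (rule alg_ok_same [OF coreD(6) [OF core rlt] _ map_le_refl map_le_refl holds])
        (use False num alg in auto)
  next
    case True
    then obtain a c f r where w: "status (thr \<sigma> t) = Waiting a c f r"
      by (auto simp: waiting_def)
    obtain s F E av where g: "good \<rho> s F (pc (thr \<sigma> t)) (drop (pc (thr \<sigma> t)) (code \<rho>)) (E(r := av))"
      "\<And>r. rep lab rl (regs (thr \<sigma> t) r) (E r)"
      "\<And>i. i \<in> deps (thr \<sigma> t) \<Longrightarrow> is_alg \<sigma> (thread_of \<sigma> i) \<and> tau i < s \<and> weight \<sigma> i = 0"
      "request_ok lab rl \<sigma> \<rho> a c f av F"
      by (rule waiting_alg [OF core rlt w]) (rule that, assumption, blast, blast, assumption)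
    note sv = service_served [OF exclusive [OF core wf rlt w] w, folded \<sigma>'_def]
    have "rep lab rl (snd (rmw_op f (mem \<sigma> a c))) av \<and> (\<forall>f \<in> F. holds lab rl \<sigma>' f)"
      using g(4) unfolding request_ok_def
    proof (elim disjE exE conjE)
      fix L
      assume *: "lab a = Some L" "av = MV L c" "f = Read" "holds lab rl \<sigma> (Filled L c)"
        "\<forall>f\<in>F. holds lab rl \<sigma> f"
      then have "rep lab rl (mem \<sigma> a c) (MV L c)"
        using lab_inj by auto
      then show ?thesis
        using * holds by auto
    next
      fix L x
      assume *: "lab a = Some L" "av = MV L c" "f = Write x" "rep lab rl x av"
        "\<forall>f\<in>F - {Filled L c}. holds lab rl \<sigma> f"
      \<comment> \<open>The fact promised in \<open>request_ok\<close> becomes true now.\<close>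
      then have "holds lab rl \<sigma>' (Filled L c)"
        using sv(2) by auto
      then have "\<forall>f \<in> F. holds lab rl \<sigma>' f"
        using *(5) holds by blast
      then show ?thesis
        using * by simp
    next
      assume *: "f = Read" "a < N" "c < K" "old \<rho> a" "av = Raw (m a c)" "\<forall>f\<in>F. holds lab rl \<sigma> f"
      have "mem \<sigma> a c = m a c"
        using coreD(3) [OF core] waiting_old [OF core rlt w *(4)] *(2,3) by (simp add: mem_ok_def)
      then show ?thesis
        using * holds by auto
    qed
    then have "ready_ok lab rl tau \<sigma>' \<rho> (thr \<sigma>' t)"
      unfolding ready_ok_def
      by (intro conjI exI [of _ s] exI [of _ F] exI [of _ "E(r := av)"])
        (use g in \<open>auto simp: sv(1) num alg\<close>)
    moreover have "proc (thr \<sigma>' t) = Alg (prc \<rho>)"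
      using same(1) [of t] coreD(6) [OF core rlt] by (simp add: same_frame_def alg_ok_def)
    ultimately show ?thesis
      using coreD(6) [OF core rlt] unfolding alg_ok_def num same by blast
  qed
  have conds': "cond_ok lab tau \<sigma>' (thr \<sigma>' t)" if t: "t < nthr \<sigma>" "\<not> is_alg \<sigma> t" for t
  proof -
    have c: "cond_ok lab tau \<sigma> (thr \<sigma> t)"
      by (rule coreD(7) [OF core t])
    then have c': "cond_ok lab tau \<sigma>' (thr \<sigma> t)"
      unfolding cond_ok_def num alg low .
    show ?thesis
    proof (cases "thr \<sigma>' t = thr \<sigma> t")
      case False
      then obtain a c f r where w: "status (thr \<sigma> t) = Waiting a c f r"
        and th: "thr \<sigma>' t = set_reg r (snd (rmw_op f (mem \<sigma> a c))) ((thr \<sigma> t)\<lparr>status := Ready\<rparr>)"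
        by (auto simp: \<sigma>'_def service_thr split: status.splits if_splits)
      have "low lab \<sigma> (mem \<sigma> a c)"
        using c w coreD(3) [OF core] by (auto simp: cond_ok_def mem_ok_def)
      then have "low lab \<sigma> (snd (rmw_op f (mem \<sigma> a c)))"
        using c w low_rmw(2) by (auto simp: cond_ok_def)
      then show ?thesis
        using c' unfolding th cond_ok_def low by simp
    qed (use c' in simp)
  qed
  show ?thesis
    unfolding \<sigma>'_def [symmetric] core_def
    using tags' labs' mem' gate' dag' algs' conds' by (auto simp: num alg)
qed

lemma core_init: "\<exists>lab rl tau. core lab rl tau (init_config m N v)"
proof (intro exI)
  let ?\<sigma> = "init_config m N v" and ?rl = "[0 \<mapsto> AlgT main]"
  have s: "nnodes ?\<sigma> = N" "nthr ?\<sigma> = 1" "ninstr ?\<sigma> = 0" "edges ?\<sigma> = {}" "mem ?\<sigma> = m"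
    "thr ?\<sigma> 0 = new_thread (Alg 0) [v] {} None"
    by (simp_all add: init_config_def)
  have "ready_ok Map.empty ?rl (\<lambda>_. 0) ?\<sigma> main (thr ?\<sigma> 0)"
    unfolding ready_ok_def
    by (intro conjI exI [of _ "start main"] exI [of _ "{}"] exI [of _ "init_env main"])
      (use good_role [OF main(1)] main in \<open>auto simp: s init_env_def\<close>)
  then have a: "alg_ok Map.empty ?rl (\<lambda>_. 0) ?\<sigma> main 0"
    by (simp add: alg_ok_def s main)
  have "low Map.empty ?\<sigma> (m a c)" if "a < N" "c < K" for a c
    using memory that by (auto simp: wf_memory_def low_def s split: val.splits)
  then have "mem_ok Map.empty ?\<sigma>"
    by (simp add: mem_ok_def s)
  then show "core Map.empty ?rl (\<lambda>_. 0) ?\<sigma>"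
    using a main by (auto simp: core_def tags_ok_def labs_ok_def gate_ok_def dag_ok_def is_alg_def s)
qed

lemma honest_persists:
  assumes "honest \<sigma>'" "persists \<sigma> \<sigma>'"
  shows "honest \<sigma>"
  using assms unfolding honest_def evaluation_def persists_def same_frame_def
  by (metis less_le_trans)

lemma run_core:
  assumes run: "(time_step K P)\<^sup>*\<^sup>* (init_config m N v) \<sigma>" and honest: "honest \<sigma>"
  shows "\<exists>lab rl tau. core lab rl tau \<sigma>"
proof -
  \<comment> \<open>Honesty is assumed for the last configuration only. As a premise inside the
    invariant it can be passed backwards from each configuration to its predecessor.\<close>
  define I where "I \<sigma> \<longleftrightarrow> wf_config \<sigma> \<and> (honest \<sigma> \<longrightarrow> (\<exists>lab rl tau. core lab rl tau \<sigma>))" for \<sigma>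
  have "I \<sigma>"
  proof (rule run_invariant [OF _ _ _ run])
    show "I (init_config m N v)"
      using core_init by (simp add: I_def wf_config_init)
    show "I (service \<tau>)" if "I \<tau>" for \<tau>
      using that service_wf core_service honest_persists [OF _ service_persists]
      unfolding I_def by blast
    fix t \<tau> \<tau>'
    assume I: "I \<tau>" and ex: "exec K P t \<tau> = Some \<tau>'"
    have t: "t < nthr \<tau>" "status (thr \<tau> t) = Ready"
      using exec_enabled [OF ex] by (auto simp: enabled_def)
    have "\<exists>lab rl tau. core lab rl tau \<tau>'" if h: "honest \<tau>'"
    proof -
      have h': "honest \<tau>"
        by (rule honest_persists [OF h effect_persists [OF t exec_effect [OF ex]]])
      with I obtain lab rl tau where c: "core lab rl tau \<tau>" and wf: "wf_config \<tau>"
        by (auto simp: I_def)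
      show ?thesis
      proof (cases "is_alg \<tau> t")
        case True
        then obtain \<rho> where "rl t = Some (AlgT \<rho>)"
          using tags_okD(2) [OF coreD(1) [OF c] t(1)] by blast
        with alg_step [OF c wf h' _ ex] show ?thesis by blast
      next
        case False
        with cond_step [OF c wf t(1) _ ex] show ?thesis by blast
      qed
    qed
    then show "I \<tau>'"
      using I exec_wf [OF _ ex] by (simp add: I_def)
  qed
  then show ?thesis
    using honest by (simp add: I_def)
qed

section \<open>Work, span and termination\<close>

text \<open>Symbolic execution rules out ill-typed instructions and running off the code, which
  leaves an unfinished \<open>Join\<close> as the only reason to be stuck.\<close>

lemma blocked:
  assumes core: "core lab rl tau \<sigma>" and rlt: "rl t = Some (AlgT \<rho>)"
    and st: "status (thr \<sigma> t) = Ready" and ex: "exec K P t \<sigma> = None"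
  shows "(\<exists>u \<rho>'. rl u = Some (AlgT \<rho>') \<and> fin \<rho>' < fin \<rho> \<and> (\<forall>x. status (thr \<sigma> u) \<noteq> Done x)) \<or>
    (\<exists>u \<rho>'. rl u = Some (CondT \<rho>') \<and> (\<forall>x. status (thr \<sigma> u) \<noteq> Done x))"
proof -
  note tg = tags_okD [OF coreD(1) [OF core]]
  have t: "t < nthr \<sigma>" and \<rho>: "\<rho> \<in> Roles"
    using tg(1,6) [OF rlt] .
  define th where "th = thr \<sigma> t"
  have prog: "P (proc th) = code \<rho>"
    using coreD(6) [OF core rlt] prog_code [OF \<rho>] by (simp add: alg_ok_def th_def)
  have "ready_ok lab rl tau \<sigma> \<rho> th"
    using coreD(6) [OF core rlt] st by (auto simp: alg_ok_def wait_ok_def done_ok_def th_def)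
  then obtain s F E where good0: "good \<rho> s F (pc th) (drop (pc th) (code \<rho>)) E"
    and regs: "\<And>r. rep lab rl (regs th r) (E r)"
    unfolding ready_ok_def by metis
  have len: "pc th < length (code \<rho>)"
    using good0 by (cases "pc th < length (code \<rho>)") auto
  define p where "p = pc th"
  define I where "I = code \<rho> ! p"
  define cs where "cs = drop (Suc p) (code \<rho>)"
  have good: "good \<rho> s F p (I # cs) E"
    using good0 len Cons_nth_drop_Suc unfolding p_def I_def cs_def by metis
  note ex' = ex [unfolded exec_def Let_def, folded th_def, unfolded prog, folded p_def, folded I_def]
  have enc: "t < nthr \<sigma> \<and> status th = Ready \<and> p < length (code \<rho>)"
    using t st len by (simp add: th_def p_def)
  have laba: "lab a = Some L \<Longrightarrow> a < nnodes \<sigma>" for a L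
    using coreD(2) [OF core] by (auto simp: labs_ok_def)
  have N: "N \<le> nnodes \<sigma>"
    using coreD(3) [OF core] by (simp add: mem_ok_def)
  show ?thesis
  proof (cases I)
    case (Arith f r r1 r2)
    from good [unfolded Arith] obtain x y where "E r1 = Raw (IntV x)" "E r2 = Raw (IntV y)"
      by (rule good_ArithD)
    then show ?thesis
      using ex' enc regs [of r1] regs [of r2] unfolding Arith by simp
  next
    case (BranchLess r1 r2 l)
    from good [unfolded BranchLess] obtain x y where "E r1 = Raw (IntV x)" "E r2 = Raw (IntV y)"
      by (rule good_BranchLessD)
    then show ?thesis
      using ex' enc regs [of r1] regs [of r2] unfolding BranchLess by simp
  next
    case (RMW r q c f)
    from good [unfolded RMW] have "\<exists>a. regs th q = NodeP a \<and> a < nnodes \<sigma> \<and> c < K"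
      using regs [of q] laba N by (cases rule: good_RMWD) auto
    then show ?thesis
      using ex' enc unfolding RMW by auto
  next
    case (Join r x)
    from good [unfolded Join] show ?thesis
    proof (cases rule: good_JoinD)
      case (alg \<rho>')
      obtain u where u: "regs th x = ThreadP u" "rl u = Some (AlgT \<rho>')"
        using regs [of x] alg(1) by auto
      have "status (thr \<sigma> u) \<noteq> Done y" for y
        using ex' enc u(1) tg(1) [OF u(2)] unfolding Join by (auto split: status.splits)
      moreover have "fin \<rho>' < fin \<rho>"
        using good_le_fin [OF alg(2)] by simp
      ultimately show ?thesis
        using u(2) by blast
    next
      case (cond \<rho>')
      obtain u where u: "regs th x = ThreadP u" "rl u = Some (CondT \<rho>')"
        using regs [of x] cond(1) by auto
      have "status (thr \<sigma> u) \<noteq> Done y" for y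
        using ex' enc u(1) tg(1) [OF u(2)] unfolding Join by (auto split: status.splits)
      then show ?thesis
        using u(2) by blast
    qed
  qed (use good ex' enc in \<open>auto simp: Let_def\<close>)
qed

lemma cond_evaluation:
  assumes core: "core lab rl tau \<sigma>" and rlu: "rl u = Some (CondT \<rho>)"
  shows "evaluation \<sigma> u (itm \<rho>)" "itm \<rho> \<in> set xs" "\<rho> \<in> Evals"
proof -
  note tg = tags_okD [OF coreD(1) [OF core]]
  show "evaluation \<sigma> u (itm \<rho>)"
    using tg(1,8) [OF rlu] tg(3) [OF tg(1) [OF rlu]] rlu by (auto simp: evaluation_def)
  show "\<rho> \<in> Evals" "itm \<rho> \<in> set xs"
    using tg(8) [OF rlu] itm by auto
qed

lemma evaluates_honest: "evaluates K P xs \<phi> \<sigma> \<Longrightarrow> honest \<sigma>"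
  unfolding evaluates_def honest_def by blast

text \<open>A role that has not ended would wait for a role with smaller \<open>fin\<close> or for
  an evaluation; induction on \<open>fin\<close> excludes the former, and evaluations have results
  by hypothesis.\<close>

lemma finished_done:
  assumes core: "core lab rl tau \<sigma>" and wf: "wf_config \<sigma>" and ev: "evaluates K P xs \<phi> \<sigma>"
    and fin: "finished K P \<sigma>"
  shows "\<exists>x. status (thr \<sigma> 0) = Done x"
proof -
  note tg = tags_okD [OF coreD(1) [OF core]]
  have "\<exists>x. status (thr \<sigma> t) = Done x" if "rl t = Some (AlgT \<rho>)" for t \<rho>
    using that
  proof (induction "fin \<rho>" arbitrary: t \<rho> rule: less_induct)
    case less
    show ?case
    proof (rule ccontr)
      assume nd: "\<not> ?thesis"
      have "status (thr \<sigma> t) \<noteq> Waiting a c f r" for a c f r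
        using wf_configD(5) [OF wf, of t a c] tg(1) [OF less.prems] fin by (auto simp: finished_def)
      then have st: "status (thr \<sigma> t) = Ready"
        using coreD(6) [OF core less.prems] nd
        by (auto simp: alg_ok_def ready_ok_def wait_ok_def done_ok_def)
      have "exec K P t \<sigma> = None"
        using fin by (simp add: finished_def)
      from blocked [OF core less.prems st this] show False
      proof
        assume "\<exists>u \<rho>'. rl u = Some (AlgT \<rho>') \<and> fin \<rho>' < fin \<rho> \<and> (\<forall>x. status (thr \<sigma> u) \<noteq> Done x)"
        with less.hyps show False by blast
      next
        assume "\<exists>u \<rho>'. rl u = Some (CondT \<rho>') \<and> (\<forall>x. status (thr \<sigma> u) \<noteq> Done x)"
        then obtain u \<rho>' where u: "rl u = Some (CondT \<rho>')" "\<forall>x. status (thr \<sigma> u) \<noteq> Done x"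
          by blast
        then show False
          using ev fin cond_evaluation [OF core u(1)] unfolding evaluates_def by blast
      qed
    qed
  qed
  then show ?thesis
    using tg(5) by blast
qed

lemma result:
  assumes core: "core lab rl tau \<sigma>" and d: "status (thr \<sigma> 0) = Done y"
  shows "rep lab rl y (ret main)" "f \<in> KD main \<Longrightarrow> holds lab rl \<sigma> f"
proof -
  have "done_ok lab rl tau \<sigma> main (thr \<sigma> 0)"
    using coreD(6) [OF core tags_okD(5) [OF coreD(1) [OF core]]] d
    by (auto simp: alg_ok_def ready_ok_def wait_ok_def)
  then show "rep lab rl y (ret main)" "f \<in> KD main \<Longrightarrow> holds lab rl \<sigma> f"
    using d by (auto simp: done_ok_def)
qed

lemma evaluation_of:
  assumes core: "core lab rl tau \<sigma>" and wf: "wf_config \<sigma>" and t: "t < nthr \<sigma>"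
    and e: "eval_of (thr \<sigma> t) = Some e"
  obtains \<rho> where "rl e = Some (CondT \<rho>)"
  using wf_configD(7) [OF wf t e] tags_okD(3) [OF coreD(1) [OF core], of e] that by blast

text \<open>Every instruction belongs to a role or to an evaluation, and distinct threads carry
  distinct names, so counting names suffices. The bound \<open>w'\<close> is nonnegative because the
  number of evaluations so far is replaced by the larger \<open>card Evals\<close>.\<close>

lemma work_bound:
  assumes core: "core lab rl tau \<sigma>" and wf: "wf_config \<sigma>" and cost: "evaluation_cost xs w s \<sigma>"
    and w: "w \<le> w'" "0 \<le> w'"
  shows "real (dag_work \<sigma>) \<le> real (card Roles * M) + real (card Evals) * w'"
proof -
  note tg = tags_okD [OF coreD(1) [OF core]]
  define T where "T = {t. \<exists>\<rho>. rl t = Some (AlgT \<rho>)}"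
  define Ev where "Ev = {e. \<exists>\<rho>. rl e = Some (CondT \<rho>)}"
  define J where "J t = {i. i < ninstr \<sigma> \<and> thread_of \<sigma> i = t}" for t
  have finT: "finite T" "finite Ev"
    by (rule finite_subset [of _ "{..<nthr \<sigma>}"]; auto simp: T_def Ev_def dest: tg(1))+
  have "card T \<le> card Roles"
  proof (rule card_inj_on_le [of "\<lambda>t. THE \<rho>. rl t = Some (AlgT \<rho>)"])
    have the: "rl t = Some (AlgT \<rho>) \<Longrightarrow> (THE \<rho>. rl t = Some (AlgT \<rho>)) = \<rho>" for t \<rho>
      by auto
    show "inj_on (\<lambda>t. THE \<rho>. rl t = Some (AlgT \<rho>)) T"
    proof (rule inj_onI)
      fix t t'
      assume *: "t \<in> T" "t' \<in> T" "(THE \<rho>. rl t = Some (AlgT \<rho>)) = (THE \<rho>. rl t' = Some (AlgT \<rho>))"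
      then obtain \<rho> \<rho>' where "rl t = Some (AlgT \<rho>)" "rl t' = Some (AlgT \<rho>')"
        by (auto simp: T_def)
      moreover from this have "\<rho> = \<rho>'"
        using *(3) by simp
      ultimately show "t = t'"
        using tg(4) by blast
    qed
    show "(\<lambda>t. THE \<rho>. rl t = Some (AlgT \<rho>)) ` T \<subseteq> Roles"
      using the tg(6) by (auto simp: T_def)
  qed (rule finite_Roles)
  have cardE: "card Ev \<le> card Evals"
  proof (rule card_inj_on_le [of "\<lambda>t. THE \<rho>. rl t = Some (CondT \<rho>)"])
    have the: "rl t = Some (CondT \<rho>) \<Longrightarrow> (THE \<rho>. rl t = Some (CondT \<rho>)) = \<rho>" for t \<rho>
      by auto
    show "inj_on (\<lambda>t. THE \<rho>. rl t = Some (CondT \<rho>)) Ev"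
    proof (rule inj_onI)
      fix t t'
      assume *: "t \<in> Ev" "t' \<in> Ev" "(THE \<rho>. rl t = Some (CondT \<rho>)) = (THE \<rho>. rl t' = Some (CondT \<rho>))"
      then obtain \<rho> \<rho>' where "rl t = Some (CondT \<rho>)" "rl t' = Some (CondT \<rho>')"
        by (auto simp: Ev_def)
      moreover from this have "\<rho> = \<rho>'"
        using *(3) by simp
      ultimately show "t = t'"
        using tg(4) by blast
    qed
    show "(\<lambda>t. THE \<rho>. rl t = Some (CondT \<rho>)) ` Ev \<subseteq> Evals"
      using the tg(8) by (auto simp: Ev_def)
  qed (rule finite_Evals)
  have alg: "sum (weight \<sigma>) (\<Union>t \<in> T. J t) \<le> card Roles * M"
  proof -
    have "sum (weight \<sigma>) (\<Union>t \<in> T. J t) = (\<Sum>t\<in>T. sum (weight \<sigma>) (J t))"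
      by (rule sum.UNION_disjoint) (auto simp: finT J_def)
    also have "\<dots> \<le> (\<Sum>t\<in>T. M)"
    proof (rule sum_mono)
      fix t
      assume "t \<in> T"
      then obtain \<rho> where rlt: "rl t = Some (AlgT \<rho>)"
        by (auto simp: T_def)
      have "sum (weight \<sigma>) (J t) \<le> (\<Sum>i\<in>J t. 1)"
        by (rule sum_mono) (use coreD(5) [OF core] tg(9) [OF rlt] in \<open>auto simp: dag_ok_def J_def\<close>)
      also have "\<dots> \<le> pc (thr \<sigma> t)"
        using coreD(6) [OF core rlt] by (simp add: alg_ok_def J_def)
      also have "\<dots> \<le> M"
        using coreD(6) [OF core rlt] code_length [OF tg(6) [OF rlt]] by (simp add: alg_ok_def)
      finally show "sum (weight \<sigma>) (J t) \<le> M" .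
    qed
    also have "\<dots> \<le> card Roles * M"
      using \<open>card T \<le> card Roles\<close> by simp
    finally show ?thesis .
  qed
  have ev: "real (sum (weight \<sigma>) (\<Union>e \<in> Ev. eval_nodes \<sigma> e)) \<le> real (card Evals) * w'"
  proof -
    have "sum (weight \<sigma>) (\<Union>e \<in> Ev. eval_nodes \<sigma> e) = (\<Sum>e\<in>Ev. sum (weight \<sigma>) (eval_nodes \<sigma> e))"
      by (rule sum.UNION_disjoint) (auto simp: finT eval_nodes_def)
    then have "real (sum (weight \<sigma>) (\<Union>e \<in> Ev. eval_nodes \<sigma> e)) = (\<Sum>e\<in>Ev. real (work_on \<sigma> (eval_nodes \<sigma> e)))"
      by (simp add: work_on_def)
    also have "\<dots> \<le> (\<Sum>e\<in>Ev. w')"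
    proof (rule sum_mono)
      fix e
      assume "e \<in> Ev"
      then obtain \<rho> where rle: "rl e = Some (CondT \<rho>)"
        by (auto simp: Ev_def)
      show "real (work_on \<sigma> (eval_nodes \<sigma> e)) \<le> w'"
        using cost cond_evaluation [OF core rle] w(1) unfolding evaluation_cost_def
        by (meson order_trans)
    qed
    also have "\<dots> \<le> real (card Evals) * w'"
      using cardE w(2) by (simp add: mult_right_mono)
    finally show ?thesis .
  qed
  have "{..<ninstr \<sigma>} \<subseteq> (\<Union>t \<in> T. J t) \<union> (\<Union>e \<in> Ev. eval_nodes \<sigma> e)"
  proof
    fix i
    assume "i \<in> {..<ninstr \<sigma>}"
    then have i: "i < ninstr \<sigma>" by simp
    have t: "thread_of \<sigma> i < nthr \<sigma>"
      by (rule wf_configD(2) [OF wf i])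
    show "i \<in> (\<Union>t \<in> T. J t) \<union> (\<Union>e \<in> Ev. eval_nodes \<sigma> e)"
    proof (cases "eval_of (thr \<sigma> (thread_of \<sigma> i))")
      case None
      then have "thread_of \<sigma> i \<in> T"
        using tg(2) [OF t] by (simp add: T_def is_alg_def)
      then show ?thesis
        using i by (auto simp: J_def)
    next
      case (Some e)
      then have "e \<in> Ev"
        by (auto simp: Ev_def elim: evaluation_of [OF core wf t])
      then show ?thesis
        using i Some by (auto simp: eval_nodes_def)
    qed
  qed
  then have "dag_work \<sigma> \<le> sum (weight \<sigma>) ((\<Union>t \<in> T. J t) \<union> (\<Union>e \<in> Ev. eval_nodes \<sigma> e))"
    unfolding dag_work_def work_on_def
    by (intro sum_mono2) (auto simp: finT J_def eval_nodes_def)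
  also have "\<dots> \<le> sum (weight \<sigma>) (\<Union>t \<in> T. J t) + sum (weight \<sigma>) (\<Union>e \<in> Ev. eval_nodes \<sigma> e)"
    by (subst sum.union_inter [symmetric]) (auto simp: finT J_def eval_nodes_def)
  finally have "real (dag_work \<sigma>) \<le>
      real (sum (weight \<sigma>) (\<Union>t \<in> T. J t)) + real (sum (weight \<sigma>) (\<Union>e \<in> Ev. eval_nodes \<sigma> e))"
    by linarith
  then show ?thesis
    using alg ev by linarith
qed

text \<open>An instance of \<open>path_weight_bound\<close>, with the instructions of evaluations as
  \<open>U\<close> and the single evaluations as classes; that no edge joins two evaluations is part
  of \<open>evaluates\<close>.\<close>

lemma span_bound:
  assumes core: "core lab rl tau \<sigma>" and wf: "wf_config \<sigma>" and cost: "evaluation_cost xs w s \<sigma>"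
    and eval: "evaluates K P xs \<phi> \<sigma>" and s: "s \<le> s'" "0 \<le> s'"
  shows "real (dag_span \<sigma>) \<le> real TM + 1 + s'"
  unfolding dag_span_def
proof (rule span_le [OF wf])
  let ?U = "{i. \<not> is_alg \<sigma> (thread_of \<sigma> i)}" and ?ev = "\<lambda>i. eval_of (thr \<sigma> (thread_of \<sigma> i))"
  note dag = coreD(5) [OF core, unfolded dag_ok_def]
  fix p
  assume p: "path_in \<sigma> {..<ninstr \<sigma>} p"
  show "real (sum_list (map (weight \<sigma>) p)) \<le> real TM + 1 + s'"
  proof (rule path_weight_bound [where U = ?U and tau = tau and X = X and ev = ?ev, OF _ _ X_TM _ _ s(2) p])
    show "weight \<sigma> i \<le> 1" "tau i \<le> TM" if "i < ninstr \<sigma>" "i \<notin> ?U" for i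
      using dag that by auto
    show "(i \<notin> ?U \<and> j \<notin> ?U \<longrightarrow> tau i < tau j) \<and> (i \<notin> ?U \<and> j \<in> ?U \<longrightarrow> tau i \<le> X) \<and>
        (i \<in> ?U \<and> j \<notin> ?U \<longrightarrow> X < tau j) \<and> (i \<in> ?U \<and> j \<in> ?U \<longrightarrow> ?ev i = ?ev j)"
      if ij: "(i, j) \<in> edges \<sigma>" "i < ninstr \<sigma>" "j < ninstr \<sigma>" for i j
    proof -
      have "?ev i = ?ev j" if "i \<in> ?U" "j \<in> ?U"
      proof -
        obtain e e' where "?ev i = Some e" "?ev j = Some e'"
          using \<open>i \<in> ?U\<close> \<open>j \<in> ?U\<close> by (auto simp: is_alg_def)
        moreover have "e = e'"
          using eval ij calculation unfolding evaluates_def eval_nodes_def by fast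
        ultimately show ?thesis by simp
      qed
      then show ?thesis
        using dag ij(1) by auto
    qed
    fix q e'
    assume q: "path_in \<sigma> {i \<in> ?U. i < ninstr \<sigma> \<and> ?ev i = e'} q"
    then have "hd q \<in> {i \<in> ?U. i < ninstr \<sigma> \<and> ?ev i = e'}"
      unfolding path_in_def by (meson hd_in_set subsetD)
    then obtain e where e: "e' = Some e" "hd q < ninstr \<sigma>" "?ev (hd q) = Some e"
      by (auto simp: is_alg_def)
    obtain \<rho> where rle: "rl e = Some (CondT \<rho>)"
      using evaluation_of [OF core wf wf_configD(2) [OF wf e(2)] e(3)] by blast
    have V: "{i \<in> ?U. i < ninstr \<sigma> \<and> ?ev i = e'} = eval_nodes \<sigma> e"
      by (auto simp: eval_nodes_def e(1) is_alg_def)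
    have "real (sum_list (map (weight \<sigma>) q)) \<le> real (span_on \<sigma> (eval_nodes \<sigma> e))"
      using path_le_span [OF wf _ q [unfolded V]] by (auto simp: eval_nodes_def)
    also have "\<dots> \<le> s'"
      using cost cond_evaluation [OF core rle] s(1) unfolding evaluation_cost_def
      by (meson order_trans)
    finally show "real (sum_list (map (weight \<sigma>) q)) \<le> s'" .
  qed
qed (use s in simp_all)

text \<open>Each time step adds to the work, which \<open>work_bound\<close> limits.\<close>

lemma terminates:
  assumes "\<And>k. time_step K P (\<rho> k) (\<rho> (Suc k))" "\<rho> 0 = init_config m N v"
    and "\<And>k. evaluates K P xs \<phi> (\<rho> k)" "\<And>k. evaluation_cost xs w s (\<rho> k)"
  shows False
proof -
  define B where "B = real (card Roles * M) + real (card Evals) * max w 0"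
  have reach: "(time_step K P)\<^sup>*\<^sup>* (init_config m N v) (\<rho> k)" for k
    by (induction k) (use assms(1,2) in \<open>auto intro: rtranclp.rtrancl_into_rtrancl\<close>)
  have wf: "wf_config (\<rho> k)" for k
    by (rule run_wf [OF reach])
  have "k \<le> dag_work (\<rho> k)" for k
  proof (induction k)
    case (Suc k)
    then show ?case
      using dag_work_time_step [OF wf assms(1), of k] by linarith
  qed simp
  moreover have "real (dag_work (\<rho> k)) \<le> B" for k
  proof -
    obtain lab rl tau where "core lab rl tau (\<rho> k)"
      using run_core [OF reach evaluates_honest [OF assms(3)]] by blast
    from work_bound [OF this wf assms(4), of "max w 0"] show ?thesis
      by (simp add: B_def)
  qed
  ultimately have "real k \<le> B" for k
    by (meson of_nat_mono order_trans)
  moreover obtain k where "B < real k"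
    using reals_Archimedean2 by blast
  ultimately show False
    by (meson not_le)
qed

end

section \<open>The filter algorithm\<close>

text \<open>The algorithm works on three kinds of new nodes:
  \<^item> counters mirroring the input tree, with cells for two children, the number of accepted items and
    the first accepted leaf, the number of accepted items on the left and the first accepted leaf on the
    right; at a leaf, cell 1 holds the item and cell 4 receives the thread of its element of
    the bottom layer;
  \<^item> nodes of the output tree;
  \<^item> elements of a layer, with cells for the subtree, the thread of the next element and the thread of
    the element above (only if this one is its left or only child).\<close>

definition main_code :: "instr list" where
  "main_code = [SetNull 1, BranchEq 0 1 19, Fork 2 (Alg 1) [0], Join 3 2, Join 4 3, RMW 5 4 2 Read,
     Const 6 0, BranchEq 5 6 19, RMW 7 4 3 Read, Const 8 1, Fork 9 (Alg 5) [5, 8],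
     Join 10 9, Arith Minus 11 5 10, Fork 12 (Alg 6) [4, 11, 10], Join 13 12,
     RMW 14 7 4 Read, Fork 15 (Alg 10) [14], Join 16 15, Return 16, Return 1]"

text \<open>The gate's own handle travels down the scan. The value returned, passed up by the scan,
  is the thread that counts at the root.\<close>

definition gate1_code :: "instr list" where
  "gate1_code = [Self 1, Fork 2 (Alg 2) [0, 1], Join 3 2, Return 3]"

text \<open>The handle of the counting thread is returned without being joined: the counting thread
  waits for the gate, which waits for the scan.\<close>

definition s1_code :: "instr list" where
  "s1_code = [RMW 2 0 0 Read, SetNull 3, BranchEq 2 3 10, RMW 4 0 1 Read, Fork 5 (Alg 2) [2, 1],
     Fork 6 (Alg 2) [4, 1], Join 7 5, Join 8 6, Fork 9 (Alg 4) [7, 8], Return 9,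
     RMW 10 0 4 Read, Fork 11 (Alg 3) [10, 1], Return 11]"

text \<open>The result 0 or 1 of the condition doubles as the count of the leaf. Cell 5 repeats cell
  3, since the parent reads the one and the ranking thread the other.\<close>

definition ev_leaf_code :: "instr list" where
  "ev_leaf_code = [Join 2 1, Fork 3 (Cond 0) [0], Join 4 3, New 5, RMW 6 5 1 (Write 0),
     RMW 6 5 2 (Write 4), Const 7 0, BranchEq 4 7 10, RMW 6 5 3 (Write 5),
     RMW 6 5 5 (Write 5), Return 5]"

text \<open>Cells 4 and 5 repeat cell 2 of the left and cell 3 of the right child, whose only reader
  is this thread; the ranking thread needs both as well.\<close>

definition ev_branch_code :: "instr list" where
  "ev_branch_code = [Join 2 0, Join 3 1, New 4, RMW 12 4 0 (Write 2), RMW 12 4 1 (Write 3), RMW 5 2 2 Read,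
     RMW 6 3 2 Read, Arith Plus 7 5 6, RMW 12 4 2 (Write 7), RMW 12 4 4 (Write 5),
     RMW 8 2 3 Read, RMW 9 3 3 Read, RMW 12 4 5 (Write 9), SetNull 10, Move 11 9,
     BranchEq 8 10 17, Move 11 8, RMW 12 4 3 (Write 11), Return 4]"

text \<open>Doubles from 1 up to the largest power of two not exceeding the count. Each doubling
  takes a new thread, as jumps only lead forward.\<close>

definition pow_code :: "instr list" where
  "pow_code = [Arith Plus 2 1 1, BranchLess 0 2 5, Fork 3 (Alg 5) [0, 2], Join 4 3, Return 4, Return 1]"

text \<open>Ends when every accepted leaf holds the thread of its base element; behind this gate an
  element may fetch its right neighbour from the next accepted leaf.\<close>

definition gate2_code :: "instr list" where
  "gate2_code = [Self 3, Const 4 0, SetNull 5, Fork 6 (Alg 7) [0, 4, 5, 1, 2, 3], Join 7 6, Return 7]"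

text \<open>Register 2 holds the first accepted leaf to the right of the subtree; for the left child
  it is replaced by the first accepted leaf under the right sibling, if there is one.\<close>

definition d_code :: "instr list" where
  "d_code = [SetNull 6, RMW 7 0 0 Read, BranchEq 7 6 15, RMW 8 0 1 Read, RMW 9 0 4 Read,
     RMW 10 0 5 Read, Move 11 2, BranchEq 10 6 9, Move 11 10,
     Fork 12 (Alg 7) [7, 1, 11, 3, 4, 5], Arith Plus 13 1 9,
     Fork 14 (Alg 7) [8, 13, 2, 3, 4, 5], Join 15 12, Join 16 14, Return 6, RMW 17 0 5 Read,
     BranchEq 17 6 19, Fork 18 (Alg 8) [0, 1, 2, 3, 4, 5], RMW 19 0 4 (Write 18), Return 6]"

text \<open>Indices below \<open>2 * r\<close> are paired: even ones fork the element above at half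
  the index, odd ones are picked up by it. The others move up alone, to index \<open>j - r\<close>;
  register 21 tells the element above which case applies.\<close>

definition base_code :: "instr list" where
  "base_code = [Join 6 5, SetNull 7, Move 8 7, BranchEq 2 7 5, RMW 8 2 4 Read, RMW 9 0 1 Read, New 10,
     Const 11 0, Const 12 1, RMW 19 10 2 (Write 11), RMW 19 10 3 (Write 12),
     RMW 19 10 4 (Write 9), RMW 19 10 5 (Write 9), New 13, RMW 19 13 0 (Write 10),
     RMW 19 13 1 (Write 8), Arith Plus 14 3 3, Self 20, BranchLess 1 14 22,
     Arith Minus 15 1 3, Move 21 11, Jump 27, Const 17 2, Arith Mod 18 1 17,
     BranchEq 18 12 29, Arith Div 15 1 17, Move 21 12, Fork 16 (Alg 9) [20, 15, 4, 21],
     RMW 19 13 2 (Write 16), Return 13]"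

text \<open>The thread that forks an element does not know its right neighbour. This is found one
  layer down: the next child is the left or only child of the neighbour and has recorded its thread
  in cell 2. Register 3 is 0 exactly for an element with a single child.\<close>

definition level_code :: "instr list" where
  "level_code = [Join 4 0, RMW 5 4 0 Read, RMW 6 4 1 Read, Const 7 0, Const 8 1, SetNull 9,
     BranchEq 3 7 28, Join 10 6, RMW 11 10 0 Read, RMW 6 10 1 Read, New 12,
     RMW 30 12 0 (Write 5), RMW 30 12 1 (Write 11), RMW 13 5 2 Read, RMW 14 11 2 Read,
     BranchLess 14 13 17, Move 13 14, Arith Plus 15 13 8, RMW 30 12 2 (Write 15),
     RMW 16 5 3 Read, RMW 17 11 3 Read, Arith Plus 18 16 17, RMW 30 12 3 (Write 18),
     RMW 19 5 4 Read, RMW 30 12 4 (Write 19), RMW 20 11 5 Read, RMW 30 12 5 (Write 20),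
     Move 5 12, Move 21 9, BranchEq 6 9 32, Join 22 6, RMW 21 22 2 Read, New 23,
     RMW 30 23 0 (Write 5), RMW 30 23 1 (Write 21), BranchEq 2 8 44, Const 24 2,
     Arith Mod 25 1 24, BranchEq 25 8 44, Arith Div 26 1 24, Arith Div 27 2 24, Self 28,
     Fork 29 (Alg 9) [28, 26, 27, 8], RMW 30 23 2 (Write 29), Return 23]"

text \<open>Only an element knows the thread above it, so the root is reached by climbing the
  leftmost elements.\<close>

definition walk_code :: "instr list" where
  "walk_code = [Join 1 0, RMW 2 1 2 Read, SetNull 3, BranchEq 2 3 7, Fork 4 (Alg 10) [2], Join 5 4,
     Return 5, RMW 6 1 0 Read, Return 6]"

definition filter_code :: "instr list list" where
  "filter_code = [main_code, gate1_code, s1_code, ev_leaf_code, ev_branch_code, pow_code, gate2_code, d_code, base_code, level_code, walk_code]"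

section \<open>Static names, contents and stamps\<close>

type_synonym path = "bool list"

text \<open>\<open>Elem e j\<close> is the element with index \<open>j\<close> of layer
  \<open>e\<close>: layer 0 has the accepted leaves, layer 1 the \<open>2 ^ d\<close> subtrees,
  layer \<open>Suc d\<close> the root.\<close>

datatype role = Main | Gate1 | Scan path | Eval path | Pow nat | Gate2 | Rank path | Elem nat nat | Walk nat
datatype label = Rec path | TN nat nat | ER nat nat

type_synonym sval = "(role, label) aval"
type_synonym sfact = "(role, label) fact"

abbreviation IV :: "int \<Rightarrow> sval" where
  "IV k \<equiv> Raw (IntV k)"

fun kept :: "(val \<Rightarrow> bool) \<Rightarrow> val batch_tree \<Rightarrow> path \<Rightarrow> path list" where
  "kept \<phi> (Leaf x) p = (if \<phi> x then [p] else [])"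
| "kept \<phi> (Branch l r) p = kept \<phi> l (False # p) @ kept \<phi> r (True # p)"

fun is_leaf :: "val batch_tree \<Rightarrow> bool" where
  "is_leaf (Leaf x) = True"
| "is_leaf (Branch l r) = False"

fun leaf_val :: "val batch_tree \<Rightarrow> val" where
  "leaf_val (Leaf x) = x"
| "leaf_val (Branch l r) = Null"

text \<open>Paths are read from right to left; \<open>False\<close> stands for left.\<close>

locale filt =
  fixes K :: nat and m :: "nat \<Rightarrow> nat \<Rightarrow> val" and N :: nat and \<phi> :: "val \<Rightarrow> bool"
    and t0 :: "val batch_tree" and a0 :: nat and v :: val
begin

fun sub :: "path \<Rightarrow> val batch_tree" where
  "sub [] = t0"
| "sub (b # p) = (case sub p of Leaf x \<Rightarrow> Leaf x | Branch l r \<Rightarrow> if b then r else l)"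

fun valid :: "path \<Rightarrow> bool" where
  "valid [] \<longleftrightarrow> True"
| "valid (b # p) \<longleftrightarrow> valid p \<and> \<not> is_leaf (sub p)"

fun addr :: "path \<Rightarrow> nat" where
  "addr [] = a0"
| "addr (b # p) = (case m (addr p) (if b then 1 else 0) of NodeP a \<Rightarrow> a | _ \<Rightarrow> 0)"

definition cnt :: "path \<Rightarrow> nat" where
  "cnt p = length (filter \<phi> (leaves (sub p)))"

fun rank :: "path \<Rightarrow> nat" where
  "rank [] = 0"
| "rank (b # p) = (if b then rank p + cnt (False # p) else rank p)"

definition k :: nat where
  "k = cnt []"

definition kl :: "path list" where
  "kl = kept \<phi> t0 []"

text \<open>The binary logarithm of \<open>k\<close> rounded down, and 0 if
  \<open>k = 0\<close>.\<close>

definition d :: nat where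
  "d = (LEAST d. k < 2 ^ Suc d)"

definition r :: nat where
  "r = k - 2 ^ d"

definition H :: nat where
  "H = height t0"

definition leafrec :: "nat \<Rightarrow> sval" where
  "leafrec i = (if i < k then Nd (Rec (kl ! i)) else Raw Null)"

definition first :: "path \<Rightarrow> sval" where
  "first p = (if 0 < cnt p then leafrec (rank p) else Raw Null)"

definition nxt :: "path \<Rightarrow> sval" where
  "nxt p = leafrec (rank p + cnt p)"

definition layer :: "nat \<Rightarrow> nat" where
  "layer e = (if e = 0 then k else 2 ^ (Suc d - e))"

text \<open>Here and in \<open>lo\<close>, \<open>j\<close> is an index in layer
  \<open>Suc e\<close>: \<open>lo\<close> gives the left or only child in layer \<open>e\<close>,
  and \<open>up\<close> leads back. The first \<open>r\<close> parents use up \<open>2 * r\<close>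
  leaves, so a parent \<open>j\<close> from \<open>r\<close> on has the single child
  \<open>2 * r + (j - r) = j + r\<close>. Left and only children are marked by
  \<open>has_up\<close>.\<close>

definition single :: "nat \<Rightarrow> nat \<Rightarrow> bool" where
  "single e j \<longleftrightarrow> e = 0 \<and> r \<le> j"

definition lo :: "nat \<Rightarrow> nat \<Rightarrow> nat" where
  "lo e j = (if single e j then j + r else 2 * j)"

definition up :: "nat \<Rightarrow> nat \<Rightarrow> nat" where
  "up e j = (if e = 0 \<and> 2 * r \<le> j then j - r else j div 2)"

definition has_up :: "nat \<Rightarrow> nat \<Rightarrow> bool" where
  "has_up e j \<longleftrightarrow> e \<le> d \<and> (e = 0 \<and> 2 * r \<le> j \<or> even j)"

text \<open>An element with a single child passes on the subtree of the child, so its tree node is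
  that of the leaf.\<close>

fun tl_ix :: "nat \<Rightarrow> nat \<Rightarrow> nat \<times> nat" where
  "tl_ix 0 j = (0, j)"
| "tl_ix (Suc e) j = (if single e j then (0, j + r) else (Suc e, j))"

definition tlab :: "nat \<Rightarrow> nat \<Rightarrow> label" where
  "tlab e j = (case tl_ix e j of (e', j') \<Rightarrow> TN e' j')"

definition tcre :: "nat \<Rightarrow> nat \<Rightarrow> role" where
  "tcre e j = (case tl_ix e j of (e', j') \<Rightarrow> Elem e' j')"

definition item :: "nat \<Rightarrow> val" where
  "item i = leaf_val (sub (kl ! i))"

fun tr :: "nat \<Rightarrow> nat \<Rightarrow> val batch_tree" where
  "tr 0 j = Leaf (item j)"
| "tr (Suc e) j = (if single e j then Leaf (item (j + r)) else Branch (tr e (2 * j)) (tr e (Suc (2 * j))))"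

fun tfacts :: "nat \<Rightarrow> nat \<Rightarrow> sfact set" where
  "tfacts 0 j = range (Filled (TN 0 j))"
| "tfacts (Suc e) j = (if single e j then range (Filled (TN 0 (j + r)))
     else range (Filled (TN (Suc e) j)) \<union> tfacts e (2 * j) \<union> tfacts e (Suc (2 * j)))"

definition below :: "path \<Rightarrow> path set" where
  "below p = {q. valid q \<and> (\<exists>s. q = s @ p)}"

definition scan_facts :: "path \<Rightarrow> sfact set" where
  "scan_facts p = (Ended \<circ> Scan) ` below p"

text \<open>Cell 4 of a leaf is exempt, being left to the ranking thread.\<close>

definition eval_facts :: "path \<Rightarrow> sfact set" where
  "eval_facts p = (Ended \<circ> Eval) ` below p \<union>
     {Filled (Rec q) c | q c. q \<in> below p \<and> (c \<noteq> 4 \<or> \<not> is_leaf (sub q))}"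

definition rank_facts :: "path \<Rightarrow> sfact set" where
  "rank_facts p = (Ended \<circ> Rank) ` {q \<in> below p. is_leaf (sub q) \<and> 0 < cnt q} \<union>
     {Filled (Rec q) 4 | q. q \<in> below p \<and> is_leaf (sub q) \<and> 0 < cnt q}"

fun prc :: "role \<Rightarrow> nat" where
  "prc Main = 0" | "prc Gate1 = 1" | "prc (Scan p) = 2"
| "prc (Eval p) = (if is_leaf (sub p) then 3 else 4)"
| "prc (Pow e) = 5" | "prc Gate2 = 6" | "prc (Rank p) = 7"
| "prc (Elem e j) = (if e = 0 then 8 else 9)" | "prc (Walk e) = 10"

fun ain :: "role \<Rightarrow> sval list" where
  "ain Main = [Raw v]"
| "ain Gate1 = [Raw (NodeP a0)]"
| "ain (Scan p) = [Raw (NodeP (addr p)), Th Gate1]"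
| "ain (Eval p) = (if is_leaf (sub p) then [Raw (leaf_val (sub p)), Th Gate1]
     else [Th (Eval (False # p)), Th (Eval (True # p))])"
| "ain (Pow e) = [IV (int k), IV (2 ^ e)]"
| "ain Gate2 = [Nd (Rec []), IV (int r), IV (2 ^ d)]"
| "ain (Rank p) = [Nd (Rec p), IV (int (rank p)), nxt p, IV (int r), IV (2 ^ d), Th Gate2]"
| "ain (Elem e j) = (if e = 0
     then [Nd (Rec (kl ! j)), IV (int j), leafrec (Suc j), IV (int r), IV (2 ^ d), Th Gate2]
     else [Th (Elem (e - 1) (lo (e - 1) j)), IV (int j), IV (2 ^ (Suc d - e)),
       IV (if single (e - 1) j then 0 else 1)])"
| "ain (Walk e) = [Th (Elem e 0)]"

text \<open>The numbers in \<open>chd\<close> and \<open>par\<close> are positions of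
  \<open>Fork\<close> instructions in the code of the forking role, those in \<open>nlab\<close> and
  \<open>cre\<close> positions of \<open>New\<close>.\<close>

fun chd :: "role \<Rightarrow> nat \<Rightarrow> role" where
  "chd Main i = (if i = 2 then Gate1 else if i = 10 then Pow 0 else if i = 13 then Gate2 else Walk 0)"
| "chd Gate1 i = Scan []"
| "chd (Scan p) i = (if i = 4 then Scan (False # p) else if i = 5 then Scan (True # p) else Eval p)"
| "chd (Pow e) i = Pow (Suc e)"
| "chd Gate2 i = Rank []"
| "chd (Rank p) i = (if i = 9 then Rank (False # p) else if i = 11 then Rank (True # p)
     else Elem 0 (rank p))"
| "chd (Elem e j) i = Elem (Suc e) (up e j)"
| "chd (Walk e) i = Walk (Suc e)"
| "chd (Eval p) i = Main"

fun par :: "role \<Rightarrow> (role \<times> nat) option" where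
  "par Main = None"
| "par Gate1 = Some (Main, 2)"
| "par (Scan p) = Some (case p of [] \<Rightarrow> (Gate1, 1) | b # q \<Rightarrow> (Scan q, if b then 5 else 4))"
| "par (Eval p) = Some (Scan p, if is_leaf (sub p) then 11 else 8)"
| "par (Pow e) = Some (case e of 0 \<Rightarrow> (Main, 10) | Suc e' \<Rightarrow> (Pow e', 2))"
| "par Gate2 = Some (Main, 13)"
| "par (Rank p) = Some (case p of [] \<Rightarrow> (Gate2, 3) | b # q \<Rightarrow> (Rank q, if b then 11 else 9))"
| "par (Elem e j) = Some (case e of 0 \<Rightarrow> (Rank (kl ! j), 17)
     | Suc e' \<Rightarrow> (Elem e' (lo e' j), if e' = 0 then 27 else 42))"
| "par (Walk e) = Some (case e of 0 \<Rightarrow> (Main, 16) | Suc e' \<Rightarrow> (Walk e', 4))"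

fun nlab :: "role \<Rightarrow> nat \<Rightarrow> label" where
  "nlab (Eval p) i = Rec p"
| "nlab (Elem e j) i = (if i = (if e = 0 then 6 else 10) then TN e j else ER e j)"
| "nlab _ i = Rec []"

fun cre :: "label \<Rightarrow> role \<times> nat" where
  "cre (Rec p) = (Eval p, if is_leaf (sub p) then 3 else 2)"
| "cre (TN e j) = (Elem e j, if e = 0 then 6 else 10)"
| "cre (ER e j) = (Elem e j, if e = 0 then 13 else 32)"

text \<open>The position of the fork of the condition in \<open>ev_leaf_code\<close>.\<close>

definition cpc :: "role \<Rightarrow> nat" where
  "cpc \<rho> = 1"

fun itm :: "role \<Rightarrow> val" where
  "itm (Eval p) = leaf_val (sub p)"
| "itm _ = Null"

fun MV :: "label \<Rightarrow> nat \<Rightarrow> sval" where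
  "MV (Rec p) c = (if is_leaf (sub p)
     then (if c = 1 then Raw (leaf_val (sub p))
       else if c = 2 then IV (if \<phi> (leaf_val (sub p)) then 1 else 0)
       else if c = 3 \<or> c = 5 then (if \<phi> (leaf_val (sub p)) then Nd (Rec p) else Raw Null)
       else if c = 4 \<and> \<phi> (leaf_val (sub p)) then Th (Elem 0 (rank p)) else Raw Null)
     else (if c = 0 then Nd (Rec (False # p)) else if c = 1 then Nd (Rec (True # p))
       else if c = 2 then IV (int (cnt p)) else if c = 3 then first p
       else if c = 4 then IV (int (cnt (False # p)))
       else if c = 5 then first (True # p) else Raw Null))"
| "MV (TN e j) c =
     (if c = 0 then (if e = 0 then Raw Null else Nd (tlab (e - 1) (2 * j)))
      else if c = 1 then (if e = 0 then Raw Null else Nd (tlab (e - 1) (Suc (2 * j))))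
      else if c = 2 then IV (int (height (tr e j)))
      else if c = 3 then IV (int (length (leaves (tr e j))))
      else if c = 4 then Raw (hd (leaves (tr e j)))
      else if c = 5 then Raw (last (leaves (tr e j))) else Raw Null)"
| "MV (ER e j) c =
     (if c = 0 then Nd (tlab e j)
      else if c = 1 then (if Suc j < layer e then Th (Elem e (Suc j)) else Raw Null)
      else if c = 2 then (if has_up e j then Th (Elem (Suc e) (up e j)) else Raw Null)
      else Raw Null)"

fun ret :: "role \<Rightarrow> sval" where
  "ret Main = (if k = 0 then Raw Null else Nd (tlab (Suc d) 0))"
| "ret Gate1 = Th (Eval [])"
| "ret (Scan p) = Th (Eval p)"
| "ret (Eval p) = Nd (Rec p)"
| "ret (Pow e) = IV (2 ^ d)"
| "ret Gate2 = Raw Null"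
| "ret (Rank p) = Raw Null"
| "ret (Elem e j) = Nd (ER e j)"
| "ret (Walk e) = Nd (tlab (Suc d) 0)"

text \<open>An element also vouches for the end of the role that built its tree node: with a single
  child this is another role, and a reader of the node must know that its writer has ended.\<close>

fun KD :: "role \<Rightarrow> sfact set" where
  "KD Main = (if k = 0 then {} else tfacts (Suc d) 0)"
| "KD Gate1 = scan_facts []"
| "KD (Scan p) = scan_facts p"
| "KD (Eval p) = eval_facts p"
| "KD (Pow e) = {}"
| "KD Gate2 = rank_facts []"
| "KD (Rank p) = rank_facts p"
| "KD (Elem e j) = range (Filled (ER e j)) \<union> {Ended (tcre e j)} \<union> tfacts e j"
| "KD (Walk e) = tfacts (Suc d) 0"

text \<open>What counting has established is handed from \<open>Main\<close> through
  \<open>Gate2\<close> and the ranking threads to the base elements.\<close>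

fun K0 :: "role \<Rightarrow> sfact set" where
  "K0 Gate2 = eval_facts []"
| "K0 (Rank p) = eval_facts []"
| "K0 (Elem e j) = (if e = 0 then eval_facts [] else {})"
| "K0 _ = {}"

fun wr :: "label \<Rightarrow> nat \<Rightarrow> role" where
  "wr (Rec p) c = (if c = 4 \<and> is_leaf (sub p) then Rank p else Eval p)"
| "wr (TN e j) c = Elem e j"
| "wr (ER e j) c = Elem e j"

text \<open>The node of an unpaired leaf passes through layer 1 and is first read in layer 2. Cell 2
  of an element is read from the left: by the element above its predecessor, or by the walk for
  index 0.\<close>

fun rd :: "label \<Rightarrow> nat \<Rightarrow> role" where
  "rd (Rec p) c = (if c = 2 \<or> c = 3 then (case p of [] \<Rightarrow> Main | b # q \<Rightarrow> Eval q)
     else if is_leaf (sub p) \<and> c = 1 then Elem 0 (rank p)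
     else if is_leaf (sub p) \<and> c = 4 then (if rank p = 0 then Main else Elem 0 (rank p - 1))
     else Rank p)"
| "rd (TN e j) c = (if e = 0 \<and> 2 * r \<le> j then Elem 2 ((j - r) div 2) else Elem (Suc e) (j div 2))"
| "rd (ER e j) c = (if c = 2 then (if j = 0 then Walk e else Elem (Suc e) (up e (j - 1)))
     else if e = Suc d then Walk e else Elem (Suc e) (up e j))"

definition old :: "role \<Rightarrow> nat \<Rightarrow> bool" where
  "old \<rho> a \<longleftrightarrow> (\<exists>p. valid p \<and> \<rho> = Scan p \<and> a = addr p)"

text \<open>Stamps advance in units of 64, which is more than the length of any code.\<close>

definition Q :: nat where
  "Q = 3 * H + 11 + 2 * d"

text \<open>In units of 64, the chain \<open>Pow\<close> ends at \<open>3 * H + 9 + 2 * d\<close>,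
  before \<open>Gate2\<close> starts at \<open>Q\<close>, and the last layer at
  \<open>Q + 2 * H + 7 + d\<close>, before the walk starts at \<open>R\<close>.\<close>

definition R :: nat where
  "R = Q + 2 * H + 8 + d"

fun start :: "role \<Rightarrow> nat" where
  "start Main = 0"
| "start Gate1 = 64"
| "start (Scan p) = 64 * (2 + length p)"
| "start (Eval p) = 64 * (2 * H + 5)"
| "start (Pow e) = 64 * (3 * H + 8 + e)"
| "start Gate2 = 64 * Q"
| "start (Rank p) = 64 * (Q + 1 + length p)"
| "start (Elem e j) = 64 * (Q + 2 * H + 5 + e)"
| "start (Walk e) = 64 * (R + e)"

text \<open>Where a thread joins its own recursive calls, each level costs a unit on the way down
  and one on the way back, hence the \<open>2 * height\<close> of the tree recursions and the
  \<open>2 * d - e\<close> of the chains.\<close>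

fun fin :: "role \<Rightarrow> nat" where
  "fin Main = 64 * (R + 2 * d + 5)"
| "fin Gate1 = 64 * (2 * H + 4)"
| "fin (Scan p) = 64 * (3 + length p + 2 * height (sub p))"
| "fin (Eval p) = 64 * (2 * H + 6 + height (sub p))"
| "fin (Pow e) = 64 * (3 * H + 9 + 2 * d - e)"
| "fin Gate2 = 64 * (Q + 3 + 2 * H)"
| "fin (Rank p) = 64 * (Q + 2 + length p + 2 * height (sub p))"
| "fin (Elem e j) = 64 * (Q + 2 * H + 6 + e)"
| "fin (Walk e) = 64 * (R + 4 + 2 * d - e)"

text \<open>Counting threads at leaves start at \<open>64 * (2 * H + 5)\<close>, after the end of
  \<open>Gate1\<close>, and fork their condition one instruction later; the 8 leaves room for
  that.\<close>

definition X :: nat where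
  "X = 64 * (2 * H + 5) + 8"

definition paths :: "path set" where
  "paths = {p. valid p}"

definition Roles :: "role set" where
  "Roles = {Main, Gate1} \<union> Scan ` paths \<union> Eval ` paths \<union>
     (if k = 0 then {} else Pow ` {..d} \<union> {Gate2} \<union> Rank ` paths \<union>
        {Elem e j | e j. e \<le> Suc d \<and> j < layer e} \<union> Walk ` {..Suc d})"

definition Evals :: "role set" where
  "Evals = Eval ` {p. valid p \<and> is_leaf (sub p)}"

sublocale plan_sig K filter_code m N \<phi> itm Roles Evals prc ain chd par nlab cre cpc MV ret KD K0 wr rd
  old start fin X .

end

section \<open>Paths in the input tree and ranks of accepted leaves\<close>

lemma length_kept: "length (kept \<phi> t p) = length (filter \<phi> (leaves t))"
  by (induction t arbitrary: p) auto

context filt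
begin

lemma below_self: "valid p \<Longrightarrow> p \<in> below p"
  unfolding below_def by (auto intro: exI [of _ "[]"])

lemma below_cases:
  assumes "q \<in> below p"
  obtains "q = p" | b where "q \<in> below (b # p)"
proof -
  from assms obtain s where s: "q = s @ p" "valid q"
    by (auto simp: below_def)
  show ?thesis
  proof (cases s rule: rev_cases)
    case (snoc s' b)
    with s have "q \<in> below (b # p)"
      by (auto simp: below_def)
    with that show ?thesis by blast
  qed (use s that in simp)
qed

lemma valid_append: "valid (s @ p) \<Longrightarrow> valid p"
  by (induction s) auto

lemma below_leaf: "valid p \<Longrightarrow> is_leaf (sub p) \<Longrightarrow> below p = {p}"
  using below_self valid_append unfolding below_def
  by (auto elim: below_cases [unfolded below_def]) (metis append.assoc append_Cons append_Nil rev_exhaust valid.simps(2) valid_append)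

lemma below_branch:
  assumes "valid p" "\<not> is_leaf (sub p)"
  shows "below p = insert p (below (False # p) \<union> below (True # p))"
proof
  show "below p \<subseteq> insert p (below (False # p) \<union> below (True # p))"
  proof
    fix q
    assume "q \<in> below p"
    then show "q \<in> insert p (below (False # p) \<union> below (True # p))"
    proof (cases rule: below_cases)
      case (2 b)
      then show ?thesis by (cases b) auto
    qed simp
  qed
  show "insert p (below (False # p) \<union> below (True # p)) \<subseteq> below p"
    using below_self [OF assms(1)] by (auto simp: below_def)
qed

lemma below_Nil: "below [] = paths"
  by (auto simp: below_def paths_def)

lemma branchE:
  assumes "\<not> is_leaf (sub p)"
  obtains l r where "sub p = Branch l r" "sub (False # p) = l" "sub (True # p) = r"
  using assms by (cases "sub p") auto

lemma leafE:
  assumes "is_leaf (sub p)"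
  shows "sub p = Leaf (leaf_val (sub p))"
  using assms by (cases "sub p") auto

lemma depth: "valid p \<Longrightarrow> length p + height (sub p) \<le> H"
proof (induction p)
  case (Cons b p)
  then obtain l r where "sub p = Branch l r"
    by (auto elim: branchE)
  then show ?case
    using Cons by auto
qed (simp add: H_def)

lemma cnt_branch: "\<not> is_leaf (sub p) \<Longrightarrow> cnt p = cnt (False # p) + cnt (True # p)"
  by (cases "sub p") (auto simp: cnt_def)

lemma cnt_leaf: "is_leaf (sub p) \<Longrightarrow> cnt p = (if \<phi> (leaf_val (sub p)) then 1 else 0)"
  using leafE [of p] by (cases "sub p") (auto simp: cnt_def)

lemma rank_cnt: "valid p \<Longrightarrow> rank p + cnt p \<le> k"
proof (induction p)
  case (Cons b p)
  then show ?case
    using cnt_branch [of p] by (cases b) auto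
qed (simp add: k_def)

text \<open>Ranks count the accepted leaves further left, so those under \<open>p\<close> are
  consecutive in \<open>kl\<close>. This ties the path names of leaves to their indices in layer
  0.\<close>

lemma kept_segment: "valid p \<Longrightarrow> kept \<phi> (sub p) p = take (cnt p) (drop (rank p) kl)"
proof (induction p)
  case Nil
  have "length kl = cnt []"
    by (simp add: kl_def cnt_def length_kept)
  then show ?case
    by (simp add: kl_def)
next
  case (Cons b p)
  then obtain l r where lr: "sub p = Branch l r" "sub (False # p) = l" "sub (True # p) = r"
    by (auto elim: branchE)
  have c: "cnt p = cnt (False # p) + cnt (True # p)"
    using Cons by (simp add: cnt_branch)
  have eq: "kept \<phi> l (False # p) @ kept \<phi> r (True # p) = take (cnt p) (drop (rank p) kl)"
    using Cons lr by simp
  have len: "length (kept \<phi> l (False # p)) = cnt (False # p)"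
    using lr by (simp add: cnt_def length_kept)
  have "kept \<phi> l (False # p) = take (cnt (False # p)) (take (cnt p) (drop (rank p) kl))"
    using len unfolding eq [symmetric] by simp
  moreover have "kept \<phi> r (True # p) = drop (cnt (False # p)) (take (cnt p) (drop (rank p) kl))"
    using len unfolding eq [symmetric] by simp
  ultimately show ?case
    using c lr by (cases b) (simp_all add: drop_take add.commute min_def)
qed

lemma length_kl: "length kl = k"
  by (simp add: kl_def k_def cnt_def length_kept)

lemma kl_rank:
  assumes "valid p" "is_leaf (sub p)" "\<phi> (leaf_val (sub p))"
  shows "rank p < k" "kl ! rank p = p"
proof -
  have c: "cnt p = 1"
    using assms by (simp add: cnt_leaf)
  then show less: "rank p < k"
    using rank_cnt [OF assms(1)] by simp
  have "take 1 (drop (rank p) kl) = [p]"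
    using kept_segment [OF assms(1)] c assms leafE [OF assms(2)] by (metis kept.simps(1))
  then show "kl ! rank p = p"
    using less length_kl by (metis Cons_nth_drop_Suc One_nat_def list.inject take_Suc_Cons take0)
qed

lemma kept_props:
  "valid p \<Longrightarrow> sub p = t \<Longrightarrow> (\<forall>q \<in> set (kept \<phi> t p). valid q \<and> is_leaf (sub q) \<and> \<phi> (leaf_val (sub q))) \<and>
     map rank (kept \<phi> t p) = [rank p ..< rank p + length (filter \<phi> (leaves t))] \<and>
     map (leaf_val \<circ> sub) (kept \<phi> t p) = filter \<phi> (leaves t)"
proof (induction t arbitrary: p)
  case (Branch l r)
  have v: "valid (b # p)" for b
    using Branch.prems by simp
  have s: "sub (False # p) = l" "sub (True # p) = r"
    using Branch.prems by simp_all
  have c: "cnt (False # p) = length (filter \<phi> (leaves l))"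
    using s by (simp add: cnt_def)
  note IH = Branch.IH(1) [OF v s(1)] Branch.IH(2) [OF v s(2)]
  show ?case
    using IH c upt_add_eq_append [of "rank p" "rank p + length (filter \<phi> (leaves l))" "length (filter \<phi> (leaves r))"]
    by (auto simp: add.assoc)
qed auto

lemma kl_props:
  assumes "i < k"
  shows "valid (kl ! i)" "is_leaf (sub (kl ! i))" "\<phi> (leaf_val (sub (kl ! i)))" "rank (kl ! i) = i"
proof -
  note kp = kept_props [of "[]" t0, folded kl_def]
  have "kl ! i \<in> set kl"
    using assms length_kl by simp
  then show "valid (kl ! i)" "is_leaf (sub (kl ! i))" "\<phi> (leaf_val (sub (kl ! i)))"
    using kp by auto
  have "map rank kl ! i = i"
    using kp assms by (simp add: k_def cnt_def)
  then show "rank (kl ! i) = i"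
    using assms length_kl by simp
qed

lemma items_kl: "map item [0..<k] = filter \<phi> (leaves t0)"
proof -
  have "map item [0..<k] = map (leaf_val \<circ> sub) kl"
    by (rule nth_equalityI) (auto simp: length_kl item_def)
  then show ?thesis
    using kept_props [of "[]" t0, folded kl_def] by simp
qed

text \<open>A full binary tree with n leaves has 2n - 1 nodes; listing them yields finiteness and
  the cardinality bound together.\<close>

lemma paths_list:
  "valid p \<Longrightarrow> \<exists>ps. below p \<subseteq> set ps \<and> Suc (length ps) = 2 * length (leaves (sub p))"
proof (induction "sub p" arbitrary: p)
  case (Leaf x)
  then show ?case
    by (intro exI [of _ "[p]"]) (simp add: below_leaf flip: Leaf.hyps)
next
  case (Branch l r)
  have v: "valid (b # p)" for b
    using Branch.prems Branch.hyps(3) by (metis is_leaf.simps(2) valid.simps(2))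
  have s: "l = sub (False # p)" "r = sub (True # p)"
    by (simp_all flip: Branch.hyps(3))
  have branch: "sub p = Branch l r" "\<not> is_leaf (sub p)"
    by (simp_all flip: Branch.hyps(3))
  obtain ps1 where "below (False # p) \<subseteq> set ps1" "Suc (length ps1) = 2 * length (leaves l)"
    using Branch.hyps(1) [OF s(1) v] unfolding s(1) [symmetric] by blast
  moreover obtain ps2 where "below (True # p) \<subseteq> set ps2" "Suc (length ps2) = 2 * length (leaves r)"
    using Branch.hyps(2) [OF s(2) v] unfolding s(2) [symmetric] by blast
  moreover have "below p = insert p (below (False # p) \<union> below (True # p))"
    by (rule below_branch [OF Branch.prems branch(2)])
  ultimately show ?case
    by (intro exI [of _ "p # ps1 @ ps2"]) (auto simp: branch(1))
qed

lemma card_paths: "finite paths" "card paths \<le> 2 * length (leaves t0)"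
proof -
  obtain ps where ps: "paths \<subseteq> set ps" "Suc (length ps) = 2 * length (leaves t0)"
    using paths_list [of "[]"] by (auto simp: below_Nil)
  show "finite paths"
    using ps(1) finite_subset by blast
  have "card paths \<le> card (set ps)"
    using ps(1) by (simp add: card_mono)
  also have "\<dots> \<le> length ps"
    by (rule card_length)
  finally show "card paths \<le> 2 * length (leaves t0)"
    using ps(2) by simp
qed

lemma leaf_paths_list:
  "valid p \<Longrightarrow> \<exists>ps. {q \<in> below p. is_leaf (sub q)} \<subseteq> set ps \<and> length ps = length (leaves (sub p))"
proof (induction "sub p" arbitrary: p)
  case (Leaf x)
  have "is_leaf (sub p)"
    by (simp flip: Leaf.hyps)
  with below_leaf [OF Leaf.prems this] show ?case
    by (intro exI [of _ "[p]"]) (auto simp flip: Leaf.hyps)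
next
  case (Branch l r)
  have v: "valid (b # p)" for b
    using Branch.prems Branch.hyps(3) by (metis is_leaf.simps(2) valid.simps(2))
  have s: "l = sub (False # p)" "r = sub (True # p)"
    by (simp_all flip: Branch.hyps(3))
  have branch: "sub p = Branch l r" "\<not> is_leaf (sub p)"
    by (simp_all flip: Branch.hyps(3))
  obtain ps1 where "{q \<in> below (False # p). is_leaf (sub q)} \<subseteq> set ps1" "length ps1 = length (leaves l)"
    using Branch.hyps(1) [OF s(1) v] unfolding s(1) [symmetric] by blast
  moreover obtain ps2 where "{q \<in> below (True # p). is_leaf (sub q)} \<subseteq> set ps2" "length ps2 = length (leaves r)"
    using Branch.hyps(2) [OF s(2) v] unfolding s(2) [symmetric] by blast
  moreover have "below p = insert p (below (False # p) \<union> below (True # p))"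
    by (rule below_branch [OF Branch.prems branch(2)])
  ultimately show ?case
    by (intro exI [of _ "ps1 @ ps2"]) (auto simp: branch(1))
qed

lemma card_Evals: "finite Evals" "card Evals \<le> length (leaves t0)"
proof -
  have E: "Evals = Eval ` {q \<in> below []. is_leaf (sub q)}"
    by (auto simp: Evals_def below_Nil paths_def)
  obtain ps where ps: "{q \<in> below []. is_leaf (sub q)} \<subseteq> set ps" "length ps = length (leaves t0)"
    using leaf_paths_list [of "[]"] by auto
  have fin: "finite {q \<in> below []. is_leaf (sub q)}"
    using ps(1) finite_subset by blast
  then show "finite Evals"
    by (simp add: E)
  have "card Evals \<le> card {q \<in> below []. is_leaf (sub q)}"
    unfolding E by (rule card_image_le [OF fin])
  also have "\<dots> \<le> card (set ps)"
    using ps(1) by (simp add: card_mono)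
  also have "\<dots> \<le> length ps"
    by (rule card_length)
  finally show "card Evals \<le> length (leaves t0)"
    using ps(2) by simp
qed

section \<open>Layers of the output tree\<close>

lemma k_bounds:
  assumes "0 < k"
  shows "2 ^ d \<le> k" "k < 2 ^ Suc d" "e < d \<Longrightarrow> 2 ^ Suc e \<le> k" "r < 2 ^ d" "k = 2 ^ d + r"
proof -
  show 2: "k < 2 ^ Suc d"
    unfolding d_def by (rule LeastI [of _ k]) (simp add: less_trans [OF less_exp])
  show "2 ^ Suc e \<le> k" if "e < d" for e
    using not_less_Least [of e "\<lambda>d. k < 2 ^ Suc d"] that by (simp add: d_def)
  from this [of "d - 1"] assms show 1: "2 ^ d \<le> k"
    by (cases d) auto
  show "r < 2 ^ d" "k = 2 ^ d + r"
    using 1 2 by (auto simp: r_def)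
qed

text \<open>By the last clause a thread can decide whether its element has a right neighbour: it
  looks for a further child one layer down.\<close>

lemma layer_facts:
  assumes "0 < k" "e \<le> d" "j < layer (Suc e)"
  shows "lo e j < layer e" "\<not> single e j \<Longrightarrow> Suc (lo e j) < layer e"
    "lo e (Suc j) < layer e \<longleftrightarrow> Suc j < layer (Suc e)"
proof -
  have l: "layer (Suc e) = 2 ^ (d - e)"
    by (simp add: layer_def)
  have l0: "layer 0 = 2 ^ d + r"
    using k_bounds(5) [OF assms(1)] by (simp add: layer_def)
  have ls: "e = Suc e' \<Longrightarrow> layer e = 2 * 2 ^ (d - e)" for e'
    using assms(2) by (auto simp: layer_def simp flip: power_Suc)
  show "lo e j < layer e" "\<not> single e j \<Longrightarrow> Suc (lo e j) < layer e"
    "lo e (Suc j) < layer e \<longleftrightarrow> Suc j < layer (Suc e)"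
    using assms(3) l l0 ls k_bounds(4) [OF assms(1)]
    by (cases e; auto simp: lo_def single_def)+
qed

lemma up_lo: "up e (lo e j) = j"
  by (auto simp: up_def lo_def single_def)

lemma has_up_lo: "e \<le> d \<Longrightarrow> has_up e (lo e j)"
  by (auto simp: has_up_def lo_def single_def)

lemma lo_up: "has_up e j \<Longrightarrow> lo e (up e j) = j"
  by (auto simp: up_def lo_def single_def has_up_def)

text \<open>The predecessor of the first child of element \<open>j + 1\<close> is a child of element
  \<open>j\<close>, which is therefore the designated reader of the upward link of that first
  child.\<close>

lemma up_pred: "up e (lo e (Suc j) - 1) = j"
  by (auto simp: up_def lo_def single_def)

lemma up_Suc_lo: "\<not> single e j \<Longrightarrow> up e (Suc (lo e j)) = j"
  by (auto simp: up_def lo_def single_def)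

lemma up_layer:
  assumes "0 < k" "has_up e j" "j < layer e"
  shows "up e j < layer (Suc e)"
proof -
  have "e \<le> d"
    using assms(2) by (simp add: has_up_def)
  then have "e = Suc e' \<Longrightarrow> layer e = 2 * 2 ^ (d - e)" for e'
    by (auto simp: layer_def simp flip: power_Suc)
  then show ?thesis
    using assms k_bounds(4,5) [OF assms(1)] by (cases e) (auto simp: layer_def up_def has_up_def)
qed

end

section \<open>Input nodes, and symbolic execution of scan, counting and ranking\<close>

locale filt_ok = filt +
  fixes S0 :: "nat set"
  assumes K6: "6 \<le> K" and tree: "tree_at m a0 t0 S0" and S0: "S0 \<subseteq> {..<N}"
begin

lemma node:
  assumes "valid p"
  shows "\<exists>S. tree_at m (addr p) (sub p) S \<and> S \<subseteq> {..<N}"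
  using assms
proof (induction p)
  case Nil
  then show ?case
    using tree S0 by auto
next
  case (Cons b p)
  then obtain l r S where "sub p = Branch l r" "tree_at m (addr p) (Branch l r) S" "S \<subseteq> {..<N}"
    by (metis branchE valid.simps(2))
  then show ?case
    by (cases b) auto
qed

lemma root_in: "tree_at m a t S \<Longrightarrow> a \<in> S"
  by (cases t) auto

lemma addr_less: "valid p \<Longrightarrow> addr p < N"
  using node root_in by blast

lemma leaf_mem:
  assumes "valid p" "is_leaf (sub p)"
  shows "m (addr p) 0 = Null" "m (addr p) 4 = leaf_val (sub p)"
  using node [OF assms(1)] leafE [OF assms(2)] by (metis tree_at.simps(1))+

lemma branch_mem:
  assumes "valid p" "\<not> is_leaf (sub p)"
  shows "m (addr p) 0 = NodeP (addr (False # p))" "m (addr p) (Suc 0) = NodeP (addr (True # p))"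
  using node [OF assms(1)] assms(2) by (cases "sub p"; auto)+

text \<open>\<open>tree_at\<close> keeps the node sets of subtrees disjoint. Injectivity gives every
  input node a single scanning thread, so reads of the input by the algorithm do not
  contend.\<close>

lemma addr_inj_below:
  assumes "valid p" "tree_at m (addr p) (sub p) S"
  shows "(\<forall>q \<in> below p. addr q \<in> S) \<and> inj_on addr (below p)"
  using assms
proof (induction "sub p" arbitrary: p S)
  case (Leaf x)
  have "below p = {p}"
    by (rule below_leaf [OF Leaf.prems(1)]) (simp flip: Leaf.hyps)
  then show ?case
    using root_in [OF Leaf.prems(2)] by simp
next
  case (Branch l r)
  have v: "valid (b # p)" for b
    using Branch.prems Branch.hyps(3) by (metis is_leaf.simps(2) valid.simps(2))
  have s: "l = sub (False # p)" "r = sub (True # p)"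
    by (simp_all flip: Branch.hyps(3))
  have branch: "sub p = Branch l r" "\<not> is_leaf (sub p)"
    by (simp_all flip: Branch.hyps(3))
  obtain S1 S2 where S: "tree_at m (addr (False # p)) l S1" "tree_at m (addr (True # p)) r S2"
    "S = insert (addr p) (S1 \<union> S2)" "addr p \<notin> S1 \<union> S2" "S1 \<inter> S2 = {}"
    using Branch.prems(2) unfolding branch(1) by auto
  have b: "below p = insert p (below (False # p) \<union> below (True # p))"
    by (rule below_branch [OF Branch.prems(1) branch(2)])
  have 1: "(\<forall>q \<in> below (False # p). addr q \<in> S1) \<and> inj_on addr (below (False # p))"
    by (rule Branch.hyps(1) [OF s(1) v]) (use S(1) s(1) in simp)
  have 2: "(\<forall>q \<in> below (True # p). addr q \<in> S2) \<and> inj_on addr (below (True # p))"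
    by (rule Branch.hyps(2) [OF s(2) v]) (use S(2) s(2) in simp)
  have "inj_on addr (below (False # p) \<union> below (True # p))"
    using 1 2 S(5) by (subst inj_on_Un) auto
  moreover have "addr p \<notin> addr ` (below (False # p) \<union> below (True # p))"
    using 1 2 S(4) by auto
  ultimately have "inj_on addr (below p)"
    unfolding b by (simp add: inj_on_insert) blast
  then show ?case
    using 1 2 S(3) unfolding b by blast
qed

lemma old_inj: "old \<rho> a \<Longrightarrow> old \<rho>' a \<Longrightarrow> \<rho> = \<rho>'"
proof -
  have "inj_on addr paths"
    using addr_inj_below [of "[]"] tree below_Nil by auto
  then show "old \<rho> a \<Longrightarrow> old \<rho>' a \<Longrightarrow> \<rho> = \<rho>'"
    unfolding old_def paths_def by (auto dest: inj_onD)
qed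

lemma RolesI [simp]:
  "Gate1 \<in> Roles" "Main \<in> Roles" "Scan p \<in> Roles \<longleftrightarrow> valid p" "Eval p \<in> Roles \<longleftrightarrow> valid p"
  "Pow e \<in> Roles \<longleftrightarrow> 0 < k \<and> e \<le> d" "Gate2 \<in> Roles \<longleftrightarrow> 0 < k" "Rank p \<in> Roles \<longleftrightarrow> 0 < k \<and> valid p"
  "Elem e j \<in> Roles \<longleftrightarrow> 0 < k \<and> e \<le> Suc d \<and> j < layer e" "Walk e \<in> Roles \<longleftrightarrow> 0 < k \<and> e \<le> Suc d"
  by (auto simp: Roles_def paths_def)

lemma code [simp]:
  "filter_code ! 0 = main_code" "filter_code ! Suc 0 = gate1_code" "filter_code ! 2 = s1_code"
  "filter_code ! 3 = ev_leaf_code" "filter_code ! 4 = ev_branch_code" "filter_code ! 5 = pow_code"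
  "filter_code ! 6 = gate2_code" "filter_code ! 7 = d_code" "filter_code ! 8 = base_code"
  "filter_code ! 9 = level_code" "filter_code ! 10 = walk_code"
  by (simp_all add: filter_code_def)

lemma K_less [simp]: "0 < K" "Suc 0 < K" "2 < K" "3 < K" "4 < K" "5 < K"
  using K6 by simp_all

lemma old_Scan [simp]: "valid p \<Longrightarrow> old (Scan p) (addr p)"
  by (auto simp: old_def)

lemma scan_facts_simps:
  assumes "valid p"
  shows "is_leaf (sub p) \<Longrightarrow> scan_facts p = {Ended (Scan p)}"
    "\<not> is_leaf (sub p) \<Longrightarrow>
      scan_facts p = insert (Ended (Scan p)) (scan_facts (False # p) \<union> scan_facts (True # p))"
  using below_leaf [OF assms] below_branch [OF assms] by (auto simp: scan_facts_def)

lemma heights: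
  assumes "\<not> is_leaf (sub p)"
  shows "Suc (height (sub (False # p))) \<le> height (sub p)" "Suc (height (sub (True # p))) \<le> height (sub p)"
  using assms by (cases "sub p"; simp)+

text \<open>Rewriting with the equations of \<open>good\<close> is the symbolic execution itself;
  what it leaves are inequalities between stamps and inclusions between sets of facts. Keeping
  \<open>sub\<close> and \<open>addr\<close> folded preserves the names of the children.\<close>

lemma good_Scan:
  assumes "valid p"
  shows "good (Scan p) (start (Scan p)) (K0 (Scan p)) 0 s1_code (init_env (Scan p))"
proof (cases "is_leaf (sub p)")
  case True
  show ?thesis
    using depth [OF assms] assms True leaf_mem [OF assms True] addr_less [OF assms]
    by (simp add: s1_code_def init_env_def scan_facts_simps del: sub.simps)
next
  case False
  have v: "valid (b # p)" for b
    using assms False by simp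
  show ?thesis
    using depth [OF assms] assms False branch_mem [OF assms False] addr_less [OF assms] heights [OF False]
    by (simp add: s1_code_def init_env_def scan_facts_simps v del: sub.simps addr.simps)
      (intro conjI; (linarith | blast))
qed

lemma good_Gate1: "good Gate1 (start Gate1) (K0 Gate1) 0 gate1_code (init_env Gate1)"
  by (auto simp add: gate1_code_def init_env_def H_def)

lemma eval_facts_simps:
  assumes "valid p"
  shows "is_leaf (sub p) \<Longrightarrow> eval_facts p = insert (Ended (Eval p)) (Filled (Rec p) ` {c. c \<noteq> 4})"
    "\<not> is_leaf (sub p) \<Longrightarrow> eval_facts p = insert (Ended (Eval p)) (range (Filled (Rec p)) \<union>
       (eval_facts (False # p) \<union> eval_facts (True # p)))"
  using below_leaf [OF assms] below_branch [OF assms] by (auto simp: eval_facts_def)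

lemma eval_factsI [simp]:
  "valid p \<Longrightarrow> c \<noteq> 4 \<or> \<not> is_leaf (sub p) \<Longrightarrow> Filled (Rec p) c \<in> eval_facts p"
  "valid p \<Longrightarrow> Ended (Eval p) \<in> eval_facts p"
  "valid p \<Longrightarrow> c \<noteq> 4 \<or> \<not> is_leaf (sub p) \<Longrightarrow> Filled (Rec p) c \<in> eval_facts []"
  "valid p \<Longrightarrow> Ended (Eval p) \<in> eval_facts []"
  using below_self [of p] by (auto simp: eval_facts_def below_Nil paths_def)

lemma first_leaf:
  "valid p \<Longrightarrow> is_leaf (sub p) \<Longrightarrow> first p = (if \<phi> (leaf_val (sub p)) then Nd (Rec p) else Raw Null)"
  using kl_rank [of p] by (auto simp: first_def cnt_leaf leafrec_def)

lemma MV_Rec [simp]: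
  "MV (Rec p) 2 = IV (int (cnt p))"
  "valid p \<Longrightarrow> MV (Rec p) 3 = first p"
  "is_leaf (sub p) \<Longrightarrow> MV (Rec p) 0 = Raw Null"
  "is_leaf (sub p) \<Longrightarrow> MV (Rec p) (Suc 0) = Raw (leaf_val (sub p))"
  "is_leaf (sub p) \<Longrightarrow> MV (Rec p) 4 = (if 0 < cnt p then Th (Elem 0 (rank p)) else Raw Null)"
  "valid p \<Longrightarrow> is_leaf (sub p) \<Longrightarrow> MV (Rec p) 5 = first p"
  "\<not> is_leaf (sub p) \<Longrightarrow> MV (Rec p) 0 = Nd (Rec (False # p))"
  "\<not> is_leaf (sub p) \<Longrightarrow> MV (Rec p) (Suc 0) = Nd (Rec (True # p))"
  "\<not> is_leaf (sub p) \<Longrightarrow> MV (Rec p) 4 = IV (int (cnt (False # p)))"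
  "\<not> is_leaf (sub p) \<Longrightarrow> MV (Rec p) 5 = first (True # p)"
  by (auto simp: cnt_leaf first_leaf)

declare MV.simps(1) [simp del]

text \<open>\<open>Filled\<close> facts range over all numbers as cell indices. Cells other than
  those listed expect \<open>Null\<close>, which the creation of the node supplies, so finitely many
  writes suffice.\<close>

lemma MV_Rec_leaf_Null:
  "valid p \<Longrightarrow> is_leaf (sub p) \<Longrightarrow> MV (Rec p) c = Raw Null \<or> c \<in> {1, 2, 3, 4, 5}"
  by (simp add: MV.simps(1))

lemma MV_Rec_branch_Null: "\<not> is_leaf (sub p) \<Longrightarrow> MV (Rec p) c = Raw Null \<or> c \<in> {0, 1, 2, 3, 4, 5}"
  by (simp add: MV.simps(1))

lemma good_Eval_leaf:
  assumes "valid p" "is_leaf (sub p)"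
  shows "good (Eval p) (start (Eval p)) (K0 (Eval p)) 0 ev_leaf_code (init_env (Eval p))"
proof -
  \<comment> \<open>Joining the gate brings the facts of the whole scan, which license the fork of
    the condition.\<close>
  have E: "Eval p \<in> Evals" "cpc (Eval p) = Suc 0" "\<forall>q. valid q \<longrightarrow> Ended (Scan q) \<in> scan_facts []"
    using assms by (auto simp: Evals_def cpc_def scan_facts_def below_Nil paths_def)
  have *: "Filled (Rec p) ` {c. c \<noteq> 4} \<subseteq> F"
    if "\<forall>c \<in> {1, 2, 3, 5}. Filled (Rec p) c \<in> F" "Filled (Rec p) ` {c. MV (Rec p) c = Raw Null} \<subseteq> F" for F
    using that MV_Rec_leaf_Null [OF assms] by blast
  show ?thesis
    using assms E
    by (cases "\<phi> (leaf_val (sub p))"; simp add: ev_leaf_code_def init_env_def old_def access_def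
        cnt_leaf first_leaf eval_facts_simps)
      (simp_all add: X_def, (intro conjI; (linarith | (rule *; auto simp: first_leaf) | blast | auto))+)
qed

lemma first_branch:
  assumes "valid p" "\<not> is_leaf (sub p)"
  shows "first p = (if cnt (False # p) = 0 then first (True # p) else first (False # p))"
  using cnt_branch [OF assms(2)] by (auto simp: first_def)

lemma aeq_leafrec [simp]: "aeq (leafrec i) (Raw Null) = Some (\<not> i < k)"
  by (simp add: leafrec_def)

lemma aeq_first [simp]: "valid p \<Longrightarrow> aeq (first p) (Raw Null) = Some (cnt p = 0)"
  using rank_cnt [of p] by (simp add: first_def)

lemma good_Eval_branch:
  assumes "valid p" "\<not> is_leaf (sub p)"
  shows "good (Eval p) (start (Eval p)) (K0 (Eval p)) 0 ev_branch_code (init_env (Eval p))"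
proof -
  have v: "valid (b # p)" for b
    using assms by simp
  have *: "range (Filled (Rec p)) \<subseteq> F"
    if "\<forall>c \<in> {0, 1, 2, 3, 4, 5}. Filled (Rec p) c \<in> F" "Filled (Rec p) ` {c. MV (Rec p) c = Raw Null} \<subseteq> F" for F
    using that MV_Rec_branch_Null [OF assms(2)] by blast
  show ?thesis
    using assms heights [OF assms(2)]
    by (simp add: ev_branch_code_def init_env_def access_def v first_branch cnt_branch
        eval_facts_simps del: sub.simps valid.simps rank.simps)
      (intro conjI impI; (linarith | (rule *; auto simp: first_leaf) | blast | auto))+
qed

text \<open>By the choice of \<open>d\<close> the chain stops exactly at \<open>e = d\<close>. The
  code compares integers, so the bounds on \<open>k\<close> are carried over from the
  naturals.\<close>

lemma good_Pow:
  assumes "0 < k" "e \<le> d"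
  shows "good (Pow e) (start (Pow e)) (K0 (Pow e)) 0 pow_code (init_env (Pow e))"
proof (cases "e = d")
  case True
  have "int k < 2 ^ d + 2 ^ d"
    using k_bounds(2) [OF assms(1)] by (metis mult_2 of_nat_less_iff of_nat_numeral of_nat_power power_Suc of_nat_add)
  then show ?thesis
    using True by (simp add: pow_code_def init_env_def)
next
  case False
  then have e: "e < d"
    using assms by simp
  have "\<not> int k < 2 ^ e + 2 ^ e"
    using k_bounds(3) [OF assms(1) e] by (metis linorder_not_less mult_2 of_nat_less_iff of_nat_numeral of_nat_power power_Suc of_nat_add)
  then show ?thesis
    using e assms by (simp add: pow_code_def init_env_def)
qed

lemma rank_facts_simps:
  assumes "valid p"
  shows "is_leaf (sub p) \<Longrightarrow> rank_facts p =
      (if 0 < cnt p then {Ended (Rank p), Filled (Rec p) 4} else {})"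
    "\<not> is_leaf (sub p) \<Longrightarrow> rank_facts p = rank_facts (False # p) \<union> rank_facts (True # p)"
  using below_leaf [OF assms] below_branch [OF assms] by (auto simp: rank_facts_def)

lemma rank_factsI [simp]:
  "i < k \<Longrightarrow> Filled (Rec (kl ! i)) 4 \<in> rank_facts []"
  "i < k \<Longrightarrow> Ended (Rank (kl ! i)) \<in> rank_facts []"
  using kl_props [of i] by (auto simp: rank_facts_def below_Nil paths_def cnt_leaf)

text \<open>No accepted leaf lies to the right of the whole tree; accordingly \<open>nxt []\<close>
  is the null pointer passed by the code.\<close>

lemma good_Gate2: "0 < k \<Longrightarrow> good Gate2 (start Gate2) (K0 Gate2) 0 gate2_code (init_env Gate2)"
  by (simp add: gate2_code_def init_env_def nxt_def leafrec_def k_def flip: H_def) auto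

lemma nxt_branch:
  assumes "valid p" "\<not> is_leaf (sub p)"
  shows "nxt (False # p) = (if cnt (True # p) = 0 then nxt p else first (True # p))"
    "nxt (True # p) = nxt p"
  using cnt_branch [OF assms(2)] by (auto simp: nxt_def first_def add.assoc)

lemma good_Rank:
  assumes "valid p" "0 < k"
  shows "good (Rank p) (start (Rank p)) (K0 (Rank p)) 0 d_code (init_env (Rank p))"
proof (cases "is_leaf (sub p)")
  case True
  have "nxt p = leafrec (Suc (rank p))" "rank p < k" "kl ! rank p = p" if "0 < cnt p"
    using that kl_rank [OF assms(1) True] True by (simp_all add: nxt_def cnt_leaf split: if_splits)
  then show ?thesis
    using assms True depth [OF assms(1)]
    by (cases "cnt p = 0"; simp add: d_code_def init_env_def access_def rank_facts_simps
        layer_def del: sub.simps rank.simps)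
next
  case False
  have v: "valid (b # p)" for b
    using assms False by simp
  show ?thesis
    using assms False depth [OF assms(1)] heights [OF False]
    by (simp add: d_code_def init_env_def access_def rank_facts_simps nxt_branch v
        layer_def del: sub.simps valid.simps)
      (intro conjI impI; (linarith | blast | auto))
qed

end

section \<open>Symbolic execution of the layers, the walk and the main thread\<close>

lemma leaves_ne [simp]: "leaves t \<noteq> []"
  by (induction t) auto

context filt_ok
begin

lemma MV_TN [simp]:
  "MV (TN 0 j) 0 = Raw Null" "MV (TN 0 j) (Suc 0) = Raw Null"
  "MV (TN (Suc e) j) 0 = Nd (tlab e (2 * j))" "MV (TN (Suc e) j) (Suc 0) = Nd (tlab e (Suc (2 * j)))"
  "MV (TN e j) 2 = IV (int (height (tr e j)))" "MV (TN e j) 3 = IV (int (length (leaves (tr e j))))"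
  "MV (TN e j) 4 = Raw (hd (leaves (tr e j)))" "MV (TN e j) 5 = Raw (last (leaves (tr e j)))"
  by simp_all

lemma MV_ER [simp]:
  "MV (ER e j) 0 = Nd (tlab e j)"
  "MV (ER e j) (Suc 0) = (if Suc j < layer e then Th (Elem e (Suc j)) else Raw Null)"
  "MV (ER e j) 2 = (if has_up e j then Th (Elem (Suc e) (up e j)) else Raw Null)"
  by simp_all

lemma MV_TN_Null: "MV (TN e j) c = Raw Null \<or> c \<in> {0, 1, 2, 3, 4, 5}"
  by simp

lemma range_TN:
  assumes "\<forall>c \<in> {0, 1, 2, 3, 4, 5}. MV (TN e j) c = Raw Null \<or> Filled (TN e j) c \<in> F"
    "Filled (TN e j) ` {c. MV (TN e j) c = Raw Null} \<subseteq> F"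
  shows "range (Filled (TN e j)) \<subseteq> F"
  using assms MV_TN_Null [of e j] by blast

lemma MV_ER_Null: "MV (ER e j) c = Raw Null \<or> c \<in> {0, 1, 2}"
  by simp

declare MV.simps(2,3) [simp del]

lemma range_ER:
  assumes "\<forall>c \<in> {0, 1, 2}. MV (ER e j) c = Raw Null \<or> Filled (ER e j) c \<in> F"
    "Filled (ER e j) ` {c. MV (ER e j) c = Raw Null} \<subseteq> F"
  shows "range (Filled (ER e j)) \<subseteq> F"
  using assms MV_ER_Null [of e j] by blast

lemma good_base:
  assumes "0 < k" "j < k"
  shows "good (Elem 0 j) (start (Elem 0 j)) (K0 (Elem 0 j)) 0 base_code (init_env (Elem 0 j))"
proof -
  have nx: "leafrec (Suc j) = (if Suc j < k then Nd (Rec (kl ! Suc j)) else Raw Null)"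
    by (simp add: leafrec_def)
  note kj = kl_props [OF assms(2)]
  have kj': "cnt (kl ! j) = 1"
    using kj by (simp add: cnt_leaf)
  have kn: "valid (kl ! Suc j)" "is_leaf (sub (kl ! Suc j))" "cnt (kl ! Suc j) = 1"
    "rank (kl ! Suc j) = Suc j" if "Suc j < k"
    using kl_props [OF that] by (auto simp: cnt_leaf)
  have up: "up 0 j < layer (Suc 0)" "lo 0 (up 0 j) = j" if "has_up 0 j"
    using up_layer [OF assms(1) that] lo_up [OF that] assms(2) by (auto simp: layer_def)
  have sv: "leaf_val (sub (kl ! j)) = item j"
    by (simp add: item_def)
  have mod: "int j mod 2 = 1 \<longleftrightarrow> odd j" "int j mod 2 = 0 \<longleftrightarrow> even j"
    by presburger+
  have div: "int j div 2 = int (j div 2)"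
    by simp
  show ?thesis
  proof (cases "2 * r \<le> j")
    case True
    have u: "up 0 j = j - r" "has_up 0 j" "single 0 (j - r)"
      using True by (auto simp: up_def has_up_def single_def)
    have i: "int (j - r) = int j - int r" "\<not> int j < 2 * int r"
      using True by auto
    show ?thesis
      using assms kj kj' kn up u
      by (cases "Suc j < k"; simp add: base_code_def init_env_def access_def nx sv i
          tlab_def tcre_def layer_def)
        (intro conjI; (rule range_TN range_ER; (simp; fail | blast)))+
  next
    case False
    have u: "up 0 j = j div 2" "has_up 0 j = even j" "\<not> single 0 (j div 2)"
      using False by (auto simp: up_def has_up_def single_def)
    have i: "int j < 2 * int r"
      using False by auto
    show ?thesis
      using assms kj kj' kn up u
      by (cases "Suc j < k"; cases "even j"; simp add: base_code_def init_env_def access_def nx sv i mod div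
          tlab_def tcre_def layer_def)
        (intro conjI; (rule range_TN range_ER; (simp; fail | blast)))+
  qed
qed

lemma tlab_single:
  assumes "single e j"
  shows "tlab (Suc e) j = tlab e (lo e j)" "tcre (Suc e) j = tcre e (lo e j)"
    "tfacts (Suc e) j = tfacts e (lo e j)" "tr (Suc e) j = tr e (lo e j)"
  using assms by (auto simp: tlab_def tcre_def lo_def single_def)

lemma tlab_pair:
  assumes "\<not> single e j"
  shows "tlab (Suc e) j = TN (Suc e) j" "tcre (Suc e) j = Elem (Suc e) j"
    "tfacts (Suc e) j = range (Filled (TN (Suc e) j)) \<union> tfacts e (2 * j) \<union> tfacts e (Suc (2 * j))"
    "tr (Suc e) j = Branch (tr e (2 * j)) (tr e (Suc (2 * j)))" "lo e j = 2 * j"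
  using assms by (auto simp: tlab_def tcre_def lo_def single_def)

lemma tlab_props [simp]:
  "MV (tlab e j) 2 = IV (int (height (tr e j)))" "MV (tlab e j) 3 = IV (int (length (leaves (tr e j))))"
  "MV (tlab e j) 4 = Raw (hd (leaves (tr e j)))" "MV (tlab e j) 5 = Raw (last (leaves (tr e j)))"
  "wr (tlab e j) c = tcre e j" "Filled (tlab e j) c \<in> tfacts e j"
  by (cases e; auto simp: tlab_def tcre_def)+

text \<open>Children that passed through layer 1 alone are represented by their leaf nodes; the
  special case in \<open>rd\<close> for indices from \<open>2 * r\<close> on assigns these to the
  same reader.\<close>

lemma rd_tlab:
  assumes "\<not> single e j"
  shows "rd (tlab e (2 * j)) c = Elem (Suc e) j" "rd (tlab e (Suc (2 * j))) c = Elem (Suc e) j"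
  using assms by (cases e; auto simp: tlab_def single_def)+

lemma good_level:
  assumes k: "0 < k" and e: "e \<le> d" and j: "j < layer (Suc e)"
  shows "good (Elem (Suc e) j) (start (Elem (Suc e) j)) (K0 (Elem (Suc e) j)) 0 level_code
    (init_env (Elem (Suc e) j))"
proof -
  have hu: "has_up (Suc e) j \<longleftrightarrow> e < d \<and> even j" "up (Suc e) j = j div 2"
    by (auto simp: has_up_def up_def)
  have ul: "j div 2 < layer (Suc (Suc e))" if "e < d" "even j"
    using up_layer [OF k _ j] hu that by simp
  have mod: "int j mod 2 = 1 \<longleftrightarrow> odd j" "int j mod 2 = 0 \<longleftrightarrow> even j"
    by presburger+
  have dv: "int j div 2 = int (j div 2)"
    by simp
  \<comment> \<open>The code recognises the top layer by its width 1.\<close>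
  have w1: "(2::int) ^ (d - e) = 1 \<longleftrightarrow> \<not> e < d"
  proof (cases "e < d")
    case True
    then have "1 < (2::int) ^ (d - e)"
      by (intro one_less_power) auto
    with True show ?thesis by linarith
  qed (use e in simp)
  have w2: "(2::int) ^ (d - e) div 2 = 2 ^ (d - Suc e)" if "e < d"
    using that by (cases "d - e") (auto simp: Suc_diff_Suc [symmetric])
  have sng: "single (Suc e) i = False" for i
    by (simp add: single_def)
  have lo2: "lo (Suc e) (j div 2) = j" if "even j"
    using that by (simp add: lo_def sng)
  have ed: "e \<noteq> Suc d" "e \<le> Suc d"
    using e by auto
  note lf = layer_facts [OF k e j]
  \<comment> \<open>Whether a right neighbour exists decides one branch of the code; the case splits
    below follow its other tests.\<close>
  define nj where "nj \<longleftrightarrow> Suc j < layer (Suc e)"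
  have step: "has_up e (lo e (Suc j))" "up e (lo e (Suc j)) = Suc j" "up e (lo e (Suc j) - Suc 0) = j"
    "lo e (Suc j) < layer e \<longleftrightarrow> nj"
    using has_up_lo [OF e] up_lo up_pred lf(3) by (simp_all add: nj_def)
  have sub: "range (Filled (ER (Suc e) j)) \<subseteq> F"
    if "\<forall>c \<in> {0, 1, 2}. MV (ER (Suc e) j) c = Raw Null \<or> Filled (ER (Suc e) j) c \<in> F"
      "Filled (ER (Suc e) j) ` {c. MV (ER (Suc e) j) c = Raw Null} \<subseteq> F" for F
    using that by (rule range_ER)
  show ?thesis
  proof (cases "single e j")
    case True
    have st: "Suc (lo e j) < layer e \<longleftrightarrow> nj" "has_up e (Suc (lo e j))" "up e (Suc (lo e j)) = Suc j"
      "up e (lo e j) = j"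
      using step True up_lo by (auto simp: lo_def single_def)
    show ?thesis
      using k j ed ul lo2 True
      by (cases nj; cases "e < d"; cases "even j"; simp add: level_code_def init_env_def access_def st hu mod dv w1 w2 sng
          tlab_single nj_def [symmetric] del: tr.simps tfacts.simps)
        (intro conjI; (presburger | (rule range_ER; (simp add: hu; fail | blast)) | blast))+
  next
    case False
    note tp = tlab_pair [OF False]
    have l2: "lo e (Suc j) = Suc (Suc (2 * j))"
      using False by (auto simp: lo_def single_def)
    have st: "Suc (Suc (2 * j)) < layer e \<longleftrightarrow> nj" "has_up e (Suc (Suc (2 * j)))"
      "up e (Suc (Suc (2 * j))) = Suc j" "up e (2 * j) = j" "up e (Suc (2 * j)) = j"
      "Suc (2 * j) < layer e" "2 * j < layer e"
      using step [unfolded l2] up_lo [of e j] up_Suc_lo [OF False] lf(1,2) [unfolded tp] False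
      by (simp_all add: tp)
    show ?thesis
      using k j ed ul lo2 False
      by (cases nj; cases "e < d"; cases "even j"; cases "height (tr e (Suc (2 * j))) < height (tr e (2 * j))";
          simp add: level_code_def init_env_def access_def st hu mod dv w1 w2 sng
          tp rd_tlab nj_def [symmetric] del: tr.simps tfacts.simps)
        (intro conjI; (presburger | (rule range_ER range_TN; (simp add: hu; fail | blast)) | blast))+
  qed
qed

lemma layer_pos: "0 < k \<Longrightarrow> 0 < layer e"
  by (simp add: layer_def)

lemma good_Walk:
  assumes "0 < k" "e \<le> Suc d"
  shows "good (Walk e) (start (Walk e)) (K0 (Walk e)) 0 walk_code (init_env (Walk e))"
proof -
  have u: "has_up e 0 \<longleftrightarrow> e \<le> d" "up e 0 = 0"
    by (auto simp: has_up_def up_def)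
  have t: "64 * R + 64 * e = 64 * (R + e)" "fin (Elem e 0) < 64 * (R + e)"
    using assms by (auto simp: R_def)
  show ?thesis
  proof (cases "e \<le> d")
    case True
    then show ?thesis
      using assms u t layer_pos
      by (simp add: walk_code_def init_env_def access_def R_def del: tfacts.simps)
        (intro conjI; (blast | arith))
  next
    case False
    then have "e = Suc d"
      using assms by simp
    then show ?thesis
      using assms u t layer_pos
      by (simp add: walk_code_def init_env_def access_def R_def del: tfacts.simps) blast
  qed
qed

lemma good_Main:
  assumes "v = NodeP a0"
  shows "good Main (start Main) (K0 Main) 0 main_code (init_env Main)"
proof -
  have a: "ain Main = [Raw (NodeP a0)]"
    by (subst ain.simps(1)) (simp only: assms)
  show ?thesis
  proof (cases "k = 0")
    case True
    then show ?thesis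
      by (simp add: main_code_def init_env_def access_def a k_def [symmetric] H_def R_def Q_def del: ain.simps(1))
  next
    case False
    then have k: "0 < k" by simp
    have f: "first [] = Nd (Rec (kl ! 0))" "cnt [] = k"
      using k by (auto simp: first_def leafrec_def k_def)
    note k0 = kl_props [OF k]
    have c0: "cnt (kl ! 0) = 1"
      using k0 by (simp add: cnt_leaf)
    have kr: "int k - 2 ^ d = int r"
      using k_bounds(5) [OF k] by simp
    show ?thesis
      using k k0 c0 f kr rank_factsI [OF k]
      by (simp add: main_code_def init_env_def access_def Q_def R_def a H_def del: tfacts.simps ain.simps(1)) blast
  qed
qed

section \<open>Stamp bound, code size and number of roles\<close>

definition TM :: nat where
  "TM = 64 * (5 * H + 5 * d + 24)"

lemma roles_good:
  assumes "v = NodeP a0" "\<rho> \<in> Roles"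
  shows "good \<rho> (start \<rho>) (K0 \<rho>) 0 (filter_code ! prc \<rho>) (init_env \<rho>)"
proof (cases \<rho>)
  case Main
  then show ?thesis using good_Main [OF assms(1)] by (simp del: start.simps K0.simps)
next
  case Gate1
  then show ?thesis using good_Gate1 by (simp del: start.simps K0.simps)
next
  case (Scan p)
  then show ?thesis using good_Scan assms(2) by (simp del: start.simps K0.simps)
next
  case (Eval p)
  then show ?thesis
    using good_Eval_leaf [of p] good_Eval_branch [of p] assms(2) by (simp del: start.simps K0.simps)
next
  case (Pow e)
  then show ?thesis using good_Pow assms(2) by (simp del: start.simps K0.simps)
next
  case Gate2
  then show ?thesis using good_Gate2 assms(2) by (simp del: start.simps K0.simps)
next
  case (Rank p)
  then show ?thesis using good_Rank assms(2) by (simp del: start.simps K0.simps)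
next
  case (Elem e j)
  then show ?thesis
    using good_base [of j] good_level [of "e - 1" j] assms(2)
    by (cases e) (simp_all add: layer_def del: start.simps K0.simps)
next
  case (Walk e)
  then show ?thesis using good_Walk assms(2) by (simp del: start.simps K0.simps)
qed

text \<open>45 is the length of \<open>level_code\<close>, the longest procedure.\<close>

lemma code_sizes: "prc \<rho> < length filter_code" "length (filter_code ! prc \<rho>) \<le> 45"
proof -
  show "prc \<rho> < length filter_code"
    by (cases \<rho>) (simp_all add: filter_code_def)
  have "\<forall>cs \<in> set filter_code. length cs \<le> 45"
    by (simp add: filter_code_def main_code_def gate1_code_def s1_code_def ev_leaf_code_def
        ev_branch_code_def pow_code_def gate2_code_def d_code_def base_code_def level_code_def
        walk_code_def)
  then show "length (filter_code ! prc \<rho>) \<le> 45"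
    using \<open>prc \<rho> < length filter_code\<close> by (metis nth_mem)
qed

text \<open>The main thread ends last: \<open>64 * (R + 2 * d + 5)\<close> with \<open>Q\<close> and
  \<open>R\<close> expanded is \<open>TM\<close>.\<close>

lemma fin_le: "\<rho> \<in> Roles \<Longrightarrow> fin \<rho> \<le> TM" "X \<le> TM"
proof -
  show "fin \<rho> \<le> TM" if "\<rho> \<in> Roles"
  proof (cases \<rho>)
    case (Scan p)
    then show ?thesis using that depth [of p] by (simp add: TM_def)
  next
    case (Eval p)
    then show ?thesis using that depth [of p] by (simp add: TM_def)
  next
    case (Rank p)
    then show ?thesis using that depth [of p] by (simp add: TM_def Q_def)
  qed (use that in \<open>auto simp: TM_def Q_def R_def\<close>)
qed (simp add: X_def TM_def)

lemma leaf_val_in: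
  assumes "valid p" "is_leaf (sub p)"
  shows "leaf_val (sub p) \<in> set (leaves t0)"
proof -
  have "set (leaves (sub p)) \<subseteq> set (leaves t0)"
    using assms(1)
  proof (induction p)
    case (Cons b p)
    then obtain l r where "sub p = Branch l r"
      by (auto elim: branchE)
    with Cons show ?case
      by (cases b) auto
  qed simp
  then show ?thesis
    using leafE [OF assms(2)] by (metis leaves.simps(1) list.set_intros(1) subsetD)
qed

lemma plan_instance:
  assumes "v = NodeP a0" "cond_code C" "wf_memory K m N"
  shows "plan K filter_code m N \<phi> itm Roles Evals prc ain chd par nlab cre cpc MV ret KD K0 wr rd
    old start fin X C v (leaves t0) Main 45 TM"
proof
  show "finite Roles"
    using card_paths(1) by (auto simp: Roles_def finite_image_set2
        intro!: finite_subset [of "{Elem e j |e j. e \<le> Suc d \<and> j < layer e}" "(\<lambda>(e, j). Elem e j) ` (SIGMA e : {..Suc d}. {..<layer e})"])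
  show "finite Evals"
    by (rule card_Evals)
  fix \<rho>
  assume "\<rho> \<in> Evals"
  then obtain p where p: "\<rho> = Eval p" "valid p" "is_leaf (sub p)"
    by (auto simp: Evals_def)
  show "itm \<rho> \<in> set (leaves t0)"
    using leaf_val_in p by simp
  \<comment> \<open>Items lie in cell 4 of input leaves, so the well-formedness of the memory
    applies to them.\<close>
  have "case m (addr p) 4 of NodeP b \<Rightarrow> b < N | ThreadP u \<Rightarrow> False | _ \<Rightarrow> True"
    using assms(3) addr_less [OF p(2)] K6 by (simp add: wf_memory_def)
  then show "case itm \<rho> of NodeP a \<Rightarrow> a < N | ThreadP u \<Rightarrow> False | _ \<Rightarrow> True"
    using p leaf_mem(2) by simp
qed (use assms(2,3) roles_good [OF assms(1)] code_sizes fin_le old_inj in auto)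

text \<open>The layers contribute \<open>k + 2 ^ Suc d - 1\<close>, at most \<open>3 * n\<close>
  because \<open>2 ^ d\<close> is at most \<open>k\<close>; three families are indexed by at most
  \<open>2 * n\<close> paths each, and the two chains have \<open>Suc d\<close> and
  \<open>Suc d + 1\<close> members. The sum is at most \<open>11 * n + 4\<close>.\<close>

lemma card_Roles: "card Roles \<le> 15 * length (leaves t0)"
proof -
  define n where "n = length (leaves t0)"
  have n: "1 \<le> n" "k \<le> n"
    by (auto simp: n_def k_def cnt_def Suc_le_eq)
  have img: "card (f ` paths) \<le> 2 * n" for f :: "path \<Rightarrow> role"
    using card_image_le [OF card_paths(1)] card_paths(2) unfolding n_def by (rule order_trans)
  have 1: "card ({Main, Gate1} \<union> Scan ` paths \<union> Eval ` paths) \<le> 2 + 2 * n + 2 * n"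
    using img [of Scan] img [of Eval]
      card_Un_le [of "{Main, Gate1} \<union> Scan ` paths" "Eval ` paths"] card_Un_le [of "{Main, Gate1}" "Scan ` paths"]
    by simp
  show ?thesis
  proof (cases "k = 0")
    case True
    then show ?thesis
      using 1 n by (simp add: Roles_def n_def)
  next
    case False
    then have k: "0 < k" by simp
    have "Suc d \<le> 2 ^ d"
      using less_exp [of d] by (simp add: Suc_le_eq)
    then have d: "Suc d \<le> n"
      using k_bounds(1) [OF k] n by linarith
    have E: "{Elem e j | e j. e \<le> Suc d \<and> j < layer e} = (\<lambda>(e, j). Elem e j) ` (SIGMA e : {..Suc d}. {..<layer e})"
      by auto
    have "card {Elem e j | e j. e \<le> Suc d \<and> j < layer e} \<le> card (SIGMA e : {..Suc d}. {..<layer e})"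
      unfolding E by (rule card_image_le) simp
    also have "\<dots> = (\<Sum>e\<le>Suc d. layer e)"
      by (subst card_SigmaI) simp_all
    also have "\<dots> = k + (\<Sum>e<Suc d. layer (Suc e))"
      unfolding lessThan_Suc_atMost by (subst sum.atMost_Suc_shift) (simp add: layer_def)
    also have "(\<Sum>e<Suc d. layer (Suc e)) = (\<Sum>e<Suc d. 2 ^ (Suc d - Suc e))"
      by (intro sum.cong) (auto simp: layer_def)
    also have "\<dots> = (\<Sum>i<Suc d. 2 ^ i)"
      by (rule sum.nat_diff_reindex)
    also have "\<dots> = 2 ^ Suc d - 1"
      by (simp only: lessThan_atLeast0 sum_power2)
    finally have 2: "card {Elem e j | e j. e \<le> Suc d \<and> j < layer e} \<le> 3 * n"
      using k_bounds(1) [OF k] n by simp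
    have "card (Pow ` {..d}) \<le> Suc d" "card (Walk ` {..Suc d}) \<le> Suc (Suc d)"
      using card_image_le [of "{..d}" Pow] card_image_le [of "{..Suc d}" Walk] by simp_all
    moreover define B where "B = {Main, Gate1} \<union> Scan ` paths \<union> Eval ` paths"
    moreover define F where "F = {Elem e j | e j. e \<le> Suc d \<and> j < layer e}"
    moreover have R: "Roles = B \<union> (Pow ` {..d} \<union> {Gate2} \<union> Rank ` paths \<union> F \<union> Walk ` {..Suc d})"
      using False by (simp add: Roles_def B_def F_def)
    moreover have "card {Gate2} = 1"
      by simp
    ultimately have "card Roles \<le> (2 + 2 * n + 2 * n) + (Suc d + 1 + 2 * n + 3 * n + Suc (Suc d))"
      using 1 [folded B_def] 2 [folded F_def] img [of Rank]
        card_Un_le [of B "Pow ` {..d} \<union> {Gate2} \<union> Rank ` paths \<union> F \<union> Walk ` {..Suc d}"]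
        card_Un_le [of "Pow ` {..d} \<union> {Gate2} \<union> Rank ` paths \<union> F" "Walk ` {..Suc d}"]
        card_Un_le [of "Pow ` {..d} \<union> {Gate2} \<union> Rank ` paths" F]
        card_Un_le [of "Pow ` {..d} \<union> {Gate2}" "Rank ` paths"]
        card_Un_le [of "Pow ` {..d}" "{Gate2}"]
      unfolding R by linarith
    then show ?thesis
      using d n(1) unfolding n_def by linarith
  qed
qed

end

text \<open>Both subtrees have at least the height of the tree minus 2, so two further levels at
  least double the number of leaves. This is weaker than the Fibonacci bound, but the height is
  still logarithmic.\<close>

lemma balanced_size: "balanced t \<Longrightarrow> 2 ^ (height t div 2) \<le> length (leaves t)"
proof (induction t)
  case (Branch l r)
  have IH: "2 ^ (height l div 2) \<le> length (leaves l)" "2 ^ (height r div 2) \<le> length (leaves r)"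
    using Branch by auto
  define h where "h = max (height l) (height r)"
  have h: "height (Branch l r) = Suc h" "h \<le> Suc (height l)" "h \<le> Suc (height r)" "h = height l \<or> h = height r"
    using Branch.prems by (auto simp: h_def)
  have mono: "(2::nat) ^ (i div 2) \<le> 2 ^ (j div 2)" if "i \<le> j" for i j :: nat
    using that by (intro power_increasing div_le_mono) auto
  show ?case
  proof (cases "h = 0")
    case True
    then show ?thesis using IH h by simp
  next
    case False
    then obtain h' where h': "h = Suc h'"
      by (cases h) auto
    have "(2::nat) ^ (Suc h div 2) = 2 ^ (h' div 2) + 2 ^ (h' div 2)"
      by (simp add: h')
    also have "\<dots> \<le> 2 ^ (height l div 2) + 2 ^ (height r div 2)"
      using mono [of h' "height l"] mono [of h' "height r"] h h' by (intro add_mono) auto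
    also have "\<dots> \<le> length (leaves (Branch l r))"
      using IH by simp
    finally show ?thesis
      using h(1) by simp
  qed
qed simp

section \<open>Shape, order and memory layout of the output tree\<close>

context filt
begin

fun lset :: "nat \<Rightarrow> nat \<Rightarrow> label set" where
  "lset 0 j = {TN 0 j}"
| "lset (Suc e) j = (if single e j then {TN 0 (j + r)}
     else insert (TN (Suc e) j) (lset e (2 * j) \<union> lset e (Suc (2 * j))))"

end

context filt_ok
begin

text \<open>Layer 1 consists of leaves and pairs, of height 0 or 1, with full level 0; joining two
  trees of one layer puts one full level on top and keeps the difference of heights.\<close>

lemma tr_shape:
  "(height (tr (Suc e) j) = e \<or> height (tr (Suc e) j) = Suc e) \<and> balanced (tr (Suc e) j) \<and>
    (\<forall>q \<le> e. level_size (tr (Suc e) j) q = 2 ^ q)"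
proof (induction e arbitrary: j)
  case (Suc e)
  have s: "\<not> single (Suc e) j"
    by (simp add: single_def)
  have t: "tr (Suc (Suc e)) j = Branch (tr (Suc e) (2 * j)) (tr (Suc e) (Suc (2 * j)))"
    using s by simp
  have "level_size (tr (Suc (Suc e)) j) q = 2 ^ q" if "q \<le> Suc e" for q
    using that Suc.IH [of "2 * j"] Suc.IH [of "Suc (2 * j)"] unfolding t by (cases q) simp_all
  then show ?case
    using Suc.IH [of "2 * j"] Suc.IH [of "Suc (2 * j)"] unfolding t by auto
qed simp

lemma tr_root: "balanced (tr (Suc d) 0)" "complete_tree (tr (Suc d) 0)"
  using tr_shape [of d 0] by (auto simp: complete_tree_def)

lemma lo_mono: "i \<le> j \<Longrightarrow> lo 0 i \<le> lo 0 j"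
  by (auto simp: lo_def single_def)

text \<open>An element of layer \<open>Suc e\<close> covers \<open>2 ^ e\<close> consecutive
  positions of layer 1, and \<open>lo 0\<close> maps such positions to ranks. Being monotone, it
  turns neighbouring blocks into adjacent intervals of ranks.\<close>

lemma leaves_tr:
  "leaves (tr (Suc e) j) = map item [lo 0 (j * 2 ^ e) ..< lo 0 (Suc j * 2 ^ e)]"
proof (induction e arbitrary: j)
  case 0
  show ?case
    by (auto simp: lo_def single_def upt_rec le_Suc_eq)
next
  case (Suc e)
  have t: "tr (Suc (Suc e)) j = Branch (tr (Suc e) (2 * j)) (tr (Suc e) (Suc (2 * j)))"
    by (simp add: single_def)
  have ge: "lo 0 (2 * j * 2 ^ e) \<le> lo 0 (Suc (2 * j) * 2 ^ e)"
    and le: "lo 0 (Suc (2 * j) * 2 ^ e) \<le> lo 0 (Suc (Suc (2 * j)) * 2 ^ e)"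
    by (auto intro!: lo_mono)
  have "[lo 0 (2 * j * 2 ^ e) ..< lo 0 (Suc (Suc (2 * j)) * 2 ^ e)] =
      [lo 0 (2 * j * 2 ^ e) ..< lo 0 (Suc (2 * j) * 2 ^ e)] @
      [lo 0 (Suc (2 * j) * 2 ^ e) ..< lo 0 (Suc (Suc (2 * j)) * 2 ^ e)]"
    using le upt_add_eq_append [OF ge, of "lo 0 (Suc (Suc (2 * j)) * 2 ^ e) - lo 0 (Suc (2 * j) * 2 ^ e)"]
    by (simp del: mult_Suc)
  moreover have "j * 2 ^ Suc e = 2 * j * 2 ^ e" "Suc j * 2 ^ Suc e = Suc (Suc (2 * j)) * 2 ^ e"
    by (simp_all add: algebra_simps)
  ultimately show ?case
    unfolding t leaves.simps Suc.IH map_append [symmetric] by (simp only:)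
qed

lemma leaves_root: "0 < k \<Longrightarrow> leaves (tr (Suc d) 0) = filter \<phi> (leaves t0)"
proof -
  assume k: "0 < k"
  \<comment> \<open>One position past the end of layer 1, \<open>lo 0\<close> yields
    \<open>2 ^ d + r\<close>, the number of accepted items.\<close>
  have "lo 0 0 = 0" "lo 0 (2 ^ d) = k"
    using k_bounds(4,5) [OF k] by (auto simp: lo_def single_def)
  then show ?thesis
    using leaves_tr [of d 0] items_kl by simp
qed

text \<open>The index in layer \<open>e\<close> of the ancestor of element \<open>j'\<close> of
  layer \<open>e'\<close>. Going up halves the index, except for the irregular step from layer 0,
  where \<open>up 0\<close> applies.\<close>

definition anc :: "nat \<Rightarrow> nat \<Rightarrow> nat \<Rightarrow> nat" where
  "anc e' j' e = (if e' = 0 then (if e = 0 then j' else up 0 j' div 2 ^ (e - 1)) else j' div 2 ^ (e - e'))"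

lemma anc_Suc:
  assumes "e' \<le> Suc e"
  shows "anc e' j' (Suc (Suc e)) = anc e' j' (Suc e) div 2"
  using assms by (auto simp: anc_def Suc_diff_le div_mult2_eq [symmetric] mult.commute)

text \<open>A label determines its ancestor in each layer above it, so different elements of one
  layer share no label below them; this gives the disjointness demanded by
  \<open>tree_at\<close>.\<close>

lemma lset_anc: "L \<in> lset e j \<Longrightarrow> \<exists>e' j'. L = TN e' j' \<and> e' \<le> e \<and> anc e' j' e = j"
proof (induction e arbitrary: j)
  case 0
  then show ?case by (simp add: anc_def)
next
  case (Suc e)
  show ?case
  proof (cases "L = TN (Suc e) j \<or> single e j")
    case True
    then consider "L = TN (Suc e) j" | "L = TN 0 (j + r)" "e = 0" "r \<le> j"
      using Suc.prems by (auto simp: single_def)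
    then show ?thesis
    proof cases
      case 1
      then show ?thesis
        by (intro exI [of _ "Suc e"] exI [of _ j]) (simp add: anc_def)
    next
      case 2
      then show ?thesis
        by (intro exI [of _ 0] exI [of _ "j + r"]) (simp add: anc_def up_def)
    qed
  next
    case False
    then obtain c where c: "L \<in> lset e c" "c div 2 = j"
      using Suc.prems by (auto split: if_splits)
    obtain e' j' where L: "L = TN e' j'" "e' \<le> e" "anc e' j' e = c"
      using Suc.IH [OF c(1)] by blast
    have "anc e' j' (Suc e) = j"
    proof (cases e)
      case 0
      then have "e' = 0" "j' = c" "j' < 2 * r \<or> j' div 2 < r"
        using L False c by (auto simp: anc_def single_def)
      then show ?thesis
        using c by (auto simp: anc_def 0 up_def)
    next
      case (Suc e0)
      then show ?thesis
        using anc_Suc [of e' e0 j'] L c by simp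
    qed
    then show ?thesis
      using L by auto
  qed
qed

lemma lset_disjoint: "lset e (2 * j) \<inter> lset e (Suc (2 * j)) = {}"
  using lset_anc [of _ e "2 * j"] lset_anc [of _ e "Suc (2 * j)"] by fastforce

lemma lset_fresh: "TN (Suc e) j \<notin> lset e i"
  using lset_anc [of _ e i] by fastforce

text \<open>Facts speak of single cells, and each provides some address; injectivity of the naming
  makes them speak of the same node. Disjointness of the node sets comes from disjointness of the
  labels.\<close>

lemma tree_built:
  fixes lab :: "nat \<Rightarrow> label option"
  assumes inj: "\<And>a a' L. lab a = Some L \<Longrightarrow> lab a' = Some L \<Longrightarrow> a = a'"
    and "\<And>L c. Filled L c \<in> tfacts e j \<Longrightarrow> \<exists>a. lab a = Some L \<and>
      (\<forall>x. MV L c = Raw x \<longrightarrow> mm a c = x) \<and>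
      (\<forall>L'. MV L c = Nd L' \<longrightarrow> (\<exists>b. mm a c = NodeP b \<and> lab b = Some L'))"
  shows "\<exists>a S. lab a = Some (tlab e j) \<and> tree_at mm a (tr e j) S \<and>
    (\<forall>b \<in> S. \<exists>L \<in> lset e j. lab b = Some L)"
  using assms(2)
proof (induction e arbitrary: j)
  case 0
  have cell: "Filled (TN 0 j) c \<in> tfacts 0 j" for c
    by simp
  obtain a where a: "lab a = Some (TN 0 j)"
    using "0.prems" [OF cell] by blast
  have "mm a c = x" if "MV (TN 0 j) c = Raw x" for c x
    using "0.prems" [OF cell, of c] inj a that by metis
  from this [of 0] this [of "Suc 0"] this [of 2] this [of 3] this [of 4] this [of 5]
  have "tree_at mm a (Leaf (item j)) {a}"
    by simp
  then show ?case
    using a by (intro exI [of _ a] exI [of _ "{a}"]) (simp add: tlab_def)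
next
  case (Suc e)
  show ?case
  proof (cases "single e j")
    case True
    then have e: "e = 0"
      by (simp add: single_def)
    have "\<exists>a S. lab a = Some (tlab 0 (j + r)) \<and> tree_at mm a (tr 0 (j + r)) S \<and>
        (\<forall>b \<in> S. \<exists>L \<in> lset 0 (j + r). lab b = Some L)"
      using Suc.IH [of "j + r"] Suc.prems True unfolding e by auto
    then show ?thesis
      using True unfolding e by (simp add: tlab_def)
  next
    case False
    note tp = tlab_pair [OF False]
    obtain b S1 where b: "lab b = Some (tlab e (2 * j))" "tree_at mm b (tr e (2 * j)) S1"
        "\<forall>b \<in> S1. \<exists>L \<in> lset e (2 * j). lab b = Some L"
      using Suc.IH [of "2 * j"] Suc.prems unfolding tp by blast
    obtain c S2 where c: "lab c = Some (tlab e (Suc (2 * j)))" "tree_at mm c (tr e (Suc (2 * j))) S2"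
        "\<forall>b \<in> S2. \<exists>L \<in> lset e (Suc (2 * j)). lab b = Some L"
      using Suc.IH [of "Suc (2 * j)"] Suc.prems unfolding tp by blast
    have cell: "Filled (TN (Suc e) j) c \<in> tfacts (Suc e) j" for c
      unfolding tp by simp
    obtain a where a: "lab a = Some (TN (Suc e) j)"
      using Suc.prems [OF cell] by blast
    have raw: "mm a i = x" if "MV (TN (Suc e) j) i = Raw x" for i x
      using Suc.prems [OF cell, of i] inj a that by metis
    have nd: "\<exists>b. mm a i = NodeP b \<and> lab b = Some L" if "MV (TN (Suc e) j) i = Nd L" for i L
      using Suc.prems [OF cell, of i] inj a that by metis
    have l: "mm a 0 = NodeP b" "mm a 1 = NodeP c"
      using nd [of 0 "tlab e (2 * j)"] nd [of "Suc 0" "tlab e (Suc (2 * j))"] inj b(1) c(1) by auto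
    have rest: "mm a 2 = IntV (int (height (tr (Suc e) j)))" "mm a 3 = IntV (int (length (leaves (tr (Suc e) j))))"
      "mm a 4 = hd (leaves (tr (Suc e) j))" "mm a 5 = last (leaves (tr (Suc e) j))"
      by (rule raw; simp del: tr.simps)+
    have "S1 \<inter> S2 = {}"
      using b(3) c(3) lset_disjoint [of e j] by fastforce
    moreover have "a \<notin> S1 \<union> S2"
      using b(3) c(3) a lset_fresh by fastforce
    ultimately have "tree_at mm a (tr (Suc e) j) (insert a (S1 \<union> S2))"
      using b(2) c(2) l rest unfolding tp(4) tree_at.simps by blast
    moreover have "\<forall>b \<in> insert a (S1 \<union> S2). \<exists>L \<in> lset (Suc e) j. lab b = Some L"
      using a b(3) c(3) False by auto
    ultimately show ?thesis
      using a unfolding tp(1) by blast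
  qed
qed

end

section \<open>Correctness\<close>

lemma (in plan) outcome:
  assumes run: "(time_step K P)\<^sup>*\<^sup>* (init_config m N v) \<sigma>"
    and ev: "evaluates K P xs \<phi> \<sigma>" and cost: "evaluation_cost xs w s \<sigma>"
  shows "real (dag_work \<sigma>) \<le> real (card Roles * M) + real (card Evals) * max w 0"
    "real (dag_span \<sigma>) \<le> real TM + 1 + max s 0"
    "finished K P \<sigma> \<Longrightarrow> \<exists>x. status (thr \<sigma> 0) = Done x"
    "status (thr \<sigma> 0) = Done y \<Longrightarrow> \<exists>lab rl. labs_ok lab rl \<sigma> \<and> rep lab rl y (ret main) \<and>
       (\<forall>f \<in> KD main. holds lab rl \<sigma> f)"
proof -
  have wf: "wf_config \<sigma>"
    by (rule run_wf [OF run])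
  obtain lab rl tau where core: "core lab rl tau \<sigma>"
    using run_core [OF run evaluates_honest [OF ev]] by blast
  show "real (dag_work \<sigma>) \<le> real (card Roles * M) + real (card Evals) * max w 0"
    by (rule work_bound [OF core wf cost]) simp_all
  show "real (dag_span \<sigma>) \<le> real TM + 1 + max s 0"
    by (rule span_bound [OF core wf cost ev]) simp_all
  show "finished K P \<sigma> \<Longrightarrow> \<exists>x. status (thr \<sigma> 0) = Done x"
    by (rule finished_done [OF core wf ev])
  show "status (thr \<sigma> 0) = Done y \<Longrightarrow> \<exists>lab rl. labs_ok lab rl \<sigma> \<and> rep lab rl y (ret main) \<and>
       (\<forall>f \<in> KD main. holds lab rl \<sigma> f)"
    using result [OF core] coreD(2) [OF core] by blast
qed

lemma (in filt_ok) filter_output: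
  assumes v: "v = NodeP a0" and C: "cond_code C" and wm: "wf_memory K m N"
    and run: "(time_step K (link filter_code C))\<^sup>*\<^sup>* (init_config m N v) \<sigma>"
    and ev: "evaluates K (link filter_code C) (leaves t0) \<phi> \<sigma>"
    and cost: "evaluation_cost (leaves t0) w s \<sigma>" and y: "status (thr \<sigma> 0) = Done y"
  shows "\<exists>T'. batch_at (mem \<sigma>) (nnodes \<sigma>) y T' \<and> complete_batch T' \<and> items T' = filter \<phi> (leaves t0)"
proof -
  interpret p: plan K filter_code m N \<phi> itm Roles Evals prc ain chd par nlab cre cpc MV ret KD K0 wr rd
    old start fin X C v "leaves t0" Main 45 TM
    by (rule plan_instance [OF v C wm])
  obtain lab rl where labs: "p.labs_ok lab rl \<sigma>" and rep: "p.rep lab rl y (ret Main)"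
    and KD: "\<forall>f \<in> KD Main. p.holds lab rl \<sigma> f"
    using p.outcome(4) [OF run ev cost y] by blast
  have inj: "lab a = Some L \<Longrightarrow> lab a' = Some L \<Longrightarrow> a = a'" and less: "lab a = Some L \<Longrightarrow> a < nnodes \<sigma>" for a a' L
    using labs unfolding p.labs_ok_def by blast+
  show ?thesis
  proof (cases "k = 0")
    case True
    then have "y = Null"
      using rep by simp
    moreover have "filter \<phi> (leaves t0) = []"
      using True by (simp add: k_def cnt_def)
    ultimately show ?thesis
      by (intro exI [of _ None]) (simp add: batch_at_def complete_batch_def items_def)
  next
    case False
    then have k: "0 < k" by simp
    obtain a where a: "y = NodeP a" "lab a = Some (tlab (Suc d) 0)"
      using rep False by auto
    have cell: "\<exists>a. lab a = Some L \<and> (\<forall>x. MV L c = Raw x \<longrightarrow> mem \<sigma> a c = x) \<and>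
        (\<forall>L'. MV L c = Nd L' \<longrightarrow> (\<exists>b. mem \<sigma> a c = NodeP b \<and> lab b = Some L'))"
      if "Filled L c \<in> tfacts (Suc d) 0" for L c
    proof -
      have "Filled L c \<in> KD Main"
        using that False by (simp del: tfacts.simps)
      then have "p.holds lab rl \<sigma> (Filled L c)"
        using KD by blast
      then obtain b where "lab b = Some L" "p.rep lab rl (mem \<sigma> b c) (MV L c)"
        by auto
      then show ?thesis
        by (intro exI [of _ b]) auto
    qed
    have "\<exists>a' S. lab a' = Some (tlab (Suc d) 0) \<and> tree_at (mem \<sigma>) a' (tr (Suc d) 0) S \<and>
        (\<forall>b \<in> S. \<exists>L \<in> lset (Suc d) 0. lab b = Some L)"
      by (rule tree_built) (fact inj, fact cell)
    then obtain a' S where S: "lab a' = Some (tlab (Suc d) 0)" "tree_at (mem \<sigma>) a' (tr (Suc d) 0) S"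
        "\<forall>b \<in> S. \<exists>L \<in> lset (Suc d) 0. lab b = Some L"
      by blast
    have "a' = a"
      by (rule inj [OF S(1) a(2)])
    moreover have "S \<subseteq> {..<nnodes \<sigma>}"
      using S(3) less by blast
    ultimately have "batch_at (mem \<sigma>) (nnodes \<sigma>) y (Some (tr (Suc d) 0))"
      using S(2) a(1) tr_root(1) by (auto simp: batch_at_def simp del: tr.simps)
    moreover have "items (Some (tr (Suc d) 0)) = filter \<phi> (leaves t0)"
      using leaves_root [OF k] by (simp add: items_def del: tr.simps)
    ultimately show ?thesis
      using tr_root(2) by (intro exI [of _ "Some (tr (Suc d) 0)"]) (simp add: complete_batch_def del: tr.simps)
  qed
qed

text \<open>With \<open>l\<close> the logarithm, \<open>H\<close> is at most
  \<open>2 * l + 1\<close> and \<open>d\<close> at most \<open>l\<close>, so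
  \<open>64 * (5 * H + 5 * d + 24)\<close> is at most \<open>64 * (15 * l + 29)\<close>.\<close>

lemma (in filt_ok) TM_bound:
  assumes "balanced t0"
  shows "real TM \<le> 960 * log 2 (real (length (leaves t0))) + 1856"
proof -
  define l where "l = log 2 (real (length (leaves t0)))"
  have "real (H div 2) \<le> l"
    using le_log2_of_power [OF balanced_size [OF assms]] by (simp add: H_def l_def)
  moreover have "real H \<le> 2 * real (H div 2) + 1"
    by linarith
  moreover have "real d \<le> l"
  proof (cases "k = 0")
    case True
    then have "d = 0"
      unfolding d_def by (intro Least_eq_0) simp
    moreover have "1 \<le> real (length (leaves t0))"
      by (simp add: Suc_le_eq)
    ultimately show ?thesis
      by (simp add: l_def)
  next
    case False
    have "2 ^ d \<le> length (leaves t0)"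
      using k_bounds(1) False length_filter_le [of \<phi> "leaves t0"] by (auto simp: k_def cnt_def intro: order_trans)
    then show ?thesis
      using le_log2_of_power by (simp add: l_def)
  qed
  ultimately show ?thesis
    unfolding TM_def l_def [symmetric] by simp
qed

text \<open>On the empty batch the first thread returns at once, so a single role and trivial ghost data do.\<close>

lemma plan_empty:
  assumes "cond_code C" "wf_memory K m N"
  shows "plan K filter_code m N \<phi> (\<lambda>_. Null) {()} {} (\<lambda>_. 0) (\<lambda>_. [Raw Null]) (\<lambda>_ _. ()) (\<lambda>_. None)
    (\<lambda>_ _. ()) (\<lambda>_. ((), 0)) (\<lambda>_. 0) (\<lambda>_ _. Raw Null) (\<lambda>_. Raw Null) (\<lambda>_. {}) (\<lambda>_. {}) (\<lambda>_ _. ())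
    (\<lambda>_ _. ()) (\<lambda>_ _. False) (\<lambda>_. 0) (\<lambda>_. 2) 0 C Null [] () 20 2"
  by unfold_locales
    (use assms in \<open>auto simp: plan_sig.good.simps plan_sig.init_env_def filter_code_def main_code_def\<close>)

text \<open>\<open>b\<close> is the constant hidden in the cost of the condition and
  \<open>c\<close>, chosen after \<open>b\<close>, the one in the conclusion; the code is fixed
  before both. Total correctness is spread over three claims: no run is infinite, a finished run has
  a result, and any result is correct. The bounds hold for unfinished runs, too.\<close>

theorem mainTheorem4:
  fixes K :: nat
  assumes "6 \<le> K"
  shows "\<exists>A :: instr list list. \<forall>b :: real. \<exists>c :: real.
    \<forall>(C :: instr list list) (\<phi> :: val \<Rightarrow> bool) (w :: real) (s :: real)
     (m :: nat \<Rightarrow> nat \<Rightarrow> val) (N :: nat) (v :: val) (T :: batch).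
      cond_code C \<longrightarrow> 1 \<le> w \<longrightarrow> 1 \<le> s \<longrightarrow> wf_memory K m N \<longrightarrow> batch_at m N v T \<longrightarrow>
      (let P = link A C;
           n = real (length (items T));
           ok = (\<lambda>\<sigma>. evaluates K P (items T) \<phi> \<sigma> \<and>
                     evaluation_cost (items T) (b * w) (b * s) \<sigma>)
       in
        (\<forall>\<sigma>. (time_step K P)\<^sup>*\<^sup>* (init_config m N v) \<sigma> \<longrightarrow> ok \<sigma> \<longrightarrow>
           (1 \<le> n \<longrightarrow> real (dag_work \<sigma>) \<le> c * (n * w) \<and> real (dag_span \<sigma>) \<le> c * (log 2 n + s)) \<and>
           (\<forall>v'. status (thr \<sigma> 0) = Done v' \<longrightarrow>
              (\<exists>T'. batch_at (mem \<sigma>) (nnodes \<sigma>) v' T' \<and> complete_batch T' \<and>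
                 items T' = filter \<phi> (items T))) \<and>
           (finished K P \<sigma> \<longrightarrow> (\<exists>v'. status (thr \<sigma> 0) = Done v'))) \<and>
        \<not> (\<exists>\<rho>. \<rho> 0 = init_config m N v \<and>
              (\<forall>k. time_step K P (\<rho> k) (\<rho> (Suc k)) \<and> ok (\<rho> k))))"
proof (intro exI [of _ filter_code] allI)
  fix b :: real
  show "\<exists>c :: real.
    \<forall>(C :: instr list list) (\<phi> :: val \<Rightarrow> bool) (w :: real) (s :: real)
     (m :: nat \<Rightarrow> nat \<Rightarrow> val) (N :: nat) (v :: val) (T :: batch).
      cond_code C \<longrightarrow> 1 \<le> w \<longrightarrow> 1 \<le> s \<longrightarrow> wf_memory K m N \<longrightarrow> batch_at m N v T \<longrightarrow>
      (let P = link filter_code C;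
           n = real (length (items T));
           ok = (\<lambda>\<sigma>. evaluates K P (items T) \<phi> \<sigma> \<and>
                     evaluation_cost (items T) (b * w) (b * s) \<sigma>)
       in
        (\<forall>\<sigma>. (time_step K P)\<^sup>*\<^sup>* (init_config m N v) \<sigma> \<longrightarrow> ok \<sigma> \<longrightarrow>
           (1 \<le> n \<longrightarrow> real (dag_work \<sigma>) \<le> c * (n * w) \<and> real (dag_span \<sigma>) \<le> c * (log 2 n + s)) \<and>
           (\<forall>v'. status (thr \<sigma> 0) = Done v' \<longrightarrow>
              (\<exists>T'. batch_at (mem \<sigma>) (nnodes \<sigma>) v' T' \<and> complete_batch T' \<and>
                 items T' = filter \<phi> (items T))) \<and>
           (finished K P \<sigma> \<longrightarrow> (\<exists>v'. status (thr \<sigma> 0) = Done v'))) \<and>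
        \<not> (\<exists>\<rho>. \<rho> 0 = init_config m N v \<and>
              (\<forall>k. time_step K P (\<rho> k) (\<rho> (Suc k)) \<and> ok (\<rho> k))))"
    unfolding Let_def
  \<comment> \<open>The algorithm takes work \<open>45 * 15 = 675\<close> per item and span at most
    \<open>960 * log 2 n + 1857\<close>; 2000 exceeds these numbers, \<open>s \<ge> 1\<close>
    absorbs the constant term, and \<open>\<bar>b\<bar>\<close> pays for the evaluations, also when
    \<open>b\<close> is negative.\<close>
  proof (intro exI [of _ "2000 + \<bar>b\<bar>"] allI impI)
    fix C :: "instr list list" and \<phi> :: "val \<Rightarrow> bool" and w s :: real
      and m :: "nat \<Rightarrow> nat \<Rightarrow> val" and N :: nat and v :: val and T :: batch
    assume C: "cond_code C" and w: "1 \<le> w" and s: "1 \<le> s" and wm: "wf_memory K m N"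
      and T: "batch_at m N v T"
    define P where "P = link filter_code C"
    define n where "n = real (length (items T))"
    define ok where "ok \<sigma> \<longleftrightarrow> evaluates K P (items T) \<phi> \<sigma> \<and> evaluation_cost (items T) (b * w) (b * s) \<sigma>" for \<sigma>
    define c where "c = 2000 + \<bar>b\<bar>"
    have "(\<forall>\<sigma>. (time_step K P)\<^sup>*\<^sup>* (init_config m N v) \<sigma> \<longrightarrow> ok \<sigma> \<longrightarrow>
           (1 \<le> n \<longrightarrow> real (dag_work \<sigma>) \<le> c * (n * w) \<and> real (dag_span \<sigma>) \<le> c * (log 2 n + s)) \<and>
           (\<forall>v'. status (thr \<sigma> 0) = Done v' \<longrightarrow>
              (\<exists>T'. batch_at (mem \<sigma>) (nnodes \<sigma>) v' T' \<and> complete_batch T' \<and>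
                 items T' = filter \<phi> (items T))) \<and>
           (finished K P \<sigma> \<longrightarrow> (\<exists>v'. status (thr \<sigma> 0) = Done v'))) \<and>
        \<not> (\<exists>\<rho>. \<rho> 0 = init_config m N v \<and>
              (\<forall>k. time_step K P (\<rho> k) (\<rho> (Suc k)) \<and> ok (\<rho> k)))"
    proof (cases T)
      case None
      then have v: "v = Null" and it: "items T = []"
        using T by (simp_all add: batch_at_def items_def)
      interpret p: plan K filter_code m N \<phi> "\<lambda>_. Null" "{()}" "{}" "\<lambda>_. 0" "\<lambda>_. [Raw Null]" "\<lambda>_ _. ()"
        "\<lambda>_. None" "\<lambda>_ _. ()" "\<lambda>_. ((), 0)" "\<lambda>_. 0" "\<lambda>_ _. Raw Null" "\<lambda>_. Raw Null" "\<lambda>_. {}" "\<lambda>_. {}"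
        "\<lambda>_ _. ()" "\<lambda>_ _. ()" "\<lambda>_ _. False" "\<lambda>_. 0" "\<lambda>_. 2" 0 C Null "[]" "()" 20 2
        by (rule plan_empty [OF C wm])
      have "\<exists>T'. batch_at (mem \<sigma>) (nnodes \<sigma>) y T' \<and> complete_batch T' \<and> items T' = []"
        if "(time_step K P)\<^sup>*\<^sup>* (init_config m N Null) \<sigma>" "ok \<sigma>" "status (thr \<sigma> 0) = Done y" for \<sigma> y
      proof -
        have "y = Null"
          using p.outcome(4) [of \<sigma> "b * w" "b * s" y] that unfolding ok_def it P_def by auto
        then show ?thesis
          by (intro exI [of _ None]) (simp add: batch_at_def complete_batch_def items_def)
      qed
      moreover have "\<exists>y. status (thr \<sigma> 0) = Done y"
        if "(time_step K P)\<^sup>*\<^sup>* (init_config m N Null) \<sigma>" "ok \<sigma>" "finished K P \<sigma>" for \<sigma>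
        using p.outcome(3) [of \<sigma> "b * w" "b * s"] that unfolding ok_def it P_def by blast
      moreover have "\<not> (\<exists>\<rho>. \<rho> 0 = init_config m N Null \<and>
          (\<forall>k. time_step K P (\<rho> k) (\<rho> (Suc k)) \<and> ok (\<rho> k)))"
        using p.terminates [of _ "b * w" "b * s"] unfolding ok_def it P_def by blast
      ultimately show ?thesis
        using v it by (simp add: n_def)
    next
      case (Some t)
      then obtain a S where v: "v = NodeP a" and t: "balanced t" "tree_at m a t S" "S \<subseteq> {..<N}"
        and it: "items T = leaves t"
        using T by (auto simp: batch_at_def items_def)
      interpret f: filt_ok K m N \<phi> t a v S
        using assms t by unfold_locales
      interpret p: plan K filter_code m N \<phi> f.itm f.Roles f.Evals f.prc f.ain f.chd f.par f.nlab f.cre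
        f.cpc f.MV f.ret f.KD f.K0 f.wr f.rd f.old f.start f.fin f.X C v "leaves t" Main 45 f.TM
        by (rule f.plan_instance [OF v C wm])
      have n: "1 \<le> n" "n = real (length (leaves t))"
        by (auto simp: n_def it Suc_le_eq)
      have nw: "n \<le> n * w"
        using n(1) w by simp
      have work: "real (dag_work \<sigma>) \<le> c * (n * w)"
        if "(time_step K P)\<^sup>*\<^sup>* (init_config m N v) \<sigma>" "ok \<sigma>" for \<sigma>
      proof -
        have "real (dag_work \<sigma>) \<le> real (card f.Roles * 45) + real (card f.Evals) * max (b * w) 0"
          using p.outcome(1) that unfolding ok_def it P_def by blast
        moreover have "real (card f.Roles * 45) \<le> 675 * n"
          using f.card_Roles n(2) by linarith
        moreover have "real (card f.Evals) * max (b * w) 0 \<le> n * (\<bar>b\<bar> * w)"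
          using f.card_Evals(2) n(2) w by (intro mult_mono) (auto simp: abs_mult mult_right_mono)
        ultimately have "real (dag_work \<sigma>) \<le> 675 * (n * w) + \<bar>b\<bar> * (n * w)"
          using nw by (simp add: mult.left_commute)
        then show ?thesis
          using nw n(1) unfolding c_def distrib_right by linarith
      qed
      have span: "real (dag_span \<sigma>) \<le> c * (log 2 n + s)"
        if "(time_step K P)\<^sup>*\<^sup>* (init_config m N v) \<sigma>" "ok \<sigma>" for \<sigma>
      proof -
        have "real (dag_span \<sigma>) \<le> real f.TM + 1 + max (b * s) 0"
          using p.outcome(2) that unfolding ok_def it P_def by blast
        moreover have "real f.TM \<le> 960 * log 2 n + 1856"
          using f.TM_bound [OF t(1)] n(2) by simp
        moreover have "max (b * s) 0 \<le> \<bar>b\<bar> * s"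
          using s by (auto simp: mult_right_mono)
        moreover have l: "0 \<le> log 2 n"
          using n(1) by simp
        moreover have "0 \<le> \<bar>b\<bar> * log 2 n"
          using l by simp
        moreover have "c * (log 2 n + s) = 2000 * log 2 n + 2000 * s + \<bar>b\<bar> * log 2 n + \<bar>b\<bar> * s"
          by (simp add: c_def algebra_simps)
        ultimately show ?thesis
          using s by linarith
      qed
      have out: "\<exists>T'. batch_at (mem \<sigma>) (nnodes \<sigma>) y T' \<and> complete_batch T' \<and> items T' = filter \<phi> (items T)"
        if "(time_step K P)\<^sup>*\<^sup>* (init_config m N v) \<sigma>" "ok \<sigma>" "status (thr \<sigma> 0) = Done y" for \<sigma> y
        using f.filter_output [OF v C wm] that unfolding ok_def it P_def by blast
      have fin: "\<exists>y. status (thr \<sigma> 0) = Done y"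
        if "(time_step K P)\<^sup>*\<^sup>* (init_config m N v) \<sigma>" "ok \<sigma>" "finished K P \<sigma>" for \<sigma>
        using p.outcome(3) that unfolding ok_def it P_def by blast
      have trm: "\<not> (\<exists>\<rho>. \<rho> 0 = init_config m N v \<and>
          (\<forall>k. time_step K P (\<rho> k) (\<rho> (Suc k)) \<and> ok (\<rho> k)))"
        using p.terminates [of _ "b * w" "b * s"] unfolding ok_def it P_def by blast
      show ?thesis
        using work span out fin trm by blast
    qed
    then show "(\<forall>\<sigma>. (time_step K (link filter_code C))\<^sup>*\<^sup>* (init_config m N v) \<sigma> \<longrightarrow>
           evaluates K (link filter_code C) (items T) \<phi> \<sigma> \<and>
             evaluation_cost (items T) (b * w) (b * s) \<sigma> \<longrightarrow>
           (1 \<le> real (length (items T)) \<longrightarrow>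
              real (dag_work \<sigma>) \<le> (2000 + \<bar>b\<bar>) * (real (length (items T)) * w) \<and>
              real (dag_span \<sigma>) \<le> (2000 + \<bar>b\<bar>) * (log 2 (real (length (items T))) + s)) \<and>
           (\<forall>v'. status (thr \<sigma> 0) = Done v' \<longrightarrow>
              (\<exists>T'. batch_at (mem \<sigma>) (nnodes \<sigma>) v' T' \<and> complete_batch T' \<and>
                 items T' = filter \<phi> (items T))) \<and>
           (finished K (link filter_code C) \<sigma> \<longrightarrow> (\<exists>v'. status (thr \<sigma> 0) = Done v'))) \<and>
        \<not> (\<exists>\<rho>. \<rho> 0 = init_config m N v \<and>
              (\<forall>k. time_step K (link filter_code C) (\<rho> k) (\<rho> (Suc k)) \<and>
                 evaluates K (link filter_code C) (items T) \<phi> (\<rho> k) \<and>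
                 evaluation_cost (items T) (b * w) (b * s) (\<rho> k)))"
      unfolding ok_def n_def c_def P_def .
  qed
qed

end
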